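(* Let $\delta>0$ and let $\mathcal{S}\subset\mathbb{R}^{n+1}$ be a complete properly immersed hypersurface with $\delta$-separated ends. Suppose that there exist an embedding $\alpha:\mathbb{S}^{n-1}\to\mathcal{S}$ such that $\mathcal{S}\setminus\alpha(\mathbb{S}^{n-1})$ has two disjoint connected components, called $\mathcal{S}^+$ and $\mathcal{S}^-$, and a set $A\subset\mathbb{S}^n$ of nonzero $n$-dimensional Lebesgue measure with the following properties: whenever $\tilde e=(e_1,\dots,e_{n+1})$ is an orthonormal basis of $\mathbb{R}^{n+1}$ with $e_{n+1}\in A$, then in the coordinates determined by $\tilde e$: (1) there exist $x=(x_1,\dots,x_n,x_{n+1})\in\mathcal{S}^-$ and $y=(x_1,\dots,x_n,y_{n+1})\in\mathcal{S}^+$ such that $y_{n+1}<x_{n+1}$; (2) there exists a neighborhood $\mathcal{V}$ of $\alpha(\mathbb{S}^{n-1})$ in the closure of $\mathcal{S}^-$ such that if $a=(z_1,\dots,z_n,a_{n+1})\in\mathcal{V}$, then there is a point $u=(z_1,\dots,z_n,u_{n+1})\in\mathcal{S}^-$ with $a_{n+1}>u_{n+1}$ such that there is no $v=(z_1,\dots,z_n,v_{n+1})\in\mathcal{S}^+$ with $a_{n+1}>v_{n+1}>u_{n+1}$; (3) if $z=(z_1,\dots,z_{n+1})\in\alpha(\mathbb{S}^{n-1})$ and $b=(z_1,\dots,z_n,b_{n+1})\in\mathcal{S}^-$ satisfy $b_{n+1}>z_{n+1}$, then there is $w=(z_1,\dots,z_n,w_{n+1})\in\mathcal{S}^+$ such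 that $b_{n+1}>w_{n+1}>z_{n+1}$. Then $\mathcal{S}$ is not a self-shrinker.
   Context: A hypersurface $\Sigma\subset\mathbb{R}^{n+1}$ is a self-shrinker if it satisfies $H=\frac{\langle x,\nu\rangle}{2}$, where $\nu$ is the (outer) unit normal vector, $H=\operatorname{div}(\nu)$ is the mean curvature and $x$ is the position vector. $\delta$-separated ends: a properly immersed hypersurface $\mathcal{S}\subset\mathbb{R}^{n+1}$ has $\delta$-separated ends if the following holds for every pair of disjoint open connected subsets $\mathcal{S}_1,\mathcal{S}_2$ of $\mathcal{S}$ such that $\overline{\mathcal{S}_1}\cup\overline{\mathcal{S}_2}=\mathcal{S}$ (closures in $\mathcal{S}$), $\partial\overline{\mathcal{S}_1}=\partial\overline{\mathcal{S}_2}$, and this common boundary is bounded: for all $r$ sufficiently large, either one of the sets $(\frac1r\mathcal{S}_i)\setminus B(0,1)$, $i=1,2$, is empty, or $\inf\{\|x_1-x_2\| : x_i\in(\frac1r\mathcal{S}_i)\setminus B(0,1),\ i=1,2\}\ge\delta$. Here $B(0,1)$ is the unit ball centered at the origin. (In particular, compact hypersurfaces automatically have $\delta$-separated ends.) *)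

theory Defs
  imports "HOL-Analysis.Analysis"
begin

text \<open>
  Throughout, the dimension of \<open>'b\<close> is \<open>n\<close> and the dimension of \<open>'a\<close> is \<open>n + 1\<close>. So \<open>'b\<close> is the
  parameter space of an \<open>n\<close>-dimensional manifold, \<open>sphere (0::'b) 1\<close> is the \<open>(n-1)\<close>-sphere, and
  \<open>sphere (0::'a) 1\<close> is the \<open>n\<close>-sphere in the ambient space.
\<close>

subsection \<open>Smooth manifolds and immersed hypersurfaces\<close>

text \<open>The following two notions are only used on open sets \<open>U\<close>.\<close>

fun Ck_on :: "nat \<Rightarrow> 'b::euclidean_space set \<Rightarrow> ('b \<Rightarrow> 'c::euclidean_space) \<Rightarrow> bool" where
  "Ck_on 0 U f \<longleftrightarrow> continuous_on U f"
| "Ck_on (Suc k) U f \<longleftrightarrow>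
     f differentiable_on U \<and> (\<forall>v. Ck_on k U (\<lambda>x. frechet_derivative f (at x) v))"

definition smooth_on :: "'b::euclidean_space set \<Rightarrow> ('b \<Rightarrow> 'c::euclidean_space) \<Rightarrow> bool" where
  "smooth_on U f \<longleftrightarrow> (\<forall>k. Ck_on k U f)"

text \<open>
  An atlas is given by local parametrisations \<open>(V, \<phi>)\<close>, with \<open>\<phi>\<close> a homeomorphism from an open set
  \<open>V\<close> of \<open>'b\<close> onto an open subset of \<open>M\<close>; the charts are the inverses of the maps \<open>\<phi>\<close>. Manifolds
  have no boundary and are not assumed to be connected.
\<close>

definition smooth_manifold ::
    "'m topology \<Rightarrow> ('b::euclidean_space set \<times> ('b \<Rightarrow> 'm)) set \<Rightarrow> bool" where
  "smooth_manifold M \<Phi> \<longleftrightarrow>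
     Hausdorff_space M \<and> second_countable M \<and>
     (\<forall>(V, \<phi>) \<in> \<Phi>. open V \<and> openin M (\<phi> ` V) \<and>
        homeomorphic_map (top_of_set V) (subtopology M (\<phi> ` V)) \<phi>) \<and>
     topspace M = (\<Union>(V, \<phi>) \<in> \<Phi>. \<phi> ` V) \<and>
     (\<forall>(V, \<phi>) \<in> \<Phi>. \<forall>(W, \<psi>) \<in> \<Phi>.
        smooth_on {u \<in> V. \<phi> u \<in> \<psi> ` W} (inv_into W \<psi> \<circ> \<phi>))"

definition smooth_immersion ::
    "('b::euclidean_space set \<times> ('b \<Rightarrow> 'm)) set \<Rightarrow> ('m \<Rightarrow> 'a::euclidean_space) \<Rightarrow> bool" where
  "smooth_immersion \<Phi> F \<longleftrightarrow>
     (\<forall>(V, \<phi>) \<in> \<Phi>. smooth_on V (F \<circ> \<phi>) \<and>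
        (\<forall>u\<in>V. inj (frechet_derivative (F \<circ> \<phi>) (at u))))"

definition properly_immersed_hypersurface ::
    "'m topology \<Rightarrow> ('b::euclidean_space set \<times> ('b \<Rightarrow> 'm)) set \<Rightarrow> ('m \<Rightarrow> 'a::euclidean_space)
      \<Rightarrow> bool" where
  "properly_immersed_hypersurface M \<Phi> F \<longleftrightarrow>
     DIM('a) = DIM('b) + 1 \<and> smooth_manifold M \<Phi> \<and> smooth_immersion \<Phi> F \<and>
     proper_map M euclidean F"

text \<open>
  Riemannian distance of the metric induced by \<open>F\<close>: the infimum of the lengths of the piecewise
  \<open>C\<^sup>1\<close> curves. As \<open>F\<close> is an immersion, a continuous curve in \<open>M\<close> is (piecewise) \<open>C\<^sup>1\<close> iff its image
  under \<open>F\<close> is. Values are in \<^typ>\<open>ennreal\<close>, so points in different components are at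
  distance \<open>\<infinity>\<close>.
\<close>

definition induced_dist ::
    "'m topology \<Rightarrow> ('m \<Rightarrow> 'a::euclidean_space) \<Rightarrow> 'm \<Rightarrow> 'm \<Rightarrow> ennreal" where
  "induced_dist M F p q =
     (INF \<gamma>\<in>{\<gamma>. pathin M \<gamma> \<and> \<gamma> 0 = p \<and> \<gamma> 1 = q \<and> (F \<circ> \<gamma>) piecewise_C1_differentiable_on {0..1}}.
        \<integral>\<^sup>+ t. ennreal (norm (vector_derivative (F \<circ> \<gamma>) (at t))) * indicator {0..1} t \<partial>lborel)"

definition complete_hypersurface ::
    "'m topology \<Rightarrow> ('m \<Rightarrow> 'a::euclidean_space) \<Rightarrow> bool" where
  "complete_hypersurface M F \<longleftrightarrow>
     (\<forall>p :: nat \<Rightarrow> 'm.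
        (\<forall>k. p k \<in> topspace M) \<and>
        (\<forall>\<epsilon>>0. \<exists>N. \<forall>i\<ge>N. \<forall>j\<ge>N. induced_dist M F (p i) (p j) < ennreal \<epsilon>)
        \<longrightarrow> (\<exists>q. limitin M p q sequentially))"

subsection \<open>Self-shrinkers\<close>

text \<open>Here \<open>X\<close> is a local parametrisation of a hypersurface, defined on an open set \<open>U\<close>.\<close>

definition smooth_unit_normal ::
    "'b::euclidean_space set \<Rightarrow> ('b \<Rightarrow> 'a::euclidean_space) \<Rightarrow> ('b \<Rightarrow> 'a) \<Rightarrow> bool" where
  "smooth_unit_normal U X \<nu> \<longleftrightarrow>
     smooth_on U \<nu> \<and>
     (\<forall>u\<in>U. norm (\<nu> u) = 1 \<and> (\<forall>w. frechet_derivative X (at u) w \<bullet> \<nu> u = 0))"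

text \<open>\<open>w\<close> is the coordinate expression of an orthonormal basis of the tangent space at \<open>X u\<close>.\<close>

definition tangent_frame ::
    "('b::euclidean_space \<Rightarrow> 'a::euclidean_space) \<Rightarrow> 'b \<Rightarrow> ('b \<Rightarrow> 'b) \<Rightarrow> bool" where
  "tangent_frame X u w \<longleftrightarrow>
     (\<forall>i\<in>Basis. \<forall>j\<in>Basis.
        frechet_derivative X (at u) (w i) \<bullet> frechet_derivative X (at u) (w j)
          = (if i = j then 1 else 0))"

text \<open>
  The divergence of \<open>\<nu>\<close> along the hypersurface: the sum over an orthonormal tangent basis \<open>\<tau>\<^sub>i\<close> of
  the terms \<open>D\<^bsub>\<tau>\<^sub>i\<^esub> \<nu> \<bullet> \<tau>\<^sub>i\<close>, a trace which does not depend on the chosen basis. With the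
  outer normal, the round sphere of radius \<open>R\<close> has mean curvature \<open>n / R\<close>.
\<close>

definition mean_curvature ::
    "('b::euclidean_space \<Rightarrow> 'a::euclidean_space) \<Rightarrow> ('b \<Rightarrow> 'a) \<Rightarrow> 'b \<Rightarrow> real" where
  "mean_curvature X \<nu> u =
     (let w = (SOME w. tangent_frame X u w)
      in \<Sum>i\<in>Basis. frechet_derivative \<nu> (at u) (w i) \<bullet> frechet_derivative X (at u) (w i))"

text \<open>
  The equation is invariant under \<open>\<nu> \<mapsto> -\<nu>\<close>, so it is imposed for all local smooth unit normals;
  no orientation has to be chosen.
\<close>

definition self_shrinker ::
    "('b::euclidean_space set \<times> ('b \<Rightarrow> 'm)) set \<Rightarrow> ('m \<Rightarrow> 'a::euclidean_space) \<Rightarrow> bool" where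
  "self_shrinker \<Phi> F \<longleftrightarrow>
     (\<forall>(V, \<phi>) \<in> \<Phi>. \<forall>U \<nu>. open U \<and> U \<subseteq> V \<and> smooth_unit_normal U (F \<circ> \<phi>) \<nu> \<longrightarrow>
        (\<forall>u\<in>U. mean_curvature (F \<circ> \<phi>) \<nu> u = ((F \<circ> \<phi>) u \<bullet> \<nu> u) / 2))"

subsection \<open>Separated ends\<close>

definition scaled_end :: "real \<Rightarrow> 'a::euclidean_space set \<Rightarrow> 'a set" where
  "scaled_end r T = ((\<lambda>x. (1 / r) *\<^sub>R x) ` T) - ball 0 1"

definition delta_separated_ends :: "real \<Rightarrow> 'a::euclidean_space set \<Rightarrow> bool" where
  "delta_separated_ends \<delta> S \<longleftrightarrow>
     (\<forall>S1 S2.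
        openin (top_of_set S) S1 \<and> openin (top_of_set S) S2 \<and>
        connected S1 \<and> connected S2 \<and> S1 \<inter> S2 = {} \<and>
        (top_of_set S closure_of S1) \<union> (top_of_set S closure_of S2) = S \<and>
        top_of_set S frontier_of (top_of_set S closure_of S1)
          = top_of_set S frontier_of (top_of_set S closure_of S2) \<and>
        bounded (top_of_set S frontier_of (top_of_set S closure_of S1))
        \<longrightarrow> (\<forall>\<^sub>F r in at_top.
               scaled_end r S1 = {} \<or> scaled_end r S2 = {} \<or>
               Inf {norm (x1 - x2) | x1 x2. x1 \<in> scaled_end r S1 \<and> x2 \<in> scaled_end r S2} \<ge> \<delta>))"

subsection \<open>Lebesgue measure on the unit sphere\<close>

text \<open>
  The measure of \<open>A\<close> is \<open>n + 1\<close> times the Lebesgue measure of the cone over \<open>A\<close> in the unit ball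
  (polar coordinates), and \<open>A\<close> is measurable iff that cone is.
\<close>

definition cone_over :: "'a::euclidean_space set \<Rightarrow> 'a set" where
  "cone_over A = {t *\<^sub>R a | t a. 0 < t \<and> t \<le> 1 \<and> a \<in> A}"

definition sphere_measurable :: "'a::euclidean_space set \<Rightarrow> bool" where
  "sphere_measurable A \<longleftrightarrow> A \<subseteq> sphere 0 1 \<and> cone_over A \<in> sets lebesgue"

definition sphere_measure :: "'a::euclidean_space set \<Rightarrow> ennreal" where
  "sphere_measure A = of_nat (DIM('a)) * emeasure lebesgue (cone_over A)"

subsection \<open>Orthonormal coordinates\<close>

text \<open>The basis is \<open>e 1, \<dots>, e (n + 1)\<close>; the \<open>i\<close>-th coordinate of \<open>x\<close> is \<open>x \<bullet> e i\<close>.\<close>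

definition orthonormal_basis :: "(nat \<Rightarrow> 'a::euclidean_space) \<Rightarrow> bool" where
  "orthonormal_basis e \<longleftrightarrow>
     (\<forall>i\<in>{1..DIM('a)}. \<forall>j\<in>{1..DIM('a)}. e i \<bullet> e j = (if i = j then 1 else 0)) \<and>
     span (e ` {1..DIM('a)}) = UNIV"

definition same_vertical :: "(nat \<Rightarrow> 'a::euclidean_space) \<Rightarrow> 'a \<Rightarrow> 'a \<Rightarrow> bool" where
  "same_vertical e x y \<longleftrightarrow> (\<forall>i\<in>{1..<DIM('a)}. x \<bullet> e i = y \<bullet> e i)"

definition height :: "(nat \<Rightarrow> 'a::euclidean_space) \<Rightarrow> 'a \<Rightarrow> real" where
  "height e x = x \<bullet> e (DIM('a))"

definition neighbourhood_in :: "'a::euclidean_space set \<Rightarrow> 'a set \<Rightarrow> 'a set \<Rightarrow> bool" where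
  "neighbourhood_in T K V \<longleftrightarrow> V \<subseteq> T \<and> (\<exists>U. openin (top_of_set T) U \<and> K \<subseteq> U \<and> U \<subseteq> V)"

end

theory Submission
  imports Defs
begin

text \<open>
  Suppose that the hypersurface is a self-shrinker. For \<open>e \<in> A\<close> consider the segments
  parallel to \<open>e\<close> with upper end \<open>x\<close> in \<open>Sm\<close> and lower end \<open>y\<close> in \<open>Sp\<close>. Separated ends keep
  segments of bounded length in a bounded region, and the conditions (2) and (3) keep minimising
  sequences away from the common boundary, so a shortest segment \<open>x = y + l e\<close> exists. Near it, a
  sheet through \<open>x\<close> and the translate by \<open>l e\<close> of a sheet through \<open>y\<close> touch from one side at \<open>x\<close>,
  with a common normal \<open>N\<close>. If \<open>e \<bullet> N \<noteq> 0\<close>, then one-sided touching gives an inequality between the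
  two mean curvatures whose opposite follows, strictly, from the self-shrinker equation, because
  \<open>(x - y) \<bullet> N = l (e \<bullet> N)\<close>. The directions with \<open>e \<bullet> N = 0\<close> form a null set: on lines in the
  direction \<open>N\<close>, minimality makes the direction a function with vanishing derivative of the length
  of the segment. Since \<open>A\<close> has positive measure, some \<open>e \<in> A\<close> avoids them.
\<close>

subsection \<open>Calculus of smooth maps and unit normals\<close>

text \<open>The strict inequality comes from \<open>l (e \<bullet> N)\<close> alone, so a shortest
  segment tangent to the sheets yields no contradiction; this obstacle is why a set of directions of
  positive measure is assumed. Tangential directions are collected without normalising their length:
  the set is then stable under positive scaling, Fubini can run along straight lines of the ambient
  space, and the result transfers to the sphere because the measure there is defined through cones.
  Exceptional directions are recorded per pair of charts, one chart for each end of the segment, and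
  countably many charts cover the manifold. Self-intersections cause no trouble: \<open>Sm\<close>
  and \<open>Sp\<close> are open in \<open>S\<close>, so any sheet through an end point stays in the
  same set near it, and minimality applies to an arbitrary choice of one sheet at each end. The
  self-shrinker equation is used only at the two end points; the comparison needs just second-order
  information there, not a maximum principle for a differential equation.\<close>

lemma frechet_derivative_eqI:
  assumes "(f has_derivative D) (at x)"
  shows "frechet_derivative f (at x) = D"
  using frechet_derivative_at[OF assms] by simp

lemma frechet_derivative_cong_open:
  assumes "open U" "x \<in> U" "\<And>y. y \<in> U \<Longrightarrow> f y = g y"
  shows "frechet_derivative f (at x) = frechet_derivative g (at x)"
proof -
  have "(f has_derivative D) (at x) \<longleftrightarrow> (g has_derivative D) (at x)" for D
    using assms by (metis has_derivative_transform_within_open)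
  then show ?thesis
    by (simp add: frechet_derivative_def)
qed

lemma differentiable_on_has_derivative:
  assumes "f differentiable_on U" "open U" "x \<in> U"
  shows "(f has_derivative frechet_derivative f (at x)) (at x)"
  using assms differentiable_on_eq_differentiable_at frechet_derivative_works by blast

lemma Ck_on_cong:
  assumes "open U" "\<And>x. x \<in> U \<Longrightarrow> f x = g x"
  shows "Ck_on k U f \<longleftrightarrow> Ck_on k U g"
  using assms(2)
proof (induction k arbitrary: f g)
  case 0
  then show ?case
    by (simp cong: continuous_on_cong)
next
  case (Suc k)
  have "Ck_on k U (\<lambda>x. frechet_derivative f (at x) v) = Ck_on k U (\<lambda>x. frechet_derivative g (at x) v)" for v
    by (rule Suc.IH) (simp add: frechet_derivative_cong_open[OF assms(1) _ Suc.prems])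
  moreover have "f differentiable_on U \<longleftrightarrow> g differentiable_on U"
    using Suc.prems unfolding differentiable_on_def
    by (metis (no_types, lifting) differentiable_transform_within zero_less_one)
  ultimately show ?case
    by simp
qed

lemma Ck_on_subset:
  assumes "Ck_on k U f" "U' \<subseteq> U"
  shows "Ck_on k U' f"
  using assms
proof (induction k arbitrary: f)
  case 0
  then show ?case by (auto intro: continuous_on_subset)
next
  case (Suc k)
  then show ?case by (auto intro: differentiable_on_subset)
qed

lemma Ck_on_Suc_D:
  assumes "Ck_on (Suc k) U f"
  shows "Ck_on k U f"
  using assms
proof (induction k arbitrary: f)
  case 0
  then show ?case by (auto intro: differentiable_imp_continuous_on)
next
  case (Suc k)
  then show ?case by (metis Ck_on.simps(2))
qed

lemma Ck_on_const: "Ck_on k U (\<lambda>x. c)"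
proof (induction k arbitrary: c)
  case 0
  then show ?case by simp
next
  case (Suc k)
  have "frechet_derivative (\<lambda>x. c) (at x) = (\<lambda>v. 0)" for x
    by (rule frechet_derivative_eqI) simp
  then show ?case using Suc by simp
qed

text \<open>\<open>Ck_on\<close> refers to \<open>frechet_derivative\<close>, which is a choice;
  uniqueness of derivatives allows an explicit formula \<open>f'\<close> to take its place in all
  closure properties below.\<close>

lemma Ck_on_Suc_I:
  assumes "open U" "\<And>x. x \<in> U \<Longrightarrow> (f has_derivative f' x) (at x)"
    and "\<And>v. Ck_on k U (\<lambda>x. f' x v)"
  shows "Ck_on (Suc k) U f"
proof -
  have "frechet_derivative f (at x) = f' x" if "x \<in> U" for x
    using assms(2)[OF that] by (rule frechet_derivative_eqI)
  then have "Ck_on k U (\<lambda>x. frechet_derivative f (at x) v)" for v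
    using Ck_on_cong[OF assms(1), of "\<lambda>x. frechet_derivative f (at x) v" "\<lambda>x. f' x v" k] assms(3) by simp
  moreover have "f differentiable_on U"
    using assms(1,2) by (meson differentiable_at_withinI differentiable_def differentiable_on_def)
  ultimately show ?thesis by simp
qed

lemma Ck_on_has_derivative:
  assumes "Ck_on (Suc k) U f" "open U" "x \<in> U"
  shows "(f has_derivative frechet_derivative f (at x)) (at x)"
  using assms differentiable_on_has_derivative by auto

lemma Ck_on_add:
  assumes "open U" "Ck_on k U f" "Ck_on k U g"
  shows "Ck_on k U (\<lambda>x. f x + g x)"
  using assms(2,3)
proof (induction k arbitrary: f g)
  case 0
  then show ?case by (auto intro: continuous_on_add)
next
  case (Suc k)
  show ?case
  proof (rule Ck_on_Suc_I[OF assms(1)])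
    show "((\<lambda>x. f x + g x) has_derivative
      (\<lambda>v. frechet_derivative f (at x) v + frechet_derivative g (at x) v)) (at x)" if "x \<in> U" for x
      using Suc.prems assms(1) that by (intro has_derivative_add Ck_on_has_derivative)
    show "Ck_on k U (\<lambda>x. frechet_derivative f (at x) v + frechet_derivative g (at x) v)" for v
      using Suc.prems by (intro Suc.IH) auto
  qed
qed


text \<open>One product rule covers scalar multiples, inner products and real products. The
  induction meets products with one factor differentiated and the other merely weakened to order
  \<open>k\<close>.\<close>

lemma Ck_on_bilinear:
  fixes prod :: "'x::euclidean_space \<Rightarrow> 'y::euclidean_space \<Rightarrow> 'z::euclidean_space"
  assumes "bounded_bilinear prod" "open U" "Ck_on k U f" "Ck_on k U g"
  shows "Ck_on k U (\<lambda>x. prod (f x) (g x))"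
  using assms(3,4)
proof (induction k arbitrary: f g)
  case 0
  then show ?case
    using bounded_bilinear.continuous_on[OF assms(1)] by auto
next
  case (Suc k)
  show ?case
  proof (rule Ck_on_Suc_I[OF assms(2)])
    show "((\<lambda>x. prod (f x) (g x)) has_derivative
      (\<lambda>v. prod (f x) (frechet_derivative g (at x) v) + prod (frechet_derivative f (at x) v) (g x))) (at x)"
      if "x \<in> U" for x
      using Suc.prems assms(2) that
      by (intro bounded_bilinear.FDERIV[OF assms(1)] Ck_on_has_derivative)
    show "Ck_on k U (\<lambda>x. prod (f x) (frechet_derivative g (at x) v) + prod (frechet_derivative f (at x) v) (g x))" for v
      using Suc.prems Ck_on_Suc_D[OF Suc.prems(1)] Ck_on_Suc_D[OF Suc.prems(2)]
      by (intro Ck_on_add[OF assms(2)] Suc.IH) auto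
  qed
qed

lemma Ck_on_mult_real:
  fixes f g :: "'b::euclidean_space \<Rightarrow> real"
  assumes "open U" "Ck_on k U f" "Ck_on k U g"
  shows "Ck_on k U (\<lambda>x. f x * g x)"
  by (rule Ck_on_bilinear[OF bounded_bilinear_mult assms])

lemma Ck_on_inverse:
  fixes f :: "'b::euclidean_space \<Rightarrow> real"
  assumes "open U" "Ck_on k U f" "\<And>x. x \<in> U \<Longrightarrow> f x \<noteq> 0"
  shows "Ck_on k U (\<lambda>x. inverse (f x))"
  using assms(2)
proof (induction k)
  case 0
  then show ?case using assms(3) by (auto intro: continuous_on_inverse)
next
  case (Suc k)
  show ?case
  proof (rule Ck_on_Suc_I[OF assms(1)])
    show "((\<lambda>x. inverse (f x)) has_derivative
      (\<lambda>v. (- 1) * (inverse (f x) * frechet_derivative f (at x) v * inverse (f x)))) (at x)" if "x \<in> U" for x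
      using Deriv.has_derivative_inverse[OF assms(3)[OF that] Ck_on_has_derivative[OF Suc.prems assms(1) that]]
      by simp
    show "Ck_on k U (\<lambda>x. (- 1) * (inverse (f x) * frechet_derivative f (at x) v * inverse (f x)))" for v
      using Suc Ck_on_Suc_D[OF Suc.prems] by (intro Ck_on_mult_real Ck_on_const assms(1)) auto
  qed
qed

lemma Ck_on_sqrt:
  assumes "open U" "Ck_on k U f" "\<And>x. x \<in> U \<Longrightarrow> f x > 0"
  shows "Ck_on k U (\<lambda>x. sqrt (f x))"
  using assms(2)
proof (induction k)
  case 0
  then show ?case using assms(3) by (auto intro: continuous_on_real_sqrt)
next
  case (Suc k)
  show ?case
  proof (rule Ck_on_Suc_I[OF assms(1)])
    show "((\<lambda>x. sqrt (f x)) has_derivative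
      (\<lambda>v. frechet_derivative f (at x) v * (inverse (sqrt (f x)) * (1 / 2)))) (at x)" if "x \<in> U" for x
    proof -
      have "(sqrt has_derivative (*) (inverse (sqrt (f x)) / 2)) (at (f x))"
        using DERIV_real_sqrt[OF assms(3)[OF that]] by (simp add: has_field_derivative_def)
      from has_derivative_compose[OF Ck_on_has_derivative[OF Suc.prems assms(1) that] this]
      show ?thesis by (simp add: ac_simps)
    qed
    have "sqrt (f x) \<noteq> 0" if "x \<in> U" for x
      using assms(3)[OF that] by simp
    then show "Ck_on k U (\<lambda>x. frechet_derivative f (at x) v * (inverse (sqrt (f x)) * (1 / 2)))" for v
      using Suc Ck_on_Suc_D[OF Suc.prems] by (intro Ck_on_mult_real Ck_on_const Ck_on_inverse assms(1)) auto
  qed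
qed

lemma smooth_on_subset: "smooth_on U f \<Longrightarrow> U' \<subseteq> U \<Longrightarrow> smooth_on U' f"
  by (auto simp: smooth_on_def intro: Ck_on_subset)

lemma smooth_on_const: "smooth_on U (\<lambda>x. c)"
  by (simp add: smooth_on_def Ck_on_const)

lemma smooth_on_add: "open U \<Longrightarrow> smooth_on U f \<Longrightarrow> smooth_on U g \<Longrightarrow> smooth_on U (\<lambda>x. f x + g x)"
  by (simp add: smooth_on_def Ck_on_add)

lemma smooth_on_scaleR: "open U \<Longrightarrow> smooth_on U f \<Longrightarrow> smooth_on U g \<Longrightarrow> smooth_on U (\<lambda>x. f x *\<^sub>R g x)"
  by (simp add: smooth_on_def Ck_on_bilinear[OF bounded_bilinear_scaleR])

lemma smooth_on_inner: "open U \<Longrightarrow> smooth_on U f \<Longrightarrow> smooth_on U g \<Longrightarrow> smooth_on U (\<lambda>x. f x \<bullet> g x)"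
  by (simp add: smooth_on_def Ck_on_bilinear[OF bounded_bilinear_inner])

lemma smooth_on_inverse:
  fixes f :: "'b::euclidean_space \<Rightarrow> real"
  shows "open U \<Longrightarrow> smooth_on U f \<Longrightarrow> (\<And>x. x \<in> U \<Longrightarrow> f x \<noteq> 0) \<Longrightarrow> smooth_on U (\<lambda>x. inverse (f x))"
  by (simp add: smooth_on_def Ck_on_inverse)

lemma smooth_on_diff: "open U \<Longrightarrow> smooth_on U f \<Longrightarrow> smooth_on U g \<Longrightarrow> smooth_on U (\<lambda>x. f x - g x)"
  using smooth_on_add[of U f "\<lambda>x. (- 1) *\<^sub>R g x"] smooth_on_scaleR[of U "\<lambda>x. - 1" g] smooth_on_const[of U "- 1 :: real"]
  by simp

lemma smooth_on_has_derivative: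
  assumes "smooth_on U f" "open U" "x \<in> U"
  shows "(f has_derivative frechet_derivative f (at x)) (at x)"
  using assms Ck_on_has_derivative[of 0 U f x] unfolding smooth_on_def by blast

lemma smooth_on_frechet_derivative:
  assumes "smooth_on U f"
  shows "smooth_on U (\<lambda>x. frechet_derivative f (at x) v)"
  using assms Ck_on.simps(2) unfolding smooth_on_def by blast

lemma smooth_on_imp_continuous_on: "smooth_on U f \<Longrightarrow> continuous_on U f"
  using Ck_on.simps(1) unfolding smooth_on_def by blast

lemma smooth_on_sqrt: "open U \<Longrightarrow> smooth_on U f \<Longrightarrow> (\<And>x. x \<in> U \<Longrightarrow> f x > 0) \<Longrightarrow> smooth_on U (\<lambda>x. sqrt (f x))"
  by (simp add: smooth_on_def Ck_on_sqrt)

text \<open>Gram--Schmidt with parameters: orthogonalise \<open>c\<close> and the last \<open>a j\<close> against the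
  others, then subtract from the first result its component along the second.\<close>

lemma smooth_orthogonal_projection:
  fixes a :: "'i \<Rightarrow> 'b::euclidean_space \<Rightarrow> 'a::euclidean_space"
  assumes "finite I" "open U" "u0 \<in> U"
    and "\<And>i. i \<in> I \<Longrightarrow> smooth_on U (a i)" "smooth_on U c"
    and "inj_on (\<lambda>i. a i u0) I" "independent ((\<lambda>i. a i u0) ` I)"
  shows "\<exists>U' n. open U' \<and> u0 \<in> U' \<and> U' \<subseteq> U \<and> smooth_on U' n \<and>
    (\<forall>u\<in>U'. (\<forall>i\<in>I. n u \<bullet> a i u = 0) \<and> c u - n u \<in> span ((\<lambda>i. a i u) ` I))"
  using assms(1,4-)
proof (induction I arbitrary: c rule: finite_induct)
  case empty
  then show ?case
    using assms(2,3) by (intro exI[of _ U] exI[of _ c]) auto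
next
  case (insert j J)
  let ?a = "\<lambda>u. (\<lambda>i. a i u) ` J"
  have indJ: "inj_on (\<lambda>i. a i u0) J" "independent (?a u0)"
    using insert.prems(3) independent_mono[OF insert.prems(4), of "?a u0"] by (auto intro: inj_on_subset)
  obtain U1 n1 where 1: "open U1" "u0 \<in> U1" "U1 \<subseteq> U" "smooth_on U1 n1"
    "\<And>u i. u \<in> U1 \<Longrightarrow> i \<in> J \<Longrightarrow> n1 u \<bullet> a i u = 0" "\<And>u. u \<in> U1 \<Longrightarrow> c u - n1 u \<in> span (?a u)"
    using insert.IH[OF _ insert.prems(2) indJ] insert.prems(1) by blast
  obtain U2 n2 where 2: "open U2" "u0 \<in> U2" "U2 \<subseteq> U" "smooth_on U2 n2"
    "\<And>u i. u \<in> U2 \<Longrightarrow> i \<in> J \<Longrightarrow> n2 u \<bullet> a i u = 0" "\<And>u. u \<in> U2 \<Longrightarrow> a j u - n2 u \<in> span (?a u)"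
    using insert.IH[of "a j", OF _ _ indJ] insert.prems(1) by blast
  have "a j u0 \<notin> ?a u0"
    using insert.prems(3) insert.hyps by auto
  then have aj: "a j u0 \<notin> span (?a u0)"
    using insert.prems(4) by (simp add: independent_insert)
  have n2: "n2 u0 \<noteq> 0"
    using 2(6)[OF 2(2)] aj by auto
  \<comment> \<open>The division by \<open>n2 u \<bullet> n2 u\<close> below needs \<open>n2\<close>
    nonzero. At \<open>u0\<close> this is linear independence, and continuity extends it to a
    neighbourhood.\<close>
  define U' where "U' = (U1 \<inter> U2) \<inter> n2 -` (- {0})"
  have U': "open U'" "u0 \<in> U'" "U' \<subseteq> U1" "U' \<subseteq> U2" "\<And>u. u \<in> U' \<Longrightarrow> n2 u \<noteq> 0"
    unfolding U'_def using 1 2 n2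
    by (auto intro!: continuous_open_preimage continuous_on_subset[OF smooth_on_imp_continuous_on[OF 2(4)]])
  define n where "n u = n1 u - ((n1 u \<bullet> n2 u) *\<^sub>R inverse (n2 u \<bullet> n2 u)) *\<^sub>R n2 u" for u
  have s: "smooth_on U' n1" "smooth_on U' n2"
    using smooth_on_subset[OF 1(4) U'(3)] smooth_on_subset[OF 2(4) U'(4)] by simp_all
  have "smooth_on U' n"
    unfolding n_def using U' s
    by (intro smooth_on_diff smooth_on_scaleR smooth_on_inner smooth_on_inverse) auto
  moreover have "n u \<bullet> a i u = 0" if "u \<in> U'" "i \<in> insert j J" for u i
  proof (cases "i \<in> J")
    case True
    then show ?thesis
      using that 1(5)[OF subsetD[OF U'(3)]] 2(5)[OF subsetD[OF U'(4)]] by (simp add: n_def inner_diff_left)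
  next
    case False
    then have "i = j" using that by simp
    have nJ: "n u \<bullet> a k u = 0" if "k \<in> J" for k
      using that \<open>u \<in> U'\<close> 1(5)[OF subsetD[OF U'(3)]] 2(5)[OF subsetD[OF U'(4)]]
      by (simp add: n_def inner_diff_left)
    then have "orthogonal (n u) (a j u - n2 u)"
      using orthogonal_to_span[OF 2(6)[OF subsetD[OF U'(4) that(1)]]] by (force simp: orthogonal_def)
    then have "n u \<bullet> a j u = n u \<bullet> n2 u"
      by (simp add: orthogonal_def inner_diff_right)
    also have "\<dots> = 0"
      using U'(5)[OF that(1)] by (simp add: n_def inner_diff_left)
    finally show ?thesis using \<open>i = j\<close> by simp
  qed
  moreover have "c u - n u \<in> span ((\<lambda>i. a i u) ` insert j J)" if "u \<in> U'" for u
  proof -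
    have mono: "span (?a u) \<subseteq> span ((\<lambda>i. a i u) ` insert j J)"
      by (intro span_mono) auto
    have "c u - n1 u \<in> span ((\<lambda>i. a i u) ` insert j J)" "a j u - n2 u \<in> span ((\<lambda>i. a i u) ` insert j J)"
      using 1(6)[OF subsetD[OF U'(3) that]] 2(6)[OF subsetD[OF U'(4) that]] mono by auto
    moreover have "a j u \<in> span ((\<lambda>i. a i u) ` insert j J)"
      by (intro span_base) auto
    ultimately have "n2 u \<in> span ((\<lambda>i. a i u) ` insert j J)" and c: "c u - n1 u \<in> span ((\<lambda>i. a i u) ` insert j J)"
      using span_diff[of "a j u" _ "a j u - n2 u"] by auto
    moreover have "c u - n u = (c u - n1 u) + ((n1 u \<bullet> n2 u) *\<^sub>R inverse (n2 u \<bullet> n2 u)) *\<^sub>R n2 u"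
      by (simp add: n_def)
    ultimately show ?thesis
      by (metis span_add span_mul)
  qed
  ultimately show ?case
    using U' 1(3) by (intro exI[of _ U'] exI[of _ n]) auto
qed

text \<open>A constant vector \<open>N\<close> outside the tangent space at \<open>u0\<close> exists
  by dimension. Removing its tangential part smoothly leaves a normal field that is nonzero at
  \<open>u0\<close>, hence nearby, and can be normalised.\<close>

lemma exists_smooth_unit_normal:
  fixes X :: "'b::euclidean_space \<Rightarrow> 'a::euclidean_space"
  assumes "DIM('a) = DIM('b) + 1" "open U" "u0 \<in> U" "smooth_on U X"
    and inj: "inj (frechet_derivative X (at u0))"
  obtains U' \<nu> where "open U'" "u0 \<in> U'" "U' \<subseteq> U" "smooth_unit_normal U' X \<nu>"
proof -
  let ?D = "\<lambda>u. frechet_derivative X (at u)"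
  have lin: "linear (?D u)" if "u \<in> U" for u
    using smooth_on_has_derivative[OF assms(4,2) that] has_derivative_linear by blast
  have "dim (range (?D u0)) = DIM('b)"
    using dim_image_eq[OF lin[OF assms(3)], of UNIV] inj by simp
  then have "range (?D u0) \<noteq> UNIV"
    using assms(1) by (metis dim_UNIV n_not_Suc_n Suc_eq_plus1)
  then obtain N where N: "N \<notin> range (?D u0)" by blast
  have ind: "inj_on (\<lambda>i. ?D u0 i) Basis" "independent ((\<lambda>i. ?D u0 i) ` Basis)"
    using inj independent_Basis linear_independent_injective_image[OF lin[OF assms(3)]]
    by (auto intro: inj_on_subset)
  obtain U1 n where 1: "open U1" "u0 \<in> U1" "U1 \<subseteq> U" "smooth_on U1 n"
    and orth: "\<And>u i. u \<in> U1 \<Longrightarrow> i \<in> Basis \<Longrightarrow> n u \<bullet> ?D u i = 0"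
    and sp: "\<And>u. u \<in> U1 \<Longrightarrow> N - n u \<in> span (?D u ` Basis)"
    using smooth_orthogonal_projection[OF finite_Basis assms(2,3)
        smooth_on_frechet_derivative[OF assms(4)] smooth_on_const ind, of N] by blast
  have "span (?D u0 ` Basis) = range (?D u0)"
    using span_linear_image[OF lin[OF assms(3)], of Basis] by simp
  then have "n u0 \<noteq> 0"
    using sp[OF 1(2)] N by auto
  define U' where "U' = U1 \<inter> n -` (- {0})"
  have U': "open U'" "u0 \<in> U'" "U' \<subseteq> U1" "\<And>u. u \<in> U' \<Longrightarrow> n u \<noteq> 0"
    unfolding U'_def using 1 \<open>n u0 \<noteq> 0\<close>
    by (auto intro!: continuous_open_preimage smooth_on_imp_continuous_on)
  define \<nu> where "\<nu> u = inverse (sqrt (n u \<bullet> n u)) *\<^sub>R n u" for u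
  have s: "smooth_on U' n"
    using 1 U' smooth_on_subset by blast
  have "smooth_on U' \<nu>"
    unfolding \<nu>_def using U' s
    by (intro smooth_on_scaleR smooth_on_inverse smooth_on_sqrt smooth_on_inner) auto
  moreover have "norm (\<nu> u) = 1" if "u \<in> U'" for u
    using U'(4)[OF that] by (simp add: \<nu>_def norm_eq_sqrt_inner[symmetric])
  moreover have "?D u w \<bullet> \<nu> u = 0" if "u \<in> U'" for u w
  proof -
    have "?D u w \<in> span (?D u ` Basis)"
    proof -
      have "span (?D u ` Basis) = range (?D u)"
        using span_linear_image[OF lin, of u Basis] that U'(3) 1(3) by (simp add: subset_iff)
      then show ?thesis by simp
    qed
    then have "orthogonal (n u) (?D u w)"
      using orthogonal_to_span[of "?D u w" "?D u ` Basis" "n u"] orth[OF subsetD[OF U'(3) that]]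
      by (force simp: orthogonal_def)
    then show ?thesis by (simp add: \<nu>_def orthogonal_def inner_commute)
  qed
  ultimately have "smooth_unit_normal U' X \<nu>"
    by (auto simp: smooth_unit_normal_def)
  then show ?thesis
    using that U' 1(3) by blast
qed

subsection \<open>Local defining functions and null sets of directions\<close>

lemma normal_complement_range:
  fixes P :: "'b::euclidean_space \<Rightarrow> 'a::euclidean_space"
  assumes "DIM('a) = DIM('b) + 1" "linear P" "inj P" "N \<noteq> 0" "\<And>v. P v \<bullet> N = 0" "w \<bullet> N = 0"
  shows "w \<in> range P"
proof -
  have "range P = {x. N \<bullet> x = 0}"
  proof (rule subspace_dim_equal)
    show "subspace (range P)"
      using assms(2) linear_subspace_image subspace_UNIV by blast
    show "subspace {x. N \<bullet> x = 0}"
      by (rule subspace_hyperplane)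
    show "range P \<subseteq> {x. N \<bullet> x = 0}"
      using assms(5) by (auto simp: inner_commute)
    have "dim (range P) = DIM('b)"
      using dim_image_eq[OF assms(2), of UNIV] assms(3) by simp
    then show "dim {x. N \<bullet> x = 0} \<le> dim (range P)"
      using dim_hyperplane[OF assms(4)] assms(1) by simp
  qed
  then show ?thesis
    using assms(6) by (auto simp: inner_commute)
qed

text \<open>\<open>h p\<close> is the coordinate along \<open>\<nu> u0\<close> in the local diffeomorphism
  \<open>(u, t) \<mapsto> X u + t \<nu> u0\<close>; its gradient at \<open>p\<close> is a multiple of the normal at \<open>u\<close>.\<close>

lemma local_defining_function:
  fixes X :: "'b::euclidean_space \<Rightarrow> 'a::euclidean_space"
  assumes dim: "DIM('a) = DIM('b) + 1" and "open U" "u0 \<in> U" and X: "smooth_on U X"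
    and inj: "inj (frechet_derivative X (at u0))" and \<nu>: "smooth_unit_normal U X \<nu>"
  obtains r h m O1 where "r > 0" "open O1" "u0 \<in> O1" "O1 \<subseteq> U"
    "\<And>p. p \<in> ball (X u0) r \<Longrightarrow> (h has_derivative (\<lambda>w. w \<bullet> m p)) (at p)"
    "continuous_on (ball (X u0) r) m"
    "\<And>p. p \<in> ball (X u0) r \<Longrightarrow> m p \<bullet> \<nu> u0 = 1"
    "\<And>p. p \<in> ball (X u0) r \<Longrightarrow> h p = 0 \<Longrightarrow> \<exists>u\<in>U. p = X u"
    "\<And>u. u \<in> O1 \<Longrightarrow> X u \<in> ball (X u0) r"
    "\<And>u. u \<in> O1 \<Longrightarrow> h (X u) = 0"
    "\<And>u. u \<in> O1 \<Longrightarrow> \<nu> u \<bullet> \<nu> u0 > 0"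
    "\<And>u. u \<in> O1 \<Longrightarrow> m (X u) = inverse (\<nu> u \<bullet> \<nu> u0) *\<^sub>R \<nu> u"
    "m differentiable (at (X u0))"
proof -
  let ?D = "\<lambda>u. frechet_derivative X (at u)"
  define N where "N = \<nu> u0"
  have \<nu>_smooth: "smooth_on U \<nu>" and normal: "\<And>u w. u \<in> U \<Longrightarrow> ?D u w \<bullet> \<nu> u = 0"
    and unit: "\<And>u. u \<in> U \<Longrightarrow> norm (\<nu> u) = 1"
    using \<nu> by (auto simp: smooth_unit_normal_def)
  have derX: "(X has_derivative ?D u) (at u)" if "u \<in> U" for u
    using smooth_on_has_derivative[OF X \<open>open U\<close> that] .
  have N1: "N \<bullet> N = 1"
    using unit[OF \<open>u0 \<in> U\<close>] by (simp add: N_def norm_eq_1)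
  have "DIM('a) = DIM('b \<times> real)"
    using dim by simp
  then obtain f :: "'a \<Rightarrow> 'b \<times> real" and g where f: "linear f" and g: "linear g"
    and gf: "\<And>x. g (f x) = x" and fg: "\<And>y. f (g y) = y"
    using isomorphisms_UNIV_UNIV[where 'M='a and 'N="'b \<times> real"] by metis
  define L where "L = fst \<circ> f"
  define T where "T = snd \<circ> f"
  have L: "bounded_linear L" and T: "bounded_linear T" and bg: "bounded_linear g"
    unfolding L_def T_def o_def using f g
    by (auto intro: bounded_linear_compose[OF bounded_linear_fst] bounded_linear_compose[OF bounded_linear_snd]
        simp: linear_conv_bounded_linear)
  have LT: "f a = (L a, T a)" for a by (simp add: L_def T_def)
  have Lg: "L (g (u, t)) = u" and Tg: "T (g (u, t)) = t" for u t
    by (simp_all add: L_def T_def fg)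
  \<comment> \<open>Positivity of \<open>\<nu> u \<bullet> N\<close> makes the field
    \<open>m\<close> below well defined.\<close>
  define U1 where "U1 = U \<inter> (\<lambda>u. \<nu> u \<bullet> N) -` {0<..}"
  have "open U1"
    unfolding U1_def using \<open>open U\<close> smooth_on_imp_continuous_on[OF \<nu>_smooth]
    by (auto intro!: continuous_open_preimage continuous_intros)
  have "u0 \<in> U1" "U1 \<subseteq> U"
    using \<open>u0 \<in> U\<close> N1 by (auto simp: U1_def N_def)
  define W where "W = L -` U1"
  have "open W"
    unfolding W_def using \<open>open U1\<close> L
    by (auto intro!: open_vimage continuous_intros linear_continuous_on)
  define G where "G a = X (L a) + T a *\<^sub>R N" for a
  define G' where "G' a = Blinfun (\<lambda>a'. ?D (L a) (L a') + T a' *\<^sub>R N)" for a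
  have derG0: "(G has_derivative (\<lambda>a'. ?D (L a) (L a') + T a' *\<^sub>R N)) (at a)" if "a \<in> W" for a
  proof -
    have "L a \<in> U" using that \<open>U1 \<subseteq> U\<close> by (auto simp: W_def)
    have 1: "((\<lambda>a. X (L a)) has_derivative (\<lambda>a'. ?D (L a) (L a'))) (at a)"
      by (rule has_derivative_compose[OF bounded_linear_imp_has_derivative[OF L] derX[OF \<open>L a \<in> U\<close>]])
    have 2: "((\<lambda>a. T a *\<^sub>R N) has_derivative (\<lambda>a'. T a' *\<^sub>R N)) (at a)"
      by (rule has_derivative_scaleR_left[OF bounded_linear_imp_has_derivative[OF T]])
    show ?thesis
      unfolding G_def by (rule has_derivative_add[OF 1 2])
  qed
  have G'app: "blinfun_apply (G' a) = (\<lambda>a'. ?D (L a) (L a') + T a' *\<^sub>R N)" if "a \<in> W" for a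
    unfolding G'_def by (rule bounded_linear_Blinfun_apply, rule has_derivative_bounded_linear[OF derG0[OF that]])
  have derG: "(G has_derivative blinfun_apply (G' a)) (at a)" if "a \<in> W" for a
    using derG0 G'app that by simp
  have contG': "continuous_on W G'"
  proof (rule continuous_on_blinfun_componentwise)
    fix i :: 'a assume "i \<in> Basis"
    have "continuous_on W (\<lambda>a. ?D (L a) (L i) + T i *\<^sub>R N)"
    proof (intro continuous_intros)
      have "continuous_on U (\<lambda>u. ?D u (L i))"
        by (rule smooth_on_imp_continuous_on[OF smooth_on_frechet_derivative[OF X]])
      then show "continuous_on W (\<lambda>a. ?D (L a) (L i))"
        using \<open>U1 \<subseteq> U\<close>
        by (intro continuous_on_compose2[OF _ linear_continuous_on[OF L]]) (auto simp: W_def)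
    qed
    then show "continuous_on W (\<lambda>a. blinfun_apply (G' a) i)"
      by (rule continuous_on_eq) (simp add: G'app)
  qed
  define a0 where "a0 = g (u0, 0)"
  have a0: "a0 \<in> W" "G a0 = X u0"
    using \<open>u0 \<in> U1\<close> by (simp_all add: a0_def W_def Lg Tg G_def)
  obtain invf where invf: "invf o\<^sub>L G' a0 = id_blinfun"
  proof -
    let ?G = "\<lambda>a'. ?D u0 (L a') + T a' *\<^sub>R N"
    have Ga0: "blinfun_apply (G' a0) = ?G"
      using G'app[OF a0(1)] by (simp add: a0_def Lg)
    have lin: "linear ?G"
      using blinfun.bounded_linear_right[of "G' a0"] Ga0 by (simp add: linear_linear)
    have linD: "linear (?D u0)"
      using derX[OF \<open>u0 \<in> U\<close>] has_derivative_linear by blast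
    \<comment> \<open>Pairing with \<open>N\<close>, which is normal to the range of
      \<open>?D u0\<close>, isolates the last coordinate; injectivity of the immersion then kills
      the others.\<close>
    have "a' = 0" if "?G a' = 0" for a'
    proof -
      have "T a' = ?G a' \<bullet> N"
        using normal[OF \<open>u0 \<in> U\<close>] N1 by (simp add: inner_add_left N_def)
      then have "T a' = 0" using that by simp
      moreover from this have "?D u0 (L a') = 0" using that by simp
      then have "L a' = 0"
        using inj linD by (metis linear_injective_0)
      ultimately have "f a' = 0" by (simp add: LT zero_prod_def)
      then show ?thesis using gf[of a'] linear_0[OF g] by simp
    qed
    then have "inj ?G"
      using linear_injective_0[OF lin] by blast
    then obtain k where k: "linear k" "\<And>x. k (?G x) = x"
      using linear_injective_isomorphism[OF lin] by blast
    have "blinfun_apply (Blinfun k) = k"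
      by (rule bounded_linear_Blinfun_apply) (use k(1) in \<open>simp add: linear_linear\<close>)
    then have "Blinfun k o\<^sub>L G' a0 = id_blinfun"
      by (intro blinfun_eqI) (simp add: Ga0 k(2))
    then show ?thesis using that by blast
  qed
  obtain W' V \<gamma> \<gamma>' where W': "open W'" "W' \<subseteq> W" "a0 \<in> W'" and V: "open V" "G a0 \<in> V"
    and hom: "homeomorphism W' V G \<gamma>"
    and der\<gamma>: "\<And>y. y \<in> V \<Longrightarrow> (\<gamma> has_derivative (\<gamma>' y)) (at y)"
    and \<gamma>': "\<And>y. y \<in> V \<Longrightarrow> \<gamma>' y = inv (blinfun_apply (G' (\<gamma> y)))"
    and bij: "\<And>y. y \<in> V \<Longrightarrow> bij (blinfun_apply (G' (\<gamma> y)))"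
    using inverse_function_theorem[OF \<open>open W\<close> derG contG' a0(1) invf] by metis
  have G\<gamma>: "G (\<gamma> y) = y" "\<gamma> y \<in> W'" "L (\<gamma> y) \<in> U1" if "y \<in> V" for y
    using hom W'(2) that by (auto simp: homeomorphism_def W_def)
  have \<gamma>G: "\<gamma> (G a) = a" if "a \<in> W'" for a
    using hom that by (auto simp: homeomorphism_def)
  define h where "h p = T (\<gamma> p)" for p
  \<comment> \<open>Normalised to \<open>m p \<bullet> N = 1\<close>, so that moving along
    \<open>N\<close> changes \<open>h\<close> at unit rate in a whole ball, not only at
    \<open>X u0\<close>.\<close>
  define m where "m p = inverse (\<nu> (L (\<gamma> p)) \<bullet> N) *\<^sub>R \<nu> (L (\<gamma> p))" for p
  have pos: "\<nu> (L (\<gamma> y)) \<bullet> N > 0" if "y \<in> V" for y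
    using G\<gamma>(3)[OF that] by (simp add: U1_def)
  have derh: "(h has_derivative (\<lambda>w. w \<bullet> m p)) (at p)" if "p \<in> V" for p
  proof -
    have "(h has_derivative (\<lambda>w. T (\<gamma>' p w))) (at p)"
      unfolding h_def
      by (rule has_derivative_compose[OF der\<gamma>[OF that] bounded_linear_imp_has_derivative[OF T]])
    \<comment> \<open>Write \<open>w\<close> through the derivative of \<open>G\<close> at
      \<open>\<gamma> p\<close> and pair with the normal there: the tangential term drops out and
      only the last coordinate survives.\<close>
    moreover have "T (\<gamma>' p w) = w \<bullet> m p" for w
    proof -
      let ?u = "L (\<gamma> p)"
      have "blinfun_apply (G' (\<gamma> p)) (\<gamma>' p w) = w"
        using bij[OF that] \<gamma>'[OF that] by (simp add: bij_is_surj surj_f_inv_f)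
      then have "?D ?u (L (\<gamma>' p w)) + T (\<gamma>' p w) *\<^sub>R N = w"
        using G'app G\<gamma>(2)[OF that] W'(2) by auto
      then have "w \<bullet> \<nu> ?u = (?D ?u (L (\<gamma>' p w)) + T (\<gamma>' p w) *\<^sub>R N) \<bullet> \<nu> ?u"
        by simp
      also have "\<dots> = T (\<gamma>' p w) * (N \<bullet> \<nu> ?u)"
        using normal[OF subsetD[OF \<open>U1 \<subseteq> U\<close> G\<gamma>(3)[OF that]]] by (simp add: inner_add_left)
      finally have "w \<bullet> \<nu> ?u = T (\<gamma>' p w) * (N \<bullet> \<nu> ?u)" .
      then show ?thesis
        using pos[OF that] by (simp add: m_def inner_commute field_simps)
    qed
    ultimately show ?thesis by simp
  qed
  have cont: "continuous_on V m"
  proof -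
    have "continuous_on V \<gamma>"
      using hom by (simp add: homeomorphism_def)
    then have "continuous_on V (L \<circ> \<gamma>)"
      by (intro continuous_on_compose linear_continuous_on[OF L]) 
    moreover have "continuous_on ((L \<circ> \<gamma>) ` V) \<nu>"
      using G\<gamma>(3) \<open>U1 \<subseteq> U\<close> by (intro continuous_on_subset[OF smooth_on_imp_continuous_on[OF \<nu>_smooth]]) auto
    ultimately have "continuous_on V (\<nu> \<circ> (L \<circ> \<gamma>))"
      by (rule continuous_on_compose)
    then have c: "continuous_on V (\<lambda>p. \<nu> (L (\<gamma> p)))"
      by (simp add: o_def)
    show ?thesis
      unfolding m_def using pos by (intro continuous_intros c) fastforce
  qed
  obtain r where r: "r > 0" "ball (X u0) r \<subseteq> V"
    using V a0(2) open_contains_ball by metis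
  \<comment> \<open>\<open>\<gamma>\<close> is an inverse of \<open>G\<close> only on
    \<open>W'\<close>; requiring \<open>g (u, 0)\<close> to lie there guarantees that
    \<open>\<gamma> (X u)\<close> has last coordinate 0.\<close>
  define O1 where "O1 = (U1 \<inter> X -` ball (X u0) r) \<inter> (\<lambda>u. g (u, 0)) -` W'"
  have "open (U1 \<inter> X -` ball (X u0) r)"
    using \<open>open U1\<close> \<open>U1 \<subseteq> U\<close>
    by (intro continuous_open_preimage continuous_on_subset[OF smooth_on_imp_continuous_on[OF X]]) auto
  moreover have "open ((\<lambda>u. g (u, 0)) -` W')"
    using W'(1)
    by (intro open_vimage continuous_on_compose2[OF linear_continuous_on[OF bg, of UNIV]] continuous_intros) auto
  ultimately have "open O1" by (auto simp: O1_def)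
  have O1: "\<gamma> (X u) = g (u, 0)" if "u \<in> O1" for u
    using \<gamma>G[of "g (u, 0)"] that by (simp add: O1_def G_def Lg Tg)
  have mdiff: "m differentiable (at (X u0))"
  proof -
    have "X u0 \<in> V" using V a0 by simp
    have L0: "L (\<gamma> (X u0)) = u0"
      using \<gamma>G[OF W'(3)] a0 by (simp add: a0_def Lg)
    have 1: "((\<lambda>p. L (\<gamma> p)) has_derivative (\<lambda>w. L (\<gamma>' (X u0) w))) (at (X u0))"
      by (rule has_derivative_compose[OF der\<gamma>[OF \<open>X u0 \<in> V\<close>] bounded_linear_imp_has_derivative[OF L]])
    have "(\<nu> has_derivative frechet_derivative \<nu> (at u0)) (at (L (\<gamma> (X u0))))"
      using smooth_on_has_derivative[OF \<nu>_smooth \<open>open U\<close> \<open>u0 \<in> U\<close>] L0 by simp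
    from has_derivative_compose[OF 1 this]
    have \<nu>': "(\<lambda>p. \<nu> (L (\<gamma> p))) differentiable (at (X u0))"
      using differentiable_def by blast
    then show ?thesis
      unfolding m_def using pos[OF \<open>X u0 \<in> V\<close>]
      by (intro differentiable_scaleR differentiable_inverse differentiable_inner differentiable_const) auto
  qed
  show ?thesis
  proof (rule that[of r O1 h m])
    show "u0 \<in> O1"
      using \<open>u0 \<in> U1\<close> r W'(3) by (simp add: O1_def a0_def)
    show "continuous_on (ball (X u0) r) m"
      using cont r(2) by (rule continuous_on_subset)
    show "m p \<bullet> \<nu> u0 = 1" if "p \<in> ball (X u0) r" for p
      using pos[of p] that r(2) by (force simp: m_def N_def)
    show "\<exists>u\<in>U. p = X u" if "p \<in> ball (X u0) r" "h p = 0" for p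
      using G\<gamma>[of p] that r(2) \<open>U1 \<subseteq> U\<close> by (force simp: h_def G_def)
    show "m (X u) = inverse (\<nu> u \<bullet> \<nu> u0) *\<^sub>R \<nu> u" if "u \<in> O1" for u
      using O1[OF that] by (simp add: m_def N_def Lg)
    show "h (X u) = 0" if "u \<in> O1" for u
      using O1[OF that] by (simp add: h_def Tg)
  qed (use r \<open>open O1\<close> derh mdiff \<open>U1 \<subseteq> U\<close> in \<open>auto simp: O1_def U1_def N_def\<close>)
qed

section \<open>Null sets by covering and by slicing along parallel lines\<close>

text \<open>By \<open>flat\<close>, equal values of \<open>s\<close> force equal values of
  \<open>t\<close>, and \<open>t\<close> has derivative zero in \<open>s\<close>. Cutting the range
  of \<open>s\<close> into \<open>n\<close> short pieces therefore covers \<open>T\<close> by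
  \<open>n\<close> intervals whose total length is arbitrarily small.\<close>

lemma negligible_if_flat_multigraph:
  fixes T :: "real set"
  assumes "\<And>t. t \<in> T \<Longrightarrow> \<exists>s\<in>{l..l'}. R t s"
    and flat: "\<And>\<epsilon>. \<epsilon> > 0 \<Longrightarrow> \<exists>\<delta>>0. \<forall>t1 t2 s1 s2. t1 \<in> T \<and> t2 \<in> T \<and> R t1 s1 \<and> R t2 s2
      \<and> s1 \<in> {l..l'} \<and> s2 \<in> {l..l'} \<and> s1 \<le> s2 \<and> s2 - s1 < \<delta> \<longrightarrow> \<bar>t2 - t1\<bar> \<le> \<epsilon> * (s2 - s1)"
  shows "negligible T"
  unfolding negligible_outer_le
proof (intro allI impI)
  fix e :: real assume "e > 0"
  \<comment> \<open>The summand 1 keeps \<open>K\<close> positive and makes the piece index strictly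
    less than \<open>n\<close> even for \<open>s = l'\<close>.\<close>
  define K where "K = \<bar>l' - l\<bar> + 1"
  have "K > 0" by (simp add: K_def)
  then have "e / (2 * K) > 0" using \<open>e > 0\<close> by simp
  \<comment> \<open>The slope \<open>e / (2 * K)\<close> is chosen so that \<open>n\<close>
    intervals of radius \<open>e / (2 * K) * w\<close>, where \<open>n * w = K\<close>, have total
    length \<open>e\<close>.\<close>
  from flat[OF this] obtain \<delta> where "\<delta> > 0" and \<delta>: "\<And>t1 t2 s1 s2. t1 \<in> T \<Longrightarrow> t2 \<in> T \<Longrightarrow> R t1 s1 \<Longrightarrow> R t2 s2
      \<Longrightarrow> s1 \<in> {l..l'} \<Longrightarrow> s2 \<in> {l..l'} \<Longrightarrow> s1 \<le> s2 \<Longrightarrow> s2 - s1 < \<delta> \<Longrightarrow> \<bar>t2 - t1\<bar> \<le> e / (2 * K) * (s2 - s1)"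
    by blast
  obtain n :: nat where n: "n > 0" "K / n < \<delta>"
    using reals_Archimedean2[of "K / \<delta>"] \<open>\<delta> > 0\<close> \<open>K > 0\<close>
    by (metis divide_less_eq divide_pos_pos less_trans mult.commute of_nat_0_less_iff)
  define w where "w = K / n"
  have w: "w > 0" "w < \<delta>" using n \<open>K > 0\<close> by (simp_all add: w_def)
  define P where "P i = {t \<in> T. \<exists>s\<in>{l..l'}. R t s \<and> l + real i * w \<le> s \<and> s < l + (real i + 1) * w}" for i
  define c where "c i = (SOME t. t \<in> P i)" for i
  define J where "J i = {c i - e / (2 * K) * w..c i + e / (2 * K) * w}" for i
  have PJ: "P i \<subseteq> J i" for i
  proof
    fix t assume t: "t \<in> P i"
    then have "c i \<in> P i" unfolding c_def by (rule someI)
    then obtain s1 where s1: "c i \<in> T" "s1 \<in> {l..l'}" "R (c i) s1" "l + real i * w \<le> s1" "s1 < l + (real i + 1) * w"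
      by (auto simp: P_def)
    obtain s2 where s2: "t \<in> T" "s2 \<in> {l..l'}" "R t s2" "l + real i * w \<le> s2" "s2 < l + (real i + 1) * w"
      using t by (auto simp: P_def)
    have d: "\<bar>s2 - s1\<bar> < w" using s1 s2 by (auto simp: algebra_simps)
    have "\<bar>t - c i\<bar> \<le> e / (2 * K) * \<bar>s2 - s1\<bar>"
    proof (cases "s1 \<le> s2")
      case True
      then show ?thesis using \<delta>[of "c i" t s1 s2] s1 s2 d w by simp
    next
      case False
      then show ?thesis using \<delta>[of t "c i" s2 s1] s1 s2 d w by (simp add: abs_minus_commute)
    qed
    also have "\<dots> \<le> e / (2 * K) * w"
      using d \<open>e > 0\<close> \<open>K > 0\<close> by (intro mult_left_mono) auto
    finally show "t \<in> J i" by (auto simp: J_def abs_le_iff)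
  qed
  have "T \<subseteq> (\<Union>i<n. P i)"
  proof
    fix t assume "t \<in> T"
    then obtain s where s: "s \<in> {l..l'}" "R t s" using assms(1) by blast
    define i where "i = nat \<lfloor>(s - l) / w\<rfloor>"
    have i: "real i = \<lfloor>(s - l) / w\<rfloor>"
      using s w by (simp add: i_def)
    then have "real i \<le> (s - l) / w" "(s - l) / w < real i + 1" by linarith+
    then have "l + real i * w \<le> s" "s < l + (real i + 1) * w"
      using w by (simp_all add: field_simps)
    moreover have "i < n"
    proof -
      have "(s - l) / w < K / w"
        using s w by (intro divide_strict_right_mono) (auto simp: K_def)
      also have "K / w = n" using n \<open>K > 0\<close> by (simp add: w_def)
      finally have "real i < n" using \<open>real i \<le> (s - l) / w\<close> by linarith
      then show ?thesis by simp
    qed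
    ultimately show "t \<in> (\<Union>i<n. P i)"
      using s \<open>t \<in> T\<close> unfolding P_def by blast
  qed
  then have "T \<subseteq> (\<Union>i<n. J i)" using PJ by blast
  moreover have "(\<Union>i<n. J i) \<in> lmeasurable"
    by (intro fmeasurable.finite_UN) (auto simp: J_def)
  moreover have "measure lebesgue (\<Union>i<n. J i) \<le> (\<Sum>i<n. measure lebesgue (J i))"
    by (intro measure_UNION_le) (auto simp: J_def)
  moreover have "measure lebesgue (J i) = 2 * (e / (2 * K) * w)" for i
    using \<open>e > 0\<close> \<open>K > 0\<close> w by (simp add: J_def)
  ultimately show "\<exists>S. T \<subseteq> S \<and> S \<in> lmeasurable \<and> measure lebesgue S \<le> e"
    using \<open>K > 0\<close> n by (intro exI[of _ "\<Union>i<n. J i"]) (auto simp: w_def)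
qed

text \<open>Integrate the indicator of \<open>x + t *\<^sub>R N \<in> E\<close> over all
  \<open>(x, t)\<close>. Over \<open>t\<close> first the result is 0; over \<open>x\<close> first
  translation invariance gives the measure of \<open>E\<close> times the infinite length of the
  \<open>t\<close>-line. No splitting of the space along \<open>N\<close> is required.\<close>

lemma negligible_if_negligible_slices:
  fixes E :: "'a::euclidean_space set"
  assumes E: "E \<in> sets borel" and slices: "\<And>x. negligible {t::real. x + t *\<^sub>R N \<in> E}"
  shows "negligible E"
proof -
  have meas: "(\<lambda>(x, t). indicator E (x + t *\<^sub>R N) :: ennreal) \<in> borel_measurable (lborel \<Otimes>\<^sub>M lborel)"
  proof -
    have "(\<lambda>z. fst z + snd z *\<^sub>R N) \<in> borel_measurable (borel :: ('a \<times> real) measure)"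
      by (intro borel_measurable_continuous_onI continuous_intros)
    then have "(\<lambda>z. indicator E (fst z + snd z *\<^sub>R N) :: ennreal) \<in> borel_measurable (borel :: ('a \<times> real) measure)"
      using E by measurable
    then show ?thesis
      by (simp add: lborel_prod case_prod_unfold)
  qed
  have slice: "(\<integral>\<^sup>+ t. indicator E (x + t *\<^sub>R N) \<partial>lborel) = 0" for x
  proof -
    have sub: "{t::real. x + t *\<^sub>R N \<in> E} \<in> sets borel"
    proof -
      have "(\<lambda>t::real. x + t *\<^sub>R N) \<in> borel_measurable borel"
        by (intro borel_measurable_continuous_onI continuous_intros)
      from measurable_sets[OF this E] show ?thesis
        by (simp add: vimage_def)
    qed
    have "(\<integral>\<^sup>+ t. indicator E (x + t *\<^sub>R N) \<partial>lborel) = (\<integral>\<^sup>+ t. indicator {t. x + t *\<^sub>R N \<in> E} t \<partial>lborel)"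
      by (intro nn_integral_cong) (simp add: indicator_def)
    also have "\<dots> = emeasure lborel {t. x + t *\<^sub>R N \<in> E}"
      using sub by simp
    also have "\<dots> = 0"
      using slices[of x] sub by (simp add: negligible_iff_emeasure0)
    finally show ?thesis .
  qed
  have trans: "(\<integral>\<^sup>+ x. indicator E (x + t *\<^sub>R N) \<partial>lborel) = emeasure lborel E" for t :: real
  proof -
    have "emeasure lborel E = (\<integral>\<^sup>+ x. indicator E x \<partial>lborel)"
      using E by simp
    also have "\<dots> = (\<integral>\<^sup>+ x. indicator E x \<partial>(distr lborel borel ((+) (t *\<^sub>R N))))"
      by (simp add: lborel_distr_plus)
    also have "\<dots> = (\<integral>\<^sup>+ x. indicator E (t *\<^sub>R N + x) \<partial>lborel)"
      using E by (intro nn_integral_distr) auto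
    finally show ?thesis by (simp add: add.commute)
  qed
  have "(\<integral>\<^sup>+ t. \<integral>\<^sup>+ x. indicator E (x + t *\<^sub>R N) \<partial>lborel \<partial>(lborel :: real measure))
      = (\<integral>\<^sup>+ x. \<integral>\<^sup>+ t. indicator E (x + t *\<^sub>R N) \<partial>(lborel :: real measure) \<partial>lborel)"
    using lborel_pair.Fubini'[OF meas] by simp
  then have "emeasure lborel E * \<infinity> = 0"
    by (simp add: slice trans)
  then have "emeasure lborel E = 0" by simp
  then show ?thesis
    using E by (simp add: negligible_iff_emeasure0)
qed


text \<open>On a line in direction \<open>N\<close>, the parameter \<open>t\<close> of an exceptional direction is a function of
  the length \<open>s\<close> of its segment. Comparing two of them by the sign condition, at the shorter length
  and with the base point of the other, bounds \<open>t2 - t1\<close> between \<open>0\<close> and the variation of \<open>h\<close> along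
  a tangent line, which is \<open>o (s2 - s1)\<close>; so Sard's theorem is not needed.\<close>

lemma negligible_grazing_directions:
  fixes Y :: "'b::euclidean_space \<Rightarrow> 'a::euclidean_space"
  assumes der: "\<And>p. p \<in> ball p0 r \<Longrightarrow> (h has_derivative (\<lambda>w. w \<bullet> m p)) (at p)"
    and contm: "continuous_on (ball p0 r) m"
    and mN: "\<And>p. p \<in> ball p0 r \<Longrightarrow> m p \<bullet> N = 1"
    and C: "compact C" and D: "compact D" and Y: "continuous_on D Y" and "0 < l" "0 < r"
    and near: "\<And>e v s. e \<in> C \<Longrightarrow> v \<in> D \<Longrightarrow> s \<in> {l..l'} \<Longrightarrow> Y v + s *\<^sub>R e \<in> cball p0 (r / 2)"
  shows "negligible {e \<in> C. \<exists>v\<in>D. \<exists>s\<in>{l..l'}. h (Y v + s *\<^sub>R e) = 0 \<and> e \<bullet> m (Y v + s *\<^sub>R e) = 0 \<and>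
    (\<forall>v'\<in>D. \<forall>s'\<in>{l..l'}. 0 \<le> h (Y v' + min s' s *\<^sub>R e))}" (is "negligible ?E")
proof (rule negligible_if_negligible_slices)
  have sub: "cball p0 (r / 2) \<subseteq> ball p0 r"
    using \<open>0 < r\<close> by auto
  have near': "Y v + s *\<^sub>R e \<in> ball p0 r" if "e \<in> C" "v \<in> D" "s \<in> {l..l'}" for e v s
    using near[OF that] sub by blast
  have conth: "continuous_on (ball p0 r) h"
    using der by (meson continuous_at_imp_continuous_on has_derivative_continuous)
  define Z where "Z = C \<times> D \<times> {l..l'}"
  have Z: "compact Z" "closed Z"
    unfolding Z_def using C D by (auto intro!: compact_Times compact_imp_closed)
  have c0: "continuous_on Z (\<lambda>z. Y (fst (snd z)) + snd (snd z) *\<^sub>R fst z)"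
    unfolding Z_def by (intro continuous_intros continuous_on_compose2[OF Y]) auto
  have c1: "continuous_on Z (\<lambda>z. h (Y (fst (snd z)) + snd (snd z) *\<^sub>R fst z))"
    by (rule continuous_on_compose2[OF conth c0]) (auto simp: Z_def intro!: near')
  have "continuous_on Z (\<lambda>z. m (Y (fst (snd z)) + snd (snd z) *\<^sub>R fst z))"
    by (rule continuous_on_compose2[OF contm c0]) (auto simp: Z_def intro!: near')
  then have c2: "continuous_on Z (\<lambda>z. fst z \<bullet> m (Y (fst (snd z)) + snd (snd z) *\<^sub>R fst z))"
    by (intro continuous_intros)
  \<comment> \<open>Writing \<open>min s' s\<close> instead of restricting to
    \<open>s' \<le> s\<close> keeps the range of \<open>s'\<close> independent of \<open>s\<close>,
    so that the sign condition becomes an intersection of fixed closed sets.\<close>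
  have c3: "continuous_on Z (\<lambda>z. h (Y v' + min s' (snd (snd z)) *\<^sub>R fst z))" if "v' \<in> D" "s' \<in> {l..l'}" for v' s'
  proof (rule continuous_on_compose2[OF conth])
    show "continuous_on Z (\<lambda>z. Y v' + min s' (snd (snd z)) *\<^sub>R fst z)"
      by (intro continuous_intros continuous_on_min)
    show "(\<lambda>z. Y v' + min s' (snd (snd z)) *\<^sub>R fst z) ` Z \<subseteq> ball p0 r"
      using that near' by (fastforce simp: Z_def min_def simp del: mem_ball)
  qed
  let ?K1 = "Z \<inter> (\<lambda>z. h (Y (fst (snd z)) + snd (snd z) *\<^sub>R fst z)) -` {0}"
  let ?K2 = "Z \<inter> (\<lambda>z. fst z \<bullet> m (Y (fst (snd z)) + snd (snd z) *\<^sub>R fst z)) -` {0}"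
  let ?K3 = "\<lambda>q. Z \<inter> (\<lambda>z. h (Y (fst q) + min (snd q) (snd (snd z)) *\<^sub>R fst z)) -` {0..}"
  \<comment> \<open>The exceptional set is the projection of this compact set, hence closed; Fubini
    needs it to be Borel.\<close>
  define K where "K = Z \<inter> (?K1 \<inter> ?K2 \<inter> (\<Inter>q\<in>D \<times> {l..l'}. ?K3 q))"
  have "closed (?K1 \<inter> ?K2 \<inter> (\<Inter>q\<in>D \<times> {l..l'}. ?K3 q))"
    using c1 c2 c3 Z(2) by (intro closed_Int closed_INT ballI continuous_closed_preimage) auto
  then have "compact K"
    unfolding K_def using Z(1) by (rule compact_Int_closed[rotated])
  then have "compact (fst ` K)"
    by (intro compact_continuous_image continuous_intros)
  moreover have "fst ` K = ?E"
  proof (intro set_eqI iffI)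
    fix e assume "e \<in> fst ` K"
    then obtain v s where "(e, v, s) \<in> K" by auto
    then have "(e, v, s) \<in> ?K1" "(e, v, s) \<in> ?K2" and K3: "\<And>q. q \<in> D \<times> {l..l'} \<Longrightarrow> (e, v, s) \<in> ?K3 q"
      unfolding K_def by blast+
    then have "e \<in> C" "v \<in> D" "s \<in> {l..l'}" "h (Y v + s *\<^sub>R e) = 0" "e \<bullet> m (Y v + s *\<^sub>R e) = 0"
      by (auto simp: Z_def)
    moreover have "0 \<le> h (Y v' + min s' s *\<^sub>R e)" if "v' \<in> D" "s' \<in> {l..l'}" for v' s'
      using K3[of "(v', s')"] that by simp
    ultimately show "e \<in> ?E" by blast
  next
    fix e assume "e \<in> ?E"
    then obtain v s where "e \<in> C" "v \<in> D" "s \<in> {l..l'}" "h (Y v + s *\<^sub>R e) = 0" "e \<bullet> m (Y v + s *\<^sub>R e) = 0"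
      "\<forall>v'\<in>D. \<forall>s'\<in>{l..l'}. 0 \<le> h (Y v' + min s' s *\<^sub>R e)" by blast
    then have "(e, v, s) \<in> K"
      by (auto simp: K_def Z_def)
    then show "e \<in> fst ` K" by force
  qed
  ultimately show "?E \<in> sets borel"
    using borel_closed compact_imp_closed by metis
next
  have sub: "cball p0 (r / 2) \<subseteq> ball p0 r"
    using \<open>0 < r\<close> by auto
  have near': "Y v + s *\<^sub>R e \<in> ball p0 r" if "e \<in> C" "v \<in> D" "s \<in> {l..l'}" for e v s
    using near[OF that] sub by blast
  \<comment> \<open>The gradient has component 1 along \<open>N\<close> throughout the ball, so the
    change of \<open>h\<close> is exact and not just first order.\<close>
  have shift: "h q = h p + c" if pq: "p \<in> ball p0 r" "q \<in> ball p0 r" "q - p = c *\<^sub>R N" for p q c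
  proof -
    let ?k = "\<lambda>x. p + x *\<^sub>R (q - p)"
    have k: "?k x \<in> ball p0 r" if "0 \<le> x" "x \<le> 1" for x
      using convexD_alt[OF convex_ball pq(1,2) that] by (simp add: algebra_simps)
    have d: "((\<lambda>x. h (?k x)) has_real_derivative c) (at x)" if "0 \<le> x" "x \<le> 1" for x
    proof -
      have "(?k has_derivative (\<lambda>y. y *\<^sub>R (q - p))) (at x)"
        by (auto intro!: derivative_eq_intros)
      from has_derivative_compose[OF this der[OF k[OF that]]]
      have "((\<lambda>x. h (?k x)) has_derivative (\<lambda>y. (y *\<^sub>R (q - p)) \<bullet> m (?k x))) (at x)" .
      moreover have "(q - p) \<bullet> m (?k x) = c"
        using mN[OF k[OF that]] pq(3) by (simp add: inner_commute)
      ultimately show ?thesis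
        by (simp add: has_field_derivative_def mult_commute_abs)
    qed
    obtain z where "h (?k 1) - h (?k 0) = (1 - 0) * c"
      using MVT2[of 0 1 "\<lambda>x. h (?k x)" "\<lambda>x. c"] d by auto
    then show ?thesis by simp
  qed
  fix x0 :: 'a
  let ?e = "\<lambda>t. x0 + t *\<^sub>R N"
  define R where "R t s \<longleftrightarrow> (\<exists>v\<in>D. h (Y v + s *\<^sub>R ?e t) = 0 \<and> ?e t \<bullet> m (Y v + s *\<^sub>R ?e t) = 0 \<and>
    (\<forall>v'\<in>D. \<forall>s'\<in>{l..l'}. 0 \<le> h (Y v' + min s' s *\<^sub>R ?e t)))" for t s
  show "negligible {t. ?e t \<in> ?E}"
  proof (rule negligible_if_flat_multigraph[of _ l l' R])
    show "\<exists>s\<in>{l..l'}. R t s" if "t \<in> {t. ?e t \<in> ?E}" for t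
      using that by (auto simp: R_def)
    fix \<epsilon> :: real assume "\<epsilon> > 0"
    obtain B where B: "B > 0" "\<And>e. e \<in> C \<Longrightarrow> norm e \<le> B"
      using compact_imp_bounded[OF C] bounded_pos by metis
    have "uniformly_continuous_on (cball p0 (r / 2)) m"
      using continuous_on_subset[OF contm sub] by (intro compact_uniformly_continuous) auto
    \<comment> \<open>Changing \<open>m\<close> by at most this amount changes
      \<open>e \<bullet> m\<close> by at most \<open>\<epsilon> * l\<close>, as \<open>B\<close>
      bounds \<open>e\<close>; the factor \<open>l\<close> is cancelled at the end by
      \<open>l \<le> s1\<close>.\<close>
    moreover have "\<epsilon> * l / B > 0" using \<open>\<epsilon> > 0\<close> B \<open>0 < l\<close> by simp
    ultimately obtain d where "d > 0" and d: "\<And>p q. p \<in> cball p0 (r / 2) \<Longrightarrow> q \<in> cball p0 (r / 2) \<Longrightarrow>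
        dist q p < d \<Longrightarrow> dist (m q) (m p) < \<epsilon> * l / B"
      unfolding uniformly_continuous_on_def by blast
    have "\<bar>t2 - t1\<bar> \<le> \<epsilon> * (s2 - s1)" if E: "?e t1 \<in> C" "?e t2 \<in> C" and R: "R t1 s1" "R t2 s2"
      and s: "s1 \<in> {l..l'}" "s2 \<in> {l..l'}" "s1 \<le> s2" "s2 - s1 < d / B" for t1 t2 s1 s2
    proof -
      obtain v1 where v1: "v1 \<in> D" "h (Y v1 + s1 *\<^sub>R ?e t1) = 0"
        and pos1: "\<And>v'. v' \<in> D \<Longrightarrow> 0 \<le> h (Y v' + s1 *\<^sub>R ?e t1)"
        using R(1) s(1) unfolding R_def by (metis min.idem)
      \<comment> \<open>As \<open>s1 \<le> s2\<close>, the sign condition for the longer segment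
        also covers length \<open>s1\<close>, in direction \<open>?e t2\<close> and from every foot
        in \<open>D\<close>.\<close>
      obtain v2 where v2: "v2 \<in> D" "h (Y v2 + s2 *\<^sub>R ?e t2) = 0" "?e t2 \<bullet> m (Y v2 + s2 *\<^sub>R ?e t2) = 0"
        and pos2: "\<And>v'. v' \<in> D \<Longrightarrow> 0 \<le> h (Y v' + s1 *\<^sub>R ?e t2)"
        using R(2) s(1,3) unfolding R_def by (metis min.absorb1)
      have move: "h (Y v + s1 *\<^sub>R ?e t2) = h (Y v + s1 *\<^sub>R ?e t1) + s1 * (t2 - t1)" if "v \<in> D" for v
      proof (rule shift)
        show "Y v + s1 *\<^sub>R ?e t1 \<in> ball p0 r" "Y v + s1 *\<^sub>R ?e t2 \<in> ball p0 r"
          using that E s(1) by (simp_all only: near')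
      qed (simp add: algebra_simps)
      \<comment> \<open>At the foot \<open>v1\<close>, \<open>h\<close> vanishes for
        \<open>t1\<close> and must be nonnegative for \<open>t2\<close>.\<close>
      have "0 \<le> s1 * (t2 - t1)"
        using move[OF v1(1)] pos2[OF v1(1)] v1(2) by simp
      moreover have "s1 > 0" using s(1) \<open>0 < l\<close> by simp
      ultimately have mono: "t1 \<le> t2"
        by (simp add: zero_le_mult_iff)
      \<comment> \<open>Going back from \<open>s2\<close> to \<open>s1\<close> along the segment,
        \<open>h\<close> starts at 0 with slope 0 by tangency, and uniform continuity of
        \<open>m\<close> keeps the slope small on the way.\<close>
      have up: "h (Y v2 + s1 *\<^sub>R ?e t2) \<le> (\<epsilon> * l) * (s2 - s1)"
      proof (cases "s1 = s2")
        case True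
        then show ?thesis using v2 by simp
      next
        case False
        then have "s1 < s2" using s by simp
        let ?p = "\<lambda>s. Y v2 + s *\<^sub>R ?e t2"
        have "((\<lambda>s. h (?p s)) has_real_derivative ?e t2 \<bullet> m (?p s)) (at s)" if "s1 \<le> s" "s \<le> s2" for s
        proof -
          have "(?p has_derivative (\<lambda>y. y *\<^sub>R ?e t2)) (at s)"
            by (auto intro!: derivative_eq_intros)
          moreover have "?p s \<in> ball p0 r"
            using that s E v2 by (intro near') auto
          ultimately have "((\<lambda>s. h (?p s)) has_derivative (\<lambda>y. (y *\<^sub>R ?e t2) \<bullet> m (?p s))) (at s)"
            using has_derivative_compose der by blast
          then show ?thesis
            by (simp add: has_field_derivative_def mult_commute_abs)
        qed
        then obtain z where z: "s1 < z" "z < s2" "h (?p s2) - h (?p s1) = (s2 - s1) * (?e t2 \<bullet> m (?p z))"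
          using MVT2[OF \<open>s1 < s2\<close>, of "\<lambda>s. h (?p s)" "\<lambda>s. ?e t2 \<bullet> m (?p s)"] by blast
        have "dist (?p z) (?p s2) = \<bar>z - s2\<bar> * norm (?e t2)"
          by (simp add: dist_norm scaleR_diff_left[symmetric] del: scaleR_add_right)
        also have "\<dots> \<le> (s2 - s1) * B"
          using z B(2)[OF E(2)] by (intro mult_mono) auto
        also have "\<dots> < d"
          using s(4) B(1) by (simp add: field_simps)
        finally have "dist (m (?p z)) (m (?p s2)) < \<epsilon> * l / B"
          using z s E v2 by (intro d near) auto
        then have "norm (m (?p z) - m (?p s2)) \<le> \<epsilon> * l / B"
          by (simp add: dist_norm)
        have "- (?e t2 \<bullet> m (?p z)) = - (?e t2 \<bullet> (m (?p z) - m (?p s2)))"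
          using v2(3) by (simp add: inner_diff_right)
        also have "\<dots> \<le> norm (?e t2) * norm (m (?p z) - m (?p s2))"
          using Cauchy_Schwarz_ineq2[of "?e t2" "m (?p z) - m (?p s2)"] by linarith
        also have "\<dots> \<le> B * (\<epsilon> * l / B)"
          using B(2)[OF E(2)] \<open>norm (m (?p z) - m (?p s2)) \<le> \<epsilon> * l / B\<close> by (intro mult_mono) (use B(1) in auto)
        finally have "- (?e t2 \<bullet> m (?p z)) \<le> \<epsilon> * l" using B(1) by simp
        then have "(s2 - s1) * - (?e t2 \<bullet> m (?p z)) \<le> (s2 - s1) * (\<epsilon> * l)"
          using \<open>s1 < s2\<close> by (intro mult_left_mono) auto
        then show ?thesis using z(3) v2(2) by (simp add: algebra_simps)
      qed
      \<comment> \<open>Now the roles are exchanged: \<open>h\<close> at the foot \<open>v2\<close>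
        is nonnegative in direction \<open>?e t1\<close>, and the move to \<open>?e t2\<close> adds
        exactly \<open>s1 * (t2 - t1)\<close>.\<close>
      have "s1 * (t2 - t1) \<le> (\<epsilon> * l) * (s2 - s1)"
        using up move[OF v2(1)] pos1[OF v2(1)] by simp
      moreover have "l * (t2 - t1) \<le> s1 * (t2 - t1)"
        using s(1) mono by (intro mult_right_mono) auto
      ultimately have "l * (t2 - t1) \<le> l * (\<epsilon> * (s2 - s1))" by (simp add: algebra_simps)
      then show ?thesis using \<open>0 < l\<close> mono by simp
    qed
    then show "\<exists>\<delta>>0. \<forall>t1 t2 s1 s2. t1 \<in> {t. ?e t \<in> ?E} \<and> t2 \<in> {t. ?e t \<in> ?E} \<and> R t1 s1 \<and> R t2 s2
      \<and> s1 \<in> {l..l'} \<and> s2 \<in> {l..l'} \<and> s1 \<le> s2 \<and> s2 - s1 < \<delta> \<longrightarrow> \<bar>t2 - t1\<bar> \<le> \<epsilon> * (s2 - s1)"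
      using \<open>d > 0\<close> \<open>B > 0\<close> by (intro exI[of _ "d / B"]) auto
  qed
qed

text \<open>The directions to be avoided are those \<open>e\<close> which are tangent to \<open>X\<close> at the end of a locally
  shortest segment from \<open>Y\<close> to \<open>X\<close> parallel to \<open>e\<close>.\<close>

definition grazing ::
  "'b::euclidean_space set \<Rightarrow> ('b \<Rightarrow> 'a::euclidean_space) \<Rightarrow> 'b set \<Rightarrow> ('b \<Rightarrow> 'a) \<Rightarrow> real
    \<Rightarrow> ('a \<times> 'b \<times> 'b \<times> real) set" where
  "grazing U X V Y \<rho> = {(e, u, v, s). u \<in> U \<and> v \<in> V \<and> s > 0 \<and> X u = Y v + s *\<^sub>R e \<and>
     e \<in> range (frechet_derivative X (at u)) \<and>
     (\<forall>u'\<in>U \<inter> ball u \<rho>. \<forall>v'\<in>V \<inter> ball v \<rho>. \<forall>s'\<in>{s-\<rho><..<s}. X u' \<noteq> Y v' + s' *\<^sub>R e)}"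

lemma connected_nonzero_constant_sign:
  fixes f :: "'x::topological_space \<Rightarrow> real"
  assumes "connected S" "continuous_on S f" "\<And>x. x \<in> S \<Longrightarrow> f x \<noteq> 0"
  shows "(\<forall>x\<in>S. f x > 0) \<or> (\<forall>x\<in>S. f x < 0)"
proof (rule ccontr)
  assume "\<not> ?thesis"
  then obtain x y where "x \<in> S" "y \<in> S" "f x \<le> 0" "0 \<le> f y"
    by (meson linorder_le_less_linear)
  then have "0 \<in> f ` S"
    using connectedD_interval[OF connected_continuous_image[OF assms(2,1)], of "f x" "f y" 0] by blast
  then show False using assms(3) by force
qed

text \<open>The sign of a defining function of \<open>X\<close> along the shorter parallel segments is constant, since
  they avoid \<open>X\<close>.\<close>

lemma one_sided_near_minimal_segment:
  fixes Y :: "'b::euclidean_space \<Rightarrow> 'a::euclidean_space"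
  assumes h: "continuous_on B h" and Y: "continuous_on D Y" and "connected D" and "l < s" "s \<le> l'"
    and near: "\<And>v s. v \<in> D \<Longrightarrow> s \<in> {l..l'} \<Longrightarrow> Y v + s *\<^sub>R e \<in> B"
    and nz: "\<And>v s'. v \<in> D \<Longrightarrow> s' \<in> {l..<s} \<Longrightarrow> h (Y v + s' *\<^sub>R e) \<noteq> (0::real)"
  shows "(\<forall>v\<in>D. \<forall>s'\<in>{l..s}. 0 \<le> h (Y v + s' *\<^sub>R e)) \<or> (\<forall>v\<in>D. \<forall>s'\<in>{l..s}. h (Y v + s' *\<^sub>R e) \<le> 0)"
proof -
  have cont: "continuous_on (D \<times> {l..s}) (\<lambda>z. h (Y (fst z) + snd z *\<^sub>R e))"
    by (intro continuous_on_compose2[OF h] continuous_intros continuous_on_compose2[OF Y])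
      (use near assms(5) in auto)
  \<comment> \<open>Strict signs are available only for lengths below \<open>s\<close>; the limit
    from the left gives the weak inequality at \<open>s\<close> itself.\<close>
  have lim: "((\<lambda>s'. h (Y v + s' *\<^sub>R e)) \<longlongrightarrow> h (Y v + s *\<^sub>R e)) (at_left s)" if "v \<in> D" for v
  proof -
    have "continuous_on {l..s} (\<lambda>s'. h (Y v + s' *\<^sub>R e))"
      using that by (intro continuous_on_compose2[OF cont, where f="\<lambda>s'. (v, s')", simplified] continuous_intros) auto
    then have "((\<lambda>s'. h (Y v + s' *\<^sub>R e)) \<longlongrightarrow> h (Y v + s *\<^sub>R e)) (at s within {l..s})"
      using \<open>l < s\<close> by (simp add: continuous_on)
    then show ?thesis
      using at_within_Icc_at_left[OF \<open>l < s\<close>] by simp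
  qed
  have ev: "\<forall>\<^sub>F s' in at_left s. s' \<in> {l..<s}"
    using eventually_at_left_real[OF \<open>l < s\<close>] by (rule eventually_mono) auto
  consider "\<forall>z\<in>D \<times> {l..<s}. h (Y (fst z) + snd z *\<^sub>R e) > 0" | "\<forall>z\<in>D \<times> {l..<s}. h (Y (fst z) + snd z *\<^sub>R e) < 0"
    using connected_nonzero_constant_sign[of "D \<times> {l..<s}" "\<lambda>z. h (Y (fst z) + snd z *\<^sub>R e)"] nz \<open>connected D\<close>
      continuous_on_subset[OF cont, of "D \<times> {l..<s}"] by (force intro!: connected_Times)
  then show ?thesis
  proof cases
    case 1
    have "0 \<le> h (Y v + s *\<^sub>R e)" if "v \<in> D" for v
      by (rule tendsto_lowerbound[OF lim[OF that]]) (use ev 1 that in \<open>auto elim!: eventually_mono intro: less_imp_le\<close>)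
    then show ?thesis using 1
      by (smt (verit, best) SigmaI atLeastAtMost_iff atLeastLessThan_iff fst_conv snd_conv)
  next
    case 2
    have "h (Y v + s *\<^sub>R e) \<le> 0" if "v \<in> D" for v
      by (rule tendsto_upperbound[OF lim[OF that]]) (use ev 2 that in \<open>auto elim!: eventually_mono intro: less_imp_le\<close>)
    then show ?thesis using 2
      by (smt (verit, best) SigmaI atLeastAtMost_iff atLeastLessThan_iff fst_conv snd_conv)
  qed
qed

lemma segment_endpoints_near:
  fixes Y :: "'b::metric_space \<Rightarrow> 'a::real_normed_vector"
  assumes "open V" "continuous_on V Y" "v0 \<in> V" "r > 0" "k > 0"
  obtains \<eta> where "\<eta> > 0" "\<eta> < k" "cball v0 \<eta> \<subseteq> V"
    "\<And>e v s. e \<in> cball e0 \<eta> \<Longrightarrow> v \<in> cball v0 \<eta> \<Longrightarrow> s \<in> {s0-\<eta>..s0+\<eta>} \<Longrightarrow>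
      Y v + s *\<^sub>R e \<in> cball (Y v0 + s0 *\<^sub>R e0) r"
proof -
  let ?f = "\<lambda>(e, v, s). Y v + s *\<^sub>R e"
  let ?B = "(UNIV \<times> V \<times> UNIV) \<inter> ?f -` ball (Y v0 + s0 *\<^sub>R e0) r"
  have "continuous_on (UNIV \<times> V \<times> UNIV) ?f"
    unfolding case_prod_unfold by (intro continuous_intros continuous_on_compose2[OF assms(2)]) auto
  moreover have "open (UNIV \<times> V \<times> UNIV)" using \<open>open V\<close> by (intro open_Times) auto
  ultimately have "open ?B"
    by (intro continuous_open_preimage) auto
  moreover have "(e0, v0, s0) \<in> ?B"
    using assms by simp
  ultimately obtain d where d: "d > 0" "ball (e0, v0, s0) d \<subseteq> ?B"
    using open_contains_ball by metis
  \<comment> \<open>Three component distances, each at most \<open>\<eta>\<close>, must add up to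
    less than \<open>d\<close>.\<close>
  define \<eta> where "\<eta> = min d k / 4"
  have \<eta>: "\<eta> > 0" "\<eta> \<le> d / 4" "\<eta> < k"
    using d \<open>k > 0\<close> by (auto simp: \<eta>_def)
  have in_ball: "(e, v, s) \<in> ball (e0, v0, s0) d" if "e \<in> cball e0 \<eta>" "v \<in> cball v0 \<eta>" "s \<in> {s0-\<eta>..s0+\<eta>}" for e v s
  proof -
    have "dist (e0, v0, s0) (e, v, s) \<le> dist e0 e + (dist v0 v + dist s0 s)"
      unfolding dist_Pair_Pair[of e0 "(v0, s0)"] dist_Pair_Pair[of v0 s0]
      using sqrt_sum_squares_le_sum[of "dist e0 e" "sqrt ((dist v0 v)\<^sup>2 + (dist s0 s)\<^sup>2)"]
        sqrt_sum_squares_le_sum[of "dist v0 v" "dist s0 s"] by simp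
    also have "\<dots> \<le> \<eta> + (\<eta> + \<eta>)"
      using that by (intro add_mono) (auto simp: dist_real_def)
    also have "\<dots> < d" using \<eta> \<open>d > 0\<close> by simp
    finally show ?thesis by simp
  qed
  show ?thesis
  proof (rule that[of \<eta>])
    show "cball v0 \<eta> \<subseteq> V"
    proof
      fix v assume "v \<in> cball v0 \<eta>"
      then have "(e0, v, s0) \<in> ball (e0, v0, s0) d" using \<eta>(1) by (intro in_ball) auto
      then show "v \<in> V" using d by blast
    qed
    show "Y v + s *\<^sub>R e \<in> cball (Y v0 + s0 *\<^sub>R e0) r"
      if "e \<in> cball e0 \<eta>" "v \<in> cball v0 \<eta>" "s \<in> {s0-\<eta>..s0+\<eta>}" for e v s
      using subsetD[OF d(2) in_ball[OF that]] by simp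
  qed (use \<eta> in auto)
qed

text \<open>With a defining function \<open>h\<close> of one sheet near \<open>X u0\<close>,
  one-sidedness puts every nearby grazing direction into the exceptional set of \<open>h\<close> or
  into that of \<open>- h\<close>, and both are null.\<close>

lemma grazing_locally_negligible:
  fixes X Y :: "'b::euclidean_space \<Rightarrow> 'a::euclidean_space"
  assumes dim: "DIM('a) = DIM('b) + 1" and "open U" "open V"
    and X: "smooth_on U X" "\<And>u. u \<in> U \<Longrightarrow> inj (frechet_derivative X (at u))"
    and Y: "continuous_on V Y" and "\<rho> > 0" and z: "z \<in> grazing U X V Y \<rho>"
  shows "\<exists>W. open W \<and> z \<in> W \<and> negligible (fst ` (W \<inter> grazing U X V Y \<rho>))"
proof -
  obtain e0 u0 v0 s0 where z_eq: "z = (e0, u0, v0, s0)" using prod_cases4 by blast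
  have 0: "u0 \<in> U" "v0 \<in> V" "s0 > 0" "X u0 = Y v0 + s0 *\<^sub>R e0"
    using z by (auto simp: z_eq grazing_def)
  obtain U0 \<nu> where U0: "open U0" "u0 \<in> U0" "U0 \<subseteq> U" and \<nu>: "smooth_unit_normal U0 X \<nu>"
    using exists_smooth_unit_normal[OF dim \<open>open U\<close> \<open>u0 \<in> U\<close> X(1) X(2)[OF \<open>u0 \<in> U\<close>]] by blast
  \<comment> \<open>With radius \<open>\<rho> / 2\<close>, any two points of \<open>U1\<close> are
    closer than \<open>\<rho>\<close>, so minimality at a nearby \<open>u\<close>, not only at
    \<open>u0\<close>, excludes all competitors in \<open>U1\<close>.\<close>
  define U1 where "U1 = U0 \<inter> ball u0 (\<rho> / 2)"
  have U1: "open U1" "u0 \<in> U1" "U1 \<subseteq> U" "U1 \<subseteq> U0"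
    using U0 \<open>\<rho> > 0\<close> by (auto simp: U1_def)
  have \<nu>1: "smooth_unit_normal U1 X \<nu>"
    using \<nu> smooth_on_subset[OF _ U1(4)] U1(4) by (auto simp: smooth_unit_normal_def)
  obtain r h m O1 where "r > 0" and O1: "open O1" "u0 \<in> O1" "O1 \<subseteq> U1"
    and derh: "\<And>p. p \<in> ball (X u0) r \<Longrightarrow> (h has_derivative (\<lambda>w. w \<bullet> m p)) (at p)"
    and contm: "continuous_on (ball (X u0) r) m"
    and mN: "\<And>p. p \<in> ball (X u0) r \<Longrightarrow> m p \<bullet> \<nu> u0 = 1"
    and h0: "\<And>p. p \<in> ball (X u0) r \<Longrightarrow> h p = 0 \<Longrightarrow> \<exists>u\<in>U1. p = X u"
    and "\<And>u. u \<in> O1 \<Longrightarrow> X u \<in> ball (X u0) r"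
    and hX: "\<And>u. u \<in> O1 \<Longrightarrow> h (X u) = 0"
    and "\<And>u. u \<in> O1 \<Longrightarrow> \<nu> u \<bullet> \<nu> u0 > 0"
    and mX: "\<And>u. u \<in> O1 \<Longrightarrow> m (X u) = inverse (\<nu> u \<bullet> \<nu> u0) *\<^sub>R \<nu> u"
    and "m differentiable (at (X u0))"
    by (rule local_defining_function[OF dim U1(1,2) smooth_on_subset[OF X(1) U1(3)] X(2)[OF \<open>u0 \<in> U\<close>] \<nu>1]) (rule that)
  have conth: "continuous_on (ball (X u0) r) h"
    using derh by (meson continuous_at_imp_continuous_on has_derivative_continuous)
  \<comment> \<open>The bound \<open>\<rho> / 4\<close> puts feet and lengths in the box within
    \<open>\<rho>\<close> of each other, and \<open>s0 / 2\<close> keeps the smallest length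
    \<open>l\<close> positive.\<close>
  obtain \<eta> where \<eta>: "\<eta> > 0" "\<eta> < min (\<rho> / 4) (s0 / 2)" "cball v0 \<eta> \<subseteq> V"
    and near: "\<And>e v s. e \<in> cball e0 \<eta> \<Longrightarrow> v \<in> cball v0 \<eta> \<Longrightarrow> s \<in> {s0-\<eta>..s0+\<eta>} \<Longrightarrow> Y v + s *\<^sub>R e \<in> cball (X u0) (r / 2)"
    by (rule segment_endpoints_near[OF \<open>open V\<close> Y \<open>v0 \<in> V\<close>, where r="r / 2" and k="min (\<rho> / 4) (s0 / 2)"
          and ?e0.0=e0 and ?s0.0=s0, folded 0(4)])
      (use \<open>r > 0\<close> \<open>\<rho> > 0\<close> \<open>s0 > 0\<close> that in auto)
  define l l' where "l = s0 - \<eta>" and "l' = s0 + \<eta>"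
  let ?C = "cball e0 \<eta>" and ?D = "cball v0 \<eta>"
  define E where "E h m = {e \<in> ?C. \<exists>v\<in>?D. \<exists>s\<in>{l..l'}. h (Y v + s *\<^sub>R e) = 0 \<and> e \<bullet> m (Y v + s *\<^sub>R e) = 0 \<and>
    (\<forall>v'\<in>?D. \<forall>s'\<in>{l..l'}. 0 \<le> h (Y v' + min s' s *\<^sub>R e))}" for h :: "'a \<Rightarrow> real" and m
  have YD: "continuous_on ?D Y" using Y \<eta>(3) by (rule continuous_on_subset)
  have l: "0 < l" using \<eta> by (simp add: l_def)
  have "negligible (E h m)"
    unfolding E_def using negligible_grazing_directions[OF derh contm mN compact_cball compact_cball YD l \<open>r > 0\<close>]
      near[folded l_def l'_def] by blast
  moreover have "negligible (E (\<lambda>p. - h p) (\<lambda>p. - m p))"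
  proof -
    \<comment> \<open>Negating \<open>h\<close>, \<open>m\<close> and the normal together preserves
      the normalisation, so the other sign needs no estimate of its own.\<close>
    have 1: "((\<lambda>p. - h p) has_derivative (\<lambda>w. w \<bullet> - m p)) (at p)" if "p \<in> ball (X u0) r" for p
      using has_derivative_minus[OF derh[OF that]] by simp
    have 2: "continuous_on (ball (X u0) r) (\<lambda>p. - m p)" using contm by (intro continuous_intros)
    have 3: "- m p \<bullet> - \<nu> u0 = 1" if "p \<in> ball (X u0) r" for p using mN[OF that] by simp
    show ?thesis
      unfolding E_def
      by (rule negligible_grazing_directions[OF 1 2 3 compact_cball compact_cball YD l \<open>r > 0\<close>
            near[folded l_def l'_def]])
  qed
  ultimately have neg: "negligible (E h m \<union> E (\<lambda>p. - h p) (\<lambda>p. - m p))"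
    by (rule negligible_Un)
  define W where "W = ball e0 \<eta> \<times> O1 \<times> ball v0 \<eta> \<times> {s0-\<eta><..<s0+\<eta>}"
  have "e \<in> E h m \<union> E (\<lambda>p. - h p) (\<lambda>p. - m p)" if e: "e \<in> fst ` (W \<inter> grazing U X V Y \<rho>)" for e
  proof -
    obtain u v s where g: "(e, u, v, s) \<in> W" "(e, u, v, s) \<in> grazing U X V Y \<rho>" using e by auto
    have W: "e \<in> ?C" "u \<in> O1" "v \<in> ?D" "l < s" "s \<le> l'" and d: "dist e0 e < \<eta>" "dist v0 v < \<eta>" "\<bar>s - s0\<bar> < \<eta>"
      using g(1) by (auto simp: W_def l_def l'_def)
    have G: "X u = Y v + s *\<^sub>R e" "e \<in> range (frechet_derivative X (at u))"
      and sep: "\<And>u' v' s'. u' \<in> U \<Longrightarrow> u' \<in> ball u \<rho> \<Longrightarrow> v' \<in> V \<Longrightarrow> v' \<in> ball v \<rho> \<Longrightarrow> s - \<rho> < s' \<Longrightarrow> s' < s \<Longrightarrow> X u' \<noteq> Y v' + s' *\<^sub>R e"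
      using g(2) by (auto simp: grazing_def)
    have "u \<in> U1" using W O1 by auto
    have nearE: "Y v + s *\<^sub>R e \<in> ball (X u0) r" if "v \<in> ?D" "s \<in> {l..l'}" for v s
    proof -
      have "Y v + s *\<^sub>R e \<in> cball (X u0) (r / 2)"
        using near[OF W(1) that(1)] that(2) by (simp add: l_def l'_def)
      then show ?thesis using \<open>r > 0\<close> by auto
    qed
    have nz: "h (Y v' + s' *\<^sub>R e) \<noteq> 0" if vs: "v' \<in> ?D" "s' \<in> {l..<s}" for v' s'
    proof
      assume "h (Y v' + s' *\<^sub>R e) = 0"
      moreover have "s' \<in> {l..l'}" using vs W by auto
      ultimately obtain u' where u': "u' \<in> U1" "Y v' + s' *\<^sub>R e = X u'"
        using h0[OF nearE[OF vs(1) \<open>s' \<in> {l..l'}\<close>]] by blast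
      have "dist u u' < \<rho>"
        using u'(1) \<open>u \<in> U1\<close> dist_triangle_half_r[of u0 u \<rho> u'] by (auto simp: U1_def)
      moreover have "dist v v' < \<rho>"
        using d(2) vs(1) \<eta>(1,2) dist_triangle3[of v v' v0] by auto
      moreover have "s - \<rho> < s'" using vs(2) d(3) \<eta>(2) \<eta>(1) by (auto simp: l_def)
      ultimately show False
        using sep[of u' v' s'] u' subsetD[OF U1(3) u'(1)] subsetD[OF \<eta>(3) vs(1)] vs by auto
    qed
    have "e \<bullet> \<nu> u = 0"
      using G(2) \<nu>1 \<open>u \<in> U1\<close> by (auto simp: smooth_unit_normal_def)
    then have em: "e \<bullet> m (Y v + s *\<^sub>R e) = 0" and hm: "h (Y v + s *\<^sub>R e) = 0"
      using mX[OF W(2)] hX[OF W(2)] G(1) by simp_all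
    have sgn: "(\<forall>v\<in>?D. \<forall>s'\<in>{l..s}. 0 \<le> h (Y v + s' *\<^sub>R e)) \<or> (\<forall>v\<in>?D. \<forall>s'\<in>{l..s}. h (Y v + s' *\<^sub>R e) \<le> 0)"
      using one_sided_near_minimal_segment[OF conth YD connected_cball W(4,5) nearE nz] by blast
    have min: "min s' s \<in> {l..s}" if "s' \<in> {l..l'}" for s' using that W by auto
    have s: "s \<in> {l..l'}" using W by auto
    from sgn show ?thesis
    proof
      assume "\<forall>v\<in>?D. \<forall>s'\<in>{l..s}. 0 \<le> h (Y v + s' *\<^sub>R e)"
      then have "e \<in> E h m"
        unfolding E_def using W(1,3) s em hm min by blast
      then show ?thesis ..
    next
      assume a: "\<forall>v\<in>?D. \<forall>s'\<in>{l..s}. h (Y v + s' *\<^sub>R e) \<le> 0"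
      have "e \<in> E (\<lambda>p. - h p) (\<lambda>p. - m p)"
        unfolding E_def mem_Collect_eq
      proof (intro conjI bexI[of _ v] bexI[of _ s] ballI)
        show "0 \<le> - h (Y v' + min s' s *\<^sub>R e)" if "v' \<in> ?D" "s' \<in> {l..l'}" for v' s'
          using a that(1) min[OF that(2)] by simp
      qed (use W s em hm in auto)
      then show ?thesis ..
    qed
  qed
  then have "negligible (fst ` (W \<inter> grazing U X V Y \<rho>))"
    using negligible_subset[OF neg] by blast
  moreover have "open W" unfolding W_def using O1 by (intro open_Times) auto
  moreover have "z \<in> W" using O1 \<eta> by (simp add: W_def z_eq)
  ultimately show ?thesis by blast
qed

text \<open>Points with nearby images may be far apart in the domain, so the cover is taken in the
  domain, where the Lindelof property makes it countable.\<close>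

lemma negligible_image_if_locally:
  fixes f :: "'x::second_countable_topology \<Rightarrow> 'a::euclidean_space"
  assumes "\<And>z. z \<in> Z \<Longrightarrow> \<exists>W. open W \<and> z \<in> W \<and> negligible (f ` (W \<inter> Z))"
  shows "negligible (f ` Z)"
proof -
  define \<F> where "\<F> = {W. open W \<and> negligible (f ` (W \<inter> Z))}"
  obtain \<F>' where \<F>': "\<F>' \<subseteq> \<F>" "countable \<F>'" "\<Union>\<F>' = \<Union>\<F>"
    using Lindelof[of \<F>] by (auto simp: \<F>_def)
  have "negligible (\<Union>((\<lambda>W. f ` (W \<inter> Z)) ` \<F>'))"
    using \<F>' by (intro negligible_countable_Union) (auto simp: \<F>_def)
  moreover have "f ` Z \<subseteq> \<Union>((\<lambda>W. f ` (W \<inter> Z)) ` \<F>')"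
  proof
    fix y assume "y \<in> f ` Z"
    then obtain x where "x \<in> Z" "y = f x" by blast
    then have "x \<in> \<Union>\<F>" using assms by (auto simp: \<F>_def)
    then show "y \<in> \<Union>((\<lambda>W. f ` (W \<inter> Z)) ` \<F>')"
      using \<F>'(3) \<open>x \<in> Z\<close> \<open>y = f x\<close> by (metis IntI UN_iff Union_iff imageI)
  qed
  ultimately show ?thesis by (rule negligible_subset)
qed

text \<open>\<open>grazing\<close> grows as \<open>\<rho>\<close> shrinks, so the radii
  \<open>1 / (n + 1)\<close> already exhaust the uncountable union.\<close>

lemma negligible_grazing:
  fixes X Y :: "'b::euclidean_space \<Rightarrow> 'a::euclidean_space"
  assumes "DIM('a) = DIM('b) + 1" "open U" "open V"
    "smooth_on U X" "\<And>u. u \<in> U \<Longrightarrow> inj (frechet_derivative X (at u))" "continuous_on V Y"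
  shows "negligible (\<Union>\<rho>\<in>{0<..}. fst ` grazing U X V Y \<rho>)"
proof -
  let ?G = "\<lambda>n::nat. fst ` grazing U X V Y (inverse (real (Suc n)))"
  have "negligible (\<Union>(range ?G))"
    by (rule negligible_countable_Union)
      (use grazing_locally_negligible[OF assms] in \<open>auto intro!: negligible_image_if_locally\<close>)
  moreover have "(\<Union>\<rho>\<in>{0<..}. fst ` grazing U X V Y \<rho>) \<subseteq> \<Union>(range ?G)"
  proof
    fix e assume "e \<in> (\<Union>\<rho>\<in>{0<..}. fst ` grazing U X V Y \<rho>)"
    then obtain \<rho> u v s where \<rho>: "\<rho> > 0" "(e, u, v, s) \<in> grazing U X V Y \<rho>" by force
    obtain n where n: "inverse (real (Suc n)) < \<rho>"
      using reals_Archimedean[OF \<rho>(1)] by blast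
    then have "ball u (inverse (real (Suc n))) \<subseteq> ball u \<rho>" "ball v (inverse (real (Suc n))) \<subseteq> ball v \<rho>"
      "{s - inverse (real (Suc n))<..<s} \<subseteq> {s-\<rho><..<s}" by (auto intro: subset_ball)
    then have "(e, u, v, s) \<in> grazing U X V Y (inverse (real (Suc n)))"
      using \<rho>(2) unfolding grazing_def by blast
    then show "e \<in> \<Union>(range ?G)" by force
  qed
  ultimately show ?thesis by (rule negligible_subset)
qed

subsection \<open>Touching sheets\<close>

lemma orthonormal_family_expand:
  fixes \<tau> :: "'i \<Rightarrow> 'a::euclidean_space"
  assumes "finite I" "\<And>i j. i \<in> I \<Longrightarrow> j \<in> I \<Longrightarrow> \<tau> i \<bullet> \<tau> j = (if i = j then 1 else 0)"
    and "x \<in> span (\<tau> ` I)"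
  shows "(\<Sum>i\<in>I. (x \<bullet> \<tau> i) *\<^sub>R \<tau> i) = x"
  using assms(3)
proof (rule span_induct)
  show "subspace {x. (\<Sum>i\<in>I. (x \<bullet> \<tau> i) *\<^sub>R \<tau> i) = x}"
    by (auto simp: subspace_def inner_add_left scaleR_add_left sum.distrib simp flip: scaleR_sum_right scaleR_scaleR)
  fix y assume "y \<in> \<tau> ` I"
  then obtain j where j: "j \<in> I" "y = \<tau> j" by blast
  have "(\<Sum>i\<in>I. (\<tau> j \<bullet> \<tau> i) *\<^sub>R \<tau> i) = (\<Sum>i\<in>I. if i = j then \<tau> j else 0)"
    by (rule sum.cong) (use assms(2) j in auto)
  then show "(\<Sum>i\<in>I. (y \<bullet> \<tau> i) *\<^sub>R \<tau> i) = y"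
    using j assms(1) by simp
qed

text \<open>Expand one family in the other and exchange the sums. \<open>P\<close> need not preserve
  the common span. This is needed because the frames in the mean curvatures of two touching sheets
  are chosen independently.\<close>

lemma trace_orthonormal_families:
  fixes \<tau> \<tau>' :: "'i \<Rightarrow> 'a::euclidean_space"
  assumes "finite I" "linear P"
    and \<tau>: "\<And>i j. i \<in> I \<Longrightarrow> j \<in> I \<Longrightarrow> \<tau> i \<bullet> \<tau> j = (if i = j then 1 else 0)"
    and \<tau>': "\<And>i j. i \<in> I \<Longrightarrow> j \<in> I \<Longrightarrow> \<tau>' i \<bullet> \<tau>' j = (if i = j then 1 else 0)"
    and "\<And>i. i \<in> I \<Longrightarrow> \<tau> i \<in> span (\<tau>' ` I)" "\<And>i. i \<in> I \<Longrightarrow> \<tau>' i \<in> span (\<tau> ` I)"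
  shows "(\<Sum>i\<in>I. P (\<tau> i) \<bullet> \<tau> i) = (\<Sum>i\<in>I. P (\<tau>' i) \<bullet> \<tau>' i)"
proof -
  have "(\<Sum>i\<in>I. P (\<tau> i) \<bullet> \<tau> i) = (\<Sum>i\<in>I. P (\<tau> i) \<bullet> (\<Sum>j\<in>I. (\<tau> i \<bullet> \<tau>' j) *\<^sub>R \<tau>' j))"
    using orthonormal_family_expand[OF assms(1) \<tau>' assms(5)] by simp
  also have "\<dots> = (\<Sum>j\<in>I. \<Sum>i\<in>I. (\<tau> i \<bullet> \<tau>' j) * (P (\<tau> i) \<bullet> \<tau>' j))"
    by (subst sum.swap) (simp add: inner_sum_right)
  also have "\<dots> = (\<Sum>j\<in>I. P (\<Sum>i\<in>I. (\<tau>' j \<bullet> \<tau> i) *\<^sub>R \<tau> i) \<bullet> \<tau>' j)"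
    by (simp add: linear_sum[OF assms(2)] linear_cmul[OF assms(2)] inner_sum_left inner_commute[of "\<tau>' _" "\<tau> _"])
  also have "\<dots> = (\<Sum>j\<in>I. P (\<tau>' j) \<bullet> \<tau>' j)"
    using orthonormal_family_expand[OF assms(1) \<tau> assms(6)] by simp
  finally show ?thesis .
qed

lemma exists_tangent_frame:
  fixes X :: "'b::euclidean_space \<Rightarrow> 'a::euclidean_space"
  assumes "linear (frechet_derivative X (at u))" "inj (frechet_derivative X (at u))"
  shows "\<exists>w. tangent_frame X u w"
proof -
  let ?P = "frechet_derivative X (at u)"
  have "subspace (range ?P)"
    using assms(1) linear_subspace_image subspace_UNIV by blast
  then obtain B where B: "B \<subseteq> range ?P" "pairwise orthogonal B" "\<And>x. x \<in> B \<Longrightarrow> norm x = 1"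
    "independent B" "card B = dim (range ?P)"
    using orthonormal_basis_subspace by metis
  have "finite B" "card B = DIM('b)"
    using B(4,5) dim_image_eq[OF assms(1), of UNIV] assms(2) independent_imp_finite by auto
  then obtain f where f: "bij_betw f (Basis :: 'b set) B"
    using finite_same_card_bij[OF finite_Basis] by metis
  define w where "w i = inv ?P (f i)" for i
  have w: "?P (w i) = f i" if "i \<in> Basis" for i
    unfolding w_def using B(1) f that by (intro f_inv_into_f) (auto dest: bij_betwE)
  have "f i \<bullet> f j = (if i = j then 1 else 0)" if "i \<in> Basis" "j \<in> Basis" for i j
  proof -
    have "f i \<in> B" "f j \<in> B" "f i = f j \<longleftrightarrow> i = j"
      using f that by (auto simp: bij_betw_def inj_on_eq_iff)
    then show ?thesis
      using pairwiseD[OF B(2), of "f i" "f j"] B(3)[of "f i"] by (auto simp: orthogonal_def norm_eq_1)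
  qed
  then show ?thesis
    unfolding tangent_frame_def using w by (intro exI[of _ w]) auto
qed

lemma tangent_frame_spans:
  fixes X :: "'b::euclidean_space \<Rightarrow> 'a::euclidean_space"
  assumes P: "linear (frechet_derivative X (at u))" and w: "tangent_frame X u w"
  shows "range (frechet_derivative X (at u)) \<subseteq> span ((\<lambda>i. frechet_derivative X (at u) (w i)) ` Basis)"
proof -
  let ?\<tau> = "\<lambda>i. frechet_derivative X (at u) (w i)"
  have \<tau>: "?\<tau> i \<bullet> ?\<tau> j = (if i = j then 1 else 0)" if "i \<in> Basis" "j \<in> Basis" for i j
    using w that by (auto simp: tangent_frame_def)
  have "inj_on ?\<tau> Basis"
  proof (rule inj_onI)
    fix i j :: 'b assume ij: "i \<in> Basis" "j \<in> Basis" and "?\<tau> i = ?\<tau> j"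
    then have "?\<tau> i \<bullet> ?\<tau> j = 1" using \<tau>[OF ij(1) ij(1)] by simp
    then show "i = j" using \<tau>[OF ij] by (auto split: if_splits)
  qed
  then have card: "card (?\<tau> ` Basis) = DIM('b)"
    by (simp add: card_image)
  have "independent (?\<tau> ` Basis)"
  proof (rule pairwise_orthogonal_independent)
    show "pairwise orthogonal (?\<tau> ` Basis)"
      using \<tau> by (auto simp: pairwise_def orthogonal_def)
    show "0 \<notin> ?\<tau> ` Basis"
      using \<tau> by force
  qed
  moreover have "dim (range (frechet_derivative X (at u))) \<le> DIM('b)"
    using dim_image_le[OF P, of UNIV] by simp
  ultimately show ?thesis
    using card by (intro card_ge_dim_independent) auto
qed

lemma mean_curvature_frame:
  fixes X :: "'b::euclidean_space \<Rightarrow> 'a::euclidean_space"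
  assumes "linear (frechet_derivative X (at u))" "inj (frechet_derivative X (at u))"
  obtains w where "tangent_frame X u w"
    "mean_curvature X \<nu> u = (\<Sum>i\<in>Basis. frechet_derivative \<nu> (at u) (w i) \<bullet> frechet_derivative X (at u) (w i))"
  using that[of "SOME w. tangent_frame X u w"] someI_ex[OF exists_tangent_frame[OF assms]]
  by (simp add: mean_curvature_def Let_def)

text \<open>\<open>f'\<close> is assumed differentiable only at 0, because the gradient
  \<open>m\<close> is known to be differentiable only at the touching point. With
  \<open>c < 0\<close>, \<open>f'\<close> would be negative just to the right of 0 and
  \<open>f\<close> would fall below its minimum.\<close>

lemma second_derivative_nonneg_at_min:
  fixes f :: "real \<Rightarrow> real"
  assumes "d > 0" "\<And>t. \<bar>t\<bar> < d \<Longrightarrow> (f has_real_derivative f' t) (at t)" "(f' has_real_derivative c) (at 0)"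
    and min: "\<And>t. \<bar>t\<bar> < d \<Longrightarrow> f 0 \<le> f t"
  shows "c \<ge> 0"
proof (rule ccontr)
  assume "\<not> c \<ge> 0"
  then have "c < 0" by simp
  have "f' 0 = 0"
    using DERIV_local_min[OF assms(2)[of 0] assms(1)] min assms(1) by simp
  with DERIV_neg_dec_right[OF assms(3) \<open>c < 0\<close>] obtain e where "e > 0"
    and e: "\<And>h. h > 0 \<Longrightarrow> h < e \<Longrightarrow> f' h < 0"
    by auto
  define t where "t = min d e / 2"
  have t: "0 < t" "t < d" "t < e" using \<open>d > 0\<close> \<open>e > 0\<close> by (auto simp: t_def)
  obtain z where "0 < z" "z < t" "f t - f 0 = (t - 0) * f' z"
    using MVT2[OF t(1), of f f'] assms(2) t by auto
  then have "f t < f 0"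
    using e[of z] t by (simp add: mult_less_0_iff less_iff_diff_less_0[of "f t"])
  then show False using min[of t] t by simp
qed

lemma smooth_unit_normal_minus:
  assumes "open U" "smooth_unit_normal U X \<nu>"
  shows "smooth_unit_normal U X (\<lambda>u. - \<nu> u)"
  using assms smooth_on_diff[OF \<open>open U\<close> smooth_on_const, of \<nu> 0] by (auto simp: smooth_unit_normal_def)

lemma smooth_unit_normal_subset:
  "smooth_unit_normal U X \<nu> \<Longrightarrow> U' \<subseteq> U \<Longrightarrow> smooth_unit_normal U' X \<nu>"
  by (auto simp: smooth_unit_normal_def intro: smooth_on_subset)

text \<open>The part of \<open>N\<close> orthogonal to \<open>\<mu> v\<close> is tangent by
  dimension, hence orthogonal to \<open>N\<close> and so to itself.\<close>

lemma smooth_unit_normal_eq_or_minus: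
  fixes Y :: "'b::euclidean_space \<Rightarrow> 'a::euclidean_space"
  assumes "DIM('a) = DIM('b) + 1" "linear (frechet_derivative Y (at v))" "inj (frechet_derivative Y (at v))"
    "smooth_unit_normal V Y \<mu>" "v \<in> V" "norm N = 1" "\<And>w. frechet_derivative Y (at v) w \<bullet> N = 0"
  shows "\<mu> v = N \<or> \<mu> v = - N"
proof -
  let ?M = "\<mu> v"
  have M: "norm ?M = 1" "\<And>w. frechet_derivative Y (at v) w \<bullet> ?M = 0"
    using assms(4,5) by (auto simp: smooth_unit_normal_def)
  then have MM: "?M \<bullet> ?M = 1" and NN: "N \<bullet> N = 1" and "?M \<noteq> 0"
    using assms(6) by (auto simp: norm_eq_1)
  let ?w = "N - (N \<bullet> ?M) *\<^sub>R ?M"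
  have "?w \<bullet> ?M = 0"
    by (simp add: inner_diff_left MM)
  then have "?w \<in> range (frechet_derivative Y (at v))"
    using normal_complement_range[OF assms(1-3) \<open>?M \<noteq> 0\<close> M(2)] by blast
  then have "?w \<bullet> N = 0" using assms(7) by auto
  then have "?w \<bullet> ?w = 0" using \<open>?w \<bullet> ?M = 0\<close> by (simp add: inner_diff_right)
  then have N: "N = (N \<bullet> ?M) *\<^sub>R ?M" by simp
  have "(N \<bullet> ?M)\<^sup>2 = 1"
    using \<open>?w \<bullet> N = 0\<close> NN by (simp add: inner_diff_left inner_commute[of ?M N] power2_eq_square)
  then have "N \<bullet> ?M = 1 \<or> N \<bullet> ?M = - 1"
    by (simp add: power2_eq_1_iff)
  then show ?thesis using N by auto
qed

text \<open>The two sheets touch after translating by \<open>\<lambda> e\<close>, so the second derivative of \<open>h\<close> along \<open>Y\<close>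
  orders their mean curvatures, while the equation orders them the other way.\<close>

lemma one_sided_touching_impossible:
  fixes X Y :: "'b::euclidean_space \<Rightarrow> 'a::euclidean_space"
  assumes dim: "DIM('a) = DIM('b) + 1" and "open U" "u0 \<in> U" "open V" "v0 \<in> V"
    and X: "smooth_on U X" "inj (frechet_derivative X (at u0))"
    and Y: "smooth_on V Y" "inj (frechet_derivative Y (at v0))"
    and \<nu>: "smooth_unit_normal U X \<nu>"
    and eq: "X u0 = Y v0 + l *\<^sub>R e" and "l > 0" and e: "e \<notin> range (frechet_derivative X (at u0))"
    and HX: "mean_curvature X \<nu> u0 = X u0 \<bullet> \<nu> u0 / 2"
    and HY: "\<And>V' \<mu>. open V' \<Longrightarrow> V' \<subseteq> V \<Longrightarrow> smooth_unit_normal V' Y \<mu> \<Longrightarrow> v0 \<in> V' \<Longrightarrow>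
      mean_curvature Y \<mu> v0 = Y v0 \<bullet> \<mu> v0 / 2"
    and derh: "\<And>p. p \<in> ball (X u0) r \<Longrightarrow> (h has_derivative (\<lambda>w. w \<bullet> m p)) (at p)"
    and m: "m differentiable (at (X u0))"
    and "open O1" "u0 \<in> O1"
    and mX: "\<And>u. u \<in> O1 \<Longrightarrow> m (X u) = inverse (\<nu> u \<bullet> \<nu> u0) *\<^sub>R \<nu> u"
    and "h (X u0) = 0" "\<eta> > 0"
    and near: "\<And>v s. v \<in> ball v0 \<eta> \<Longrightarrow> s \<in> {l-\<eta>..l} \<Longrightarrow> v \<in> V \<and> Y v + s *\<^sub>R e \<in> ball (X u0) r"
    and pos: "\<And>v s. v \<in> ball v0 \<eta> \<Longrightarrow> s \<in> {l-\<eta>..l} \<Longrightarrow> 0 \<le> h (Y v + s *\<^sub>R e)"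
  shows False
proof -
  let ?DX = "frechet_derivative X (at u0)" and ?DY = "frechet_derivative Y (at v0)"
  define N where "N = \<nu> u0"
  have \<nu>_smooth: "smooth_on U \<nu>" and normal: "\<And>u w. u \<in> U \<Longrightarrow> frechet_derivative X (at u) w \<bullet> \<nu> u = 0"
    and unit: "\<And>u. u \<in> U \<Longrightarrow> norm (\<nu> u) = 1"
    using \<nu> by (auto simp: smooth_unit_normal_def)
  have N1: "norm N = 1" "N \<bullet> N = 1" "N \<noteq> 0"
    using unit[OF \<open>u0 \<in> U\<close>] by (auto simp: N_def norm_eq_1)
  have derX: "(X has_derivative ?DX) (at u0)"
    using smooth_on_has_derivative[OF X(1) \<open>open U\<close> \<open>u0 \<in> U\<close>] .
  have derY: "(Y has_derivative frechet_derivative Y (at v)) (at v)" if "v \<in> V" for v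
    using smooth_on_has_derivative[OF Y(1) \<open>open V\<close> that] .
  have linX: "linear ?DX" and linY: "linear ?DY"
    using derX derY[OF \<open>v0 \<in> V\<close>] has_derivative_linear by blast+
  have mN: "m (X u0) = N"
    using mX[OF \<open>u0 \<in> O1\<close>] N1 by (simp add: N_def)
  have near0: "v \<in> V" "Y v + l *\<^sub>R e \<in> ball (X u0) r" "0 \<le> h (Y v + l *\<^sub>R e)" if "v \<in> ball v0 \<eta>" for v
    using near[OF that, of l] pos[OF that, of l] \<open>\<eta> > 0\<close> by auto
  define \<psi>' where "\<psi>' a t = frechet_derivative Y (at (v0 + t *\<^sub>R a)) a \<bullet> m (Y (v0 + t *\<^sub>R a) + l *\<^sub>R e)" for a t
  have small: "\<exists>d>0. \<forall>t. \<bar>t\<bar> < d \<longrightarrow> v0 + t *\<^sub>R a \<in> ball v0 \<eta>" for a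
  proof (intro exI[of _ "\<eta> / (norm a + 1)"] conjI allI impI)
    have na: "norm a + 1 > 0" by (smt (verit) norm_ge_zero)
    then show "\<eta> / (norm a + 1) > 0" using \<open>\<eta> > 0\<close> by simp
    fix t assume "\<bar>t\<bar> < \<eta> / (norm a + 1)"
    then have "\<bar>t\<bar> * (norm a + 1) < \<eta>" using na by (simp add: field_simps)
    then have "\<bar>t\<bar> * norm a < \<eta>" by (simp add: distrib_left)
    then show "v0 + t *\<^sub>R a \<in> ball v0 \<eta>" by (simp add: dist_norm)
  qed
  have line: "((\<lambda>t. v0 + t *\<^sub>R a) has_derivative (\<lambda>t. t *\<^sub>R a)) (at t)" for a t
    by (auto intro!: derivative_eq_intros)
  have der\<psi>: "((\<lambda>t. h (Y (v0 + t *\<^sub>R a) + l *\<^sub>R e)) has_real_derivative \<psi>' a t) (at t)"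
    if "v0 + t *\<^sub>R a \<in> ball v0 \<eta>" for a t
  proof -
    let ?v = "v0 + t *\<^sub>R a"
    have "((\<lambda>t. Y (v0 + t *\<^sub>R a) + l *\<^sub>R e) has_derivative (\<lambda>s. frechet_derivative Y (at ?v) (s *\<^sub>R a))) (at t)"
      using has_derivative_add_const[OF has_derivative_compose[OF line derY[OF near0(1)[OF that]]]] .
    from has_derivative_compose[OF this derh[OF near0(2)[OF that]]]
    have "((\<lambda>t. h (Y (v0 + t *\<^sub>R a) + l *\<^sub>R e)) has_derivative
      (\<lambda>s. frechet_derivative Y (at ?v) (s *\<^sub>R a) \<bullet> m (Y ?v + l *\<^sub>R e))) (at t)" .
    moreover have "frechet_derivative Y (at ?v) (s *\<^sub>R a) = s *\<^sub>R frechet_derivative Y (at ?v) a" for s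
      using has_derivative_linear[OF derY[OF near0(1)[OF that]]] by (rule linear_cmul)
    ultimately show ?thesis
      by (simp add: has_field_derivative_def \<psi>'_def mult_commute_abs)
  qed
  \<comment> \<open>First-order condition: on the translated sheet \<open>h\<close> has a minimum at
    \<open>v0\<close>, so the two sheets share the tangent hyperplane.\<close>
  have DYN: "?DY a \<bullet> N = 0" for a
  proof -
    obtain d where d: "d > 0" "\<And>t. \<bar>t\<bar> < d \<Longrightarrow> v0 + t *\<^sub>R a \<in> ball v0 \<eta>" using small by blast
    have "\<psi>' a 0 = 0"
      using d(2) near0(3) \<open>h (X u0) = 0\<close> eq
      by (intro DERIV_local_min[OF der\<psi> d(1)]) (auto simp: \<open>\<eta> > 0\<close>)
    then show ?thesis using mN eq by (simp add: \<psi>'_def)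
  qed
  have "e \<bullet> N \<noteq> 0"
    using e normal_complement_range[OF dim linX X(2) \<open>N \<noteq> 0\<close>] normal[OF \<open>u0 \<in> U\<close>] by (auto simp: N_def)
  \<comment> \<open>Along the segment \<open>h\<close> is nonnegative just below length
    \<open>l\<close> and zero at \<open>l\<close>, so its slope there cannot be positive.\<close>
  moreover have "e \<bullet> N \<le> 0"
  proof (rule ccontr)
    assume "\<not> e \<bullet> N \<le> 0"
    have "Y v0 + l *\<^sub>R e \<in> ball (X u0) r" using near0(2)[of v0] \<open>\<eta> > 0\<close> by simp
    moreover have "((\<lambda>s. Y v0 + s *\<^sub>R e) has_derivative (\<lambda>s. s *\<^sub>R e)) (at l)"
      by (auto intro!: derivative_eq_intros)
    ultimately have "((\<lambda>s. h (Y v0 + s *\<^sub>R e)) has_derivative (\<lambda>s. (s *\<^sub>R e) \<bullet> m (Y v0 + l *\<^sub>R e))) (at l)"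
      using has_derivative_compose derh by blast
    then have "((\<lambda>s. h (Y v0 + s *\<^sub>R e)) has_real_derivative e \<bullet> N) (at l)"
      using mN eq by (simp add: has_field_derivative_def mult_commute_abs)
    from DERIV_pos_inc_left[OF this] \<open>\<not> e \<bullet> N \<le> 0\<close> obtain d where d: "d > 0"
      "\<And>k. k > 0 \<Longrightarrow> k < d \<Longrightarrow> h (Y v0 + (l - k) *\<^sub>R e) < h (Y v0 + l *\<^sub>R e)" by auto
    define k where "k = min d \<eta> / 2"
    have "k > 0" "k < d" "k < \<eta>" using d(1) \<open>\<eta> > 0\<close> by (auto simp: k_def)
    then show False
      using d(2)[of k] pos[of v0 "l - k"] \<open>h (X u0) = 0\<close> eq by simp
  qed
  ultimately have eN: "e \<bullet> N < 0" by simp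
  \<comment> \<open>The equation holds for every local unit normal, so the one of \<open>Y\<close>
    may be oriented to equal \<open>N\<close>.\<close>
  obtain V1 \<mu> where V1: "open V1" "v0 \<in> V1" "V1 \<subseteq> V" and \<mu>: "smooth_unit_normal V1 Y \<mu>" and \<mu>N: "\<mu> v0 = N"
  proof -
    obtain V1 \<mu> where V1: "open V1" "v0 \<in> V1" "V1 \<subseteq> V" and \<mu>: "smooth_unit_normal V1 Y \<mu>"
      using exists_smooth_unit_normal[OF dim \<open>open V\<close> \<open>v0 \<in> V\<close> Y] by blast
    have "\<mu> v0 = N \<or> - \<mu> v0 = N"
      using smooth_unit_normal_eq_or_minus[OF dim linY Y(2) \<mu> V1(2) N1(1) DYN] by auto
    then show ?thesis
      using that[OF V1 \<mu>] that[OF V1 smooth_unit_normal_minus[OF V1(1) \<mu>]] by blast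
  qed
  have \<mu>_smooth: "smooth_on V1 \<mu>" and \<mu>_normal: "\<And>v w. v \<in> V1 \<Longrightarrow> frechet_derivative Y (at v) w \<bullet> \<mu> v = 0"
    using \<mu> by (auto simp: smooth_unit_normal_def)
  obtain Dm where Dm: "(m has_derivative Dm) (at (X u0))"
    using m by (auto simp: differentiable_def)
  let ?D\<nu> = "frechet_derivative \<nu> (at u0)" and ?D\<mu> = "frechet_derivative \<mu> (at v0)"
  have der\<nu>: "(\<nu> has_derivative ?D\<nu>) (at u0)"
    using smooth_on_has_derivative[OF \<nu>_smooth \<open>open U\<close> \<open>u0 \<in> U\<close>] .
  have der\<mu>: "(\<mu> has_derivative ?D\<mu>) (at v0)"
    using smooth_on_has_derivative[OF \<mu>_smooth V1(1,2)] .
  have D\<nu>N: "?D\<nu> b \<bullet> N = 0" for b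
  proof -
    have "((\<lambda>u. \<nu> u \<bullet> \<nu> u) has_derivative (\<lambda>b. \<nu> u0 \<bullet> ?D\<nu> b + ?D\<nu> b \<bullet> \<nu> u0)) (at u0)"
      by (rule has_derivative_inner[OF der\<nu> der\<nu>])
    moreover have "((\<lambda>u. \<nu> u \<bullet> \<nu> u) has_derivative (\<lambda>b. 0)) (at u0)"
      by (rule has_derivative_transform_within_open[OF has_derivative_const[of 1] \<open>open U\<close> \<open>u0 \<in> U\<close>])
        (use unit in \<open>simp add: norm_eq_1\<close>)
    ultimately have "(\<lambda>b. \<nu> u0 \<bullet> ?D\<nu> b + ?D\<nu> b \<bullet> \<nu> u0) = (\<lambda>b. 0)"
      by (rule has_derivative_unique)
    then have "\<nu> u0 \<bullet> ?D\<nu> b + ?D\<nu> b \<bullet> \<nu> u0 = 0" by (rule fun_cong)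
    then show ?thesis by (simp add: inner_commute N_def)
  qed
  \<comment> \<open>On the sheet, \<open>m\<close> is \<open>\<nu>\<close> times a factor with value
    1 and, by \<open>D\<nu>N\<close>, derivative 0 at \<open>u0\<close>. So on tangent vectors
    \<open>Dm\<close> is the derivative of the unit normal.\<close>
  have DmX: "Dm (?DX b) = ?D\<nu> b" for b
  proof -
    have "((\<lambda>u. m (X u)) has_derivative (\<lambda>b. Dm (?DX b))) (at u0)"
      by (rule has_derivative_compose[OF derX Dm])
    moreover have "((\<lambda>u. m (X u)) has_derivative ?D\<nu>) (at u0)"
    proof (rule has_derivative_transform_within_open[OF _ \<open>open O1\<close> \<open>u0 \<in> O1\<close> mX[symmetric]])
      have "((\<lambda>u. \<nu> u \<bullet> N) has_derivative (\<lambda>b. 0)) (at u0)"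
        using has_derivative_inner_left[OF der\<nu>, of N] D\<nu>N by simp
      then have "((\<lambda>u. inverse (\<nu> u \<bullet> N)) has_derivative (\<lambda>b. 0)) (at u0)"
        using Deriv.has_derivative_inverse[of "\<lambda>u. \<nu> u \<bullet> N" u0 "\<lambda>b. 0" UNIV] N1 by (simp add: N_def)
      from has_derivative_scaleR[OF this der\<nu>]
      show "((\<lambda>u. inverse (\<nu> u \<bullet> \<nu> u0) *\<^sub>R \<nu> u) has_derivative ?D\<nu>) (at u0)"
        using N1 by (simp add: N_def)
    qed
    ultimately show ?thesis
      using has_derivative_unique by metis
  qed
  \<comment> \<open>The second derivative of \<open>h\<close> along the line is
    \<open>?DY a \<bullet> Dm (?DY a) + D2 a \<bullet> N\<close>. Differentiating the orthogonality
    of \<open>\<mu>\<close> to the sheet replaces the second term by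
    \<open>- (?DY a \<bullet> ?D\<mu> a)\<close>.\<close>
  have compare: "?DY a \<bullet> ?D\<mu> a \<le> ?DY a \<bullet> Dm (?DY a)" for a
  proof -
    obtain d where d: "d > 0" "\<And>t. \<bar>t\<bar> < d \<Longrightarrow> v0 + t *\<^sub>R a \<in> ball v0 \<eta>" using small by blast
    define D2 where "D2 = frechet_derivative (\<lambda>v. frechet_derivative Y (at v) a) (at v0)"
    have D2: "((\<lambda>v. frechet_derivative Y (at v) a) has_derivative D2) (at v0)"
      unfolding D2_def
      by (rule smooth_on_has_derivative[OF smooth_on_frechet_derivative[OF Y(1)] \<open>open V\<close> \<open>v0 \<in> V\<close>])
    have tang: "D2 a \<bullet> N + ?DY a \<bullet> ?D\<mu> a = 0"
    proof -
      have "((\<lambda>v. frechet_derivative Y (at v) a \<bullet> \<mu> v) has_derivative (\<lambda>b. ?DY a \<bullet> ?D\<mu> b + D2 b \<bullet> \<mu> v0)) (at v0)"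
        by (rule has_derivative_inner[OF D2 der\<mu>])
      moreover have "((\<lambda>v. frechet_derivative Y (at v) a \<bullet> \<mu> v) has_derivative (\<lambda>b. 0)) (at v0)"
        by (rule has_derivative_transform_within_open[OF has_derivative_const[of 0] V1(1,2)])
          (use \<mu>_normal in simp)
      ultimately have "(\<lambda>b. ?DY a \<bullet> ?D\<mu> b + D2 b \<bullet> \<mu> v0) = (\<lambda>b. 0)"
        by (rule has_derivative_unique)
      then have "?DY a \<bullet> ?D\<mu> a + D2 a \<bullet> \<mu> v0 = 0" by (rule fun_cong)
      then show ?thesis by (simp add: \<mu>N)
    qed
    have "((\<lambda>v. m (Y v + l *\<^sub>R e)) has_derivative (\<lambda>b. Dm (?DY b))) (at v0)"
      using has_derivative_compose[OF has_derivative_add_const[OF derY[OF \<open>v0 \<in> V\<close>]], of m Dm "l *\<^sub>R e"] Dm eq by simp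
    from has_derivative_inner[OF D2 this]
    have "((\<lambda>v. frechet_derivative Y (at v) a \<bullet> m (Y v + l *\<^sub>R e)) has_derivative
      (\<lambda>b. ?DY a \<bullet> Dm (?DY b) + D2 b \<bullet> N)) (at v0)"
      using mN eq by simp
    then have "((\<lambda>v. frechet_derivative Y (at v) a \<bullet> m (Y v + l *\<^sub>R e)) has_derivative
      (\<lambda>b. ?DY a \<bullet> Dm (?DY b) + D2 b \<bullet> N)) (at (v0 + 0 *\<^sub>R a))" by simp
    from has_derivative_compose[OF line this]
    have "(\<psi>' a has_derivative (\<lambda>s. ?DY a \<bullet> Dm (?DY (s *\<^sub>R a)) + D2 (s *\<^sub>R a) \<bullet> N)) (at 0)"
      unfolding \<psi>'_def .
    moreover have "?DY a \<bullet> Dm (?DY (s *\<^sub>R a)) + D2 (s *\<^sub>R a) \<bullet> N = (?DY a \<bullet> Dm (?DY a) + D2 a \<bullet> N) * s" for s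
      by (simp add: linear_cmul[OF linY] linear_cmul[OF has_derivative_linear[OF Dm]]
          linear_cmul[OF has_derivative_linear[OF D2]] algebra_simps)
    ultimately have "(\<psi>' a has_real_derivative ?DY a \<bullet> Dm (?DY a) + D2 a \<bullet> N) (at 0)"
      by (simp add: has_field_derivative_def)
    moreover have "h (Y (v0 + 0 *\<^sub>R a) + l *\<^sub>R e) \<le> h (Y (v0 + t *\<^sub>R a) + l *\<^sub>R e)" if "\<bar>t\<bar> < d" for t
      using near0(3)[OF d(2)[OF that]] \<open>h (X u0) = 0\<close> eq by simp
    ultimately have "0 \<le> ?DY a \<bullet> Dm (?DY a) + D2 a \<bullet> N"
      using second_derivative_nonneg_at_min[of d "\<lambda>t. h (Y (v0 + t *\<^sub>R a) + l *\<^sub>R e)" "\<psi>' a"] d der\<psi> by blast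
    then show ?thesis using tang by simp
  qed
  obtain w where w: "tangent_frame X u0 w" "mean_curvature X \<nu> u0 = (\<Sum>i\<in>Basis. ?D\<nu> (w i) \<bullet> ?DX (w i))"
    using mean_curvature_frame[OF linX X(2)] by metis
  obtain w' where w': "tangent_frame Y v0 w'" "mean_curvature Y \<mu> v0 = (\<Sum>i\<in>Basis. ?D\<mu> (w' i) \<bullet> ?DY (w' i))"
    using mean_curvature_frame[OF linY Y(2)] by metis
  have XN: "x \<in> range ?DX \<longleftrightarrow> x \<bullet> N = 0" for x
    using normal_complement_range[OF dim linX X(2) \<open>N \<noteq> 0\<close>] normal[OF \<open>u0 \<in> U\<close>] by (auto simp: N_def)
  have YN: "x \<in> range ?DY \<longleftrightarrow> x \<bullet> N = 0" for x
    using normal_complement_range[OF dim linY Y(2) \<open>N \<noteq> 0\<close> DYN] DYN by auto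
  have "mean_curvature X \<nu> u0 = (\<Sum>i\<in>Basis. Dm (?DX (w i)) \<bullet> ?DX (w i))"
    using w(2) DmX by simp
  \<comment> \<open>Both frames span the hyperplane orthogonal to \<open>N\<close>, so the traces of
    \<open>Dm\<close> over them agree.\<close>
  also have "\<dots> = (\<Sum>i\<in>Basis. Dm (?DY (w' i)) \<bullet> ?DY (w' i))"
  proof (rule trace_orthonormal_families)
    show "linear Dm" using Dm by (rule has_derivative_linear)
    show "?DX (w i) \<in> span ((\<lambda>i. ?DY (w' i)) ` Basis)" for i
      using tangent_frame_spans[OF linY w'(1)] XN YN by blast
    show "?DY (w' i) \<in> span ((\<lambda>i. ?DX (w i)) ` Basis)" for i
      using tangent_frame_spans[OF linX w(1)] XN YN by blast
  qed (use w(1) w'(1) in \<open>auto simp: tangent_frame_def\<close>)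
  also have "\<dots> \<ge> (\<Sum>i\<in>Basis. ?D\<mu> (w' i) \<bullet> ?DY (w' i))"
    using compare by (intro sum_mono) (simp add: inner_commute)
  finally have "mean_curvature Y \<mu> v0 \<le> mean_curvature X \<nu> u0" using w'(2) by simp
  then have "Y v0 \<bullet> N \<le> X u0 \<bullet> N"
    using HX HY[OF V1(1,3) \<mu> V1(2)] \<mu>N by (simp add: N_def)
  then have "0 \<le> l * (e \<bullet> N)" using eq by (simp add: inner_add_left)
  then show False using eN \<open>l > 0\<close> by (simp add: zero_le_mult_iff)
qed

subsection \<open>Shortest segments\<close>

text \<open>Zeros of \<open>h\<close> come from points of \<open>X\<close> within
  \<open>\<rho>\<close> of \<open>u0\<close>, which \<open>sep\<close> excludes for shorter
  segments; hence \<open>h\<close> has one sign on them. Which sign is unknown, and reversing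
  \<open>\<nu>\<close>, \<open>h\<close> and \<open>m\<close> reduces the negative case to the
  positive one.\<close>

lemma minimal_segment_impossible:
  fixes X Y :: "'b::euclidean_space \<Rightarrow> 'a::euclidean_space"
  assumes dim: "DIM('a) = DIM('b) + 1" and "open U" "u0 \<in> U" "open V" "v0 \<in> V"
    and X: "smooth_on U X" "inj (frechet_derivative X (at u0))"
    and Y: "smooth_on V Y" "inj (frechet_derivative Y (at v0))"
    and HX: "\<And>U' \<nu>. open U' \<Longrightarrow> U' \<subseteq> U \<Longrightarrow> smooth_unit_normal U' X \<nu> \<Longrightarrow> u0 \<in> U' \<Longrightarrow>
      mean_curvature X \<nu> u0 = X u0 \<bullet> \<nu> u0 / 2"
    and HY: "\<And>V' \<mu>. open V' \<Longrightarrow> V' \<subseteq> V \<Longrightarrow> smooth_unit_normal V' Y \<mu> \<Longrightarrow> v0 \<in> V' \<Longrightarrow>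
      mean_curvature Y \<mu> v0 = Y v0 \<bullet> \<mu> v0 / 2"
    and eq: "X u0 = Y v0 + l *\<^sub>R e" and "l > 0" and e: "e \<notin> range (frechet_derivative X (at u0))"
    and "\<rho> > 0"
    and sep: "\<And>u v s. u \<in> U \<inter> ball u0 \<rho> \<Longrightarrow> v \<in> V \<inter> ball v0 \<rho> \<Longrightarrow> l - \<rho> < s \<Longrightarrow> s < l \<Longrightarrow> X u \<noteq> Y v + s *\<^sub>R e"
  shows False
proof -
  obtain U0 \<nu> where U0: "open U0" "u0 \<in> U0" "U0 \<subseteq> U" and \<nu>0: "smooth_unit_normal U0 X \<nu>"
    using exists_smooth_unit_normal[OF dim \<open>open U\<close> \<open>u0 \<in> U\<close> X] by blast
  define U1 where "U1 = U0 \<inter> ball u0 \<rho>"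
  have U1: "open U1" "u0 \<in> U1" "U1 \<subseteq> U" "U1 \<subseteq> U0"
    using U0 \<open>\<rho> > 0\<close> by (auto simp: U1_def)
  have \<nu>: "smooth_unit_normal U1 X \<nu>"
    using smooth_unit_normal_subset[OF \<nu>0 U1(4)] .
  have X1: "smooth_on U1 X" using smooth_on_subset[OF X(1) U1(3)] .
  obtain r h m O1 where "r > 0" and O1: "open O1" "u0 \<in> O1" "O1 \<subseteq> U1"
    and derh: "\<And>p. p \<in> ball (X u0) r \<Longrightarrow> (h has_derivative (\<lambda>w. w \<bullet> m p)) (at p)"
    and "continuous_on (ball (X u0) r) m"
    and "\<And>p. p \<in> ball (X u0) r \<Longrightarrow> m p \<bullet> \<nu> u0 = 1"
    and h0: "\<And>p. p \<in> ball (X u0) r \<Longrightarrow> h p = 0 \<Longrightarrow> \<exists>u\<in>U1. p = X u"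
    and "\<And>u. u \<in> O1 \<Longrightarrow> X u \<in> ball (X u0) r"
    and hX: "\<And>u. u \<in> O1 \<Longrightarrow> h (X u) = 0"
    and "\<And>u. u \<in> O1 \<Longrightarrow> \<nu> u \<bullet> \<nu> u0 > 0"
    and mX: "\<And>u. u \<in> O1 \<Longrightarrow> m (X u) = inverse (\<nu> u \<bullet> \<nu> u0) *\<^sub>R \<nu> u"
    and mdiff: "m differentiable (at (X u0))"
    by (rule local_defining_function[OF dim U1(1,2) X1 X(2) \<nu>]) (rule that)
  have conth: "continuous_on (ball (X u0) r) h"
    using derh by (meson continuous_at_imp_continuous_on has_derivative_continuous)
  have contY: "continuous_on V Y" using smooth_on_imp_continuous_on[OF Y(1)] .
  obtain \<eta> where \<eta>: "\<eta> > 0" "\<eta> < \<rho>" "cball v0 \<eta> \<subseteq> V"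
    and near: "\<And>e' v s. e' \<in> cball e \<eta> \<Longrightarrow> v \<in> cball v0 \<eta> \<Longrightarrow> s \<in> {l-\<eta>..l+\<eta>} \<Longrightarrow> Y v + s *\<^sub>R e' \<in> cball (X u0) (r / 2)"
    by (rule segment_endpoints_near[OF \<open>open V\<close> contY \<open>v0 \<in> V\<close>, where r="r / 2" and k="\<rho>"
          and ?e0.0=e and ?s0.0=l, folded eq])
      (use \<open>r > 0\<close> \<open>\<rho> > 0\<close> that in auto)
  have near': "Y v + s *\<^sub>R e \<in> ball (X u0) r" if "v \<in> ball v0 \<eta>" "s \<in> {l-\<eta>..l}" for v s
  proof -
    have "Y v + s *\<^sub>R e \<in> cball (X u0) (r / 2)"
      using that \<eta>(1) by (intro near) auto
    then show ?thesis using \<open>r > 0\<close> by auto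
  qed
  have in_V: "v \<in> V" if "v \<in> ball v0 \<eta>" for v
    using subsetD[OF \<eta>(3)] that by auto
  have nz: "h (Y v + s *\<^sub>R e) \<noteq> 0" if vs: "v \<in> ball v0 \<eta>" "s \<in> {l-\<eta>..<l}" for v s
  proof
    assume "h (Y v + s *\<^sub>R e) = 0"
    then obtain u where u: "u \<in> U1" "Y v + s *\<^sub>R e = X u"
      using h0[OF near'[OF vs(1), of s]] vs(2) by auto
    have "u \<in> U \<inter> ball u0 \<rho>" using u(1) U1(3) by (auto simp: U1_def)
    moreover have "v \<in> V \<inter> ball v0 \<rho>" using in_V[OF vs(1)] vs(1) \<eta>(2) by auto
    ultimately show False
      using sep[of u v s] vs(2) \<eta>(2) u(2) by auto
  qed
  have "(\<forall>v\<in>ball v0 \<eta>. \<forall>s\<in>{l-\<eta>..l}. 0 \<le> h (Y v + s *\<^sub>R e)) \<or>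
      (\<forall>v\<in>ball v0 \<eta>. \<forall>s\<in>{l-\<eta>..l}. h (Y v + s *\<^sub>R e) \<le> 0)"
    using in_V \<eta>(1)
    by (intro one_sided_near_minimal_segment[OF conth continuous_on_subset[OF contY] connected_ball _ order_refl near' nz]) auto
  then show False
  proof
    assume pos: "\<forall>v\<in>ball v0 \<eta>. \<forall>s\<in>{l-\<eta>..l}. 0 \<le> h (Y v + s *\<^sub>R e)"
    show False
    proof (rule one_sided_touching_impossible[OF dim U1(1,2) \<open>open V\<close> \<open>v0 \<in> V\<close> X1 X(2) Y \<nu> eq \<open>l > 0\<close> e
          HX[OF U1(1,3) \<nu> U1(2)] HY derh mdiff O1(1,2) mX hX[OF O1(2)] \<eta>(1)])
      show "v \<in> V \<and> Y v + s *\<^sub>R e \<in> ball (X u0) r" "0 \<le> h (Y v + s *\<^sub>R e)"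
        if "v \<in> ball v0 \<eta>" "s \<in> {l-\<eta>..l}" for v s
        using near'[OF that] in_V[OF that(1)] pos that by blast+
    qed
  next
    assume neg: "\<forall>v\<in>ball v0 \<eta>. \<forall>s\<in>{l-\<eta>..l}. h (Y v + s *\<^sub>R e) \<le> 0"
    have \<nu>': "smooth_unit_normal U1 X (\<lambda>u. - \<nu> u)"
      using smooth_unit_normal_minus[OF U1(1) \<nu>] .
    have derh': "((\<lambda>p. - h p) has_derivative (\<lambda>w. w \<bullet> - m p)) (at p)" if "p \<in> ball (X u0) r" for p
      using has_derivative_minus[OF derh[OF that]] by simp
    have mdiff': "(\<lambda>p. - m p) differentiable (at (X u0))"
      using mdiff by (rule differentiable_minus)
    have mX': "- m (X u) = inverse (- \<nu> u \<bullet> - \<nu> u0) *\<^sub>R - \<nu> u" if "u \<in> O1" for u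
      using mX[OF that] by simp
    have hX': "- h (X u0) = 0" using hX[OF O1(2)] by simp
    show False
    proof (rule one_sided_touching_impossible[OF dim U1(1,2) \<open>open V\<close> \<open>v0 \<in> V\<close> X1 X(2) Y \<nu>' eq \<open>l > 0\<close> e
          HX[OF U1(1,3) \<nu>' U1(2)] HY derh' mdiff' O1(1,2) mX' hX' \<eta>(1)])
      show "v \<in> V \<and> Y v + s *\<^sub>R e \<in> ball (X u0) r" "0 \<le> - h (Y v + s *\<^sub>R e)"
        if "v \<in> ball v0 \<eta>" "s \<in> {l-\<eta>..l}" for v s
        using near'[OF that] in_V[OF that(1)] neg that by auto
    qed
  qed
qed

section \<open>Existence of a shortest segment\<close>

text \<open>Components are closed in \<open>S - K\<close>; since there are only two, each is the
  complement of the other and therefore also open. Openness of \<open>Q\<close> in \<open>S\<close>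
  keeps the closure of \<open>P\<close> away from it.\<close>

lemma two_components_of_complement:
  fixes S :: "'a::euclidean_space set"
  assumes "closed S" "compact K" "components (S - K) = {P, Q}" "P \<noteq> Q"
  shows "openin (top_of_set S) P" "connected P" "P \<noteq> {}" "P \<subseteq> S" "P \<inter> Q = {}" "P \<inter> K = {}"
    "S \<subseteq> P \<union> Q \<union> K" "closure P \<subseteq> P \<union> K" "closure P \<inter> Q = {}"
proof -
  have PQ: "P \<in> components (S - K)" "Q \<in> components (S - K)" using assms(3) by auto
  show c: "connected P" "P \<noteq> {}"
    using PQ(1) in_components_connected in_components_nonempty by auto
  show disj: "P \<inter> Q = {}"
    using components_nonoverlap[OF PQ] assms(4) by blast
  have un: "S - K = P \<union> Q"
    using Union_components[of "S - K"] assms(3) by auto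
  then show "P \<subseteq> S" "P \<inter> K = {}" "S \<subseteq> P \<union> Q \<union> K" by auto
  have SK: "openin (top_of_set S) (S - K)"
    using compact_imp_closed[OF assms(2)] by (auto simp: openin_open Diff_eq)
  have op: "openin (top_of_set S) (S - K - T)" if "T \<in> components (S - K)" for T
    using closedin_component[OF that] SK by (metis openin_diff openin_subtopology_self openin_trans)
  have P: "P = S - K - Q" and Q: "Q = S - K - P" using un disj by auto
  show "openin (top_of_set S) P" using op[OF PQ(2)] P by metis
  have "openin (top_of_set S) Q" using op[OF PQ(1)] Q by metis
  then obtain T where T: "open T" "Q = S \<inter> T" by (auto simp: openin_open)
  have "closure P \<subseteq> S" using \<open>P \<subseteq> S\<close> assms(1) by (rule closure_minimal)
  have "closure P \<inter> T = {}"
    using open_Int_closure_eq_empty[OF T(1), of P] disj T(2) \<open>P \<subseteq> S\<close> by auto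
  then show "closure P \<inter> Q = {}" using T by auto
  then show "closure P \<subseteq> P \<union> K" using \<open>closure P \<subseteq> S\<close> un by auto
qed

text \<open>Among the points of \<open>Q\<close> above a point of \<open>P\<close> the lowest one lies outside \<open>W\<close> by hypothesis
  \<open>below\<close>; so the minimising pairs stay away from \<open>K\<close>.\<close>

lemma shortest_vertical_segment:
  fixes P Q K W :: "'a::euclidean_space set"
  assumes P: "closure P \<subseteq> P \<union> K" "closure P \<inter> Q = {}" and Q: "closure Q \<subseteq> Q \<union> K" "closure Q \<inter> P = {}"
    and W: "openin (top_of_set (closure Q)) W" "K \<subseteq> W"
    and bdd: "\<And>L. bounded {x \<in> Q. \<exists>s>0. s \<le> L \<and> x - s *\<^sub>R e \<in> P}"
    and ex: "\<exists>x\<in>Q. \<exists>s>0. x - s *\<^sub>R e \<in> P"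
    and below: "\<And>a. a \<in> W \<Longrightarrow> \<exists>s>0. a - s *\<^sub>R e \<in> Q \<and> (\<forall>t. 0 < t \<and> t < s \<longrightarrow> a - t *\<^sub>R e \<notin> P)"
    and above: "\<And>z s. z \<in> K \<Longrightarrow> s > 0 \<Longrightarrow> z + s *\<^sub>R e \<in> Q \<Longrightarrow> \<exists>t. 0 < t \<and> t < s \<and> z + t *\<^sub>R e \<in> P"
  obtains x l where "x \<in> Q" "l > 0" "x - l *\<^sub>R e \<in> P"
    "\<And>x' s. x' \<in> Q \<Longrightarrow> 0 < s \<Longrightarrow> s < l \<Longrightarrow> x' - s *\<^sub>R e \<notin> P"
proof -
  have lowest: "\<exists>s1. 0 < s1 \<and> s1 \<le> s \<and> y + s1 *\<^sub>R e \<in> Q - W" if y: "y \<in> P" "s > 0" "y + s *\<^sub>R e \<in> Q" for y s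
  proof -
    define T where "T = {0..s} \<inter> (\<lambda>t. y + t *\<^sub>R e) -` closure Q"
    have "closed ((\<lambda>t. y + t *\<^sub>R e) -` closure Q)"
      by (intro closed_vimage continuous_intros) auto
    then have "compact T"
      unfolding T_def by (intro compact_Int_closed) auto
    moreover have "s \<in> T" using y closure_subset by (auto simp: T_def)
    ultimately obtain s1 where s1: "s1 \<in> T" "\<And>t. t \<in> T \<Longrightarrow> s1 \<le> t"
      using compact_attains_inf[of T] by blast
    let ?w = "y + s1 *\<^sub>R e"
    have w: "?w \<in> closure Q" "0 \<le> s1" "s1 \<le> s" using s1(1) by (auto simp: T_def)
    \<comment> \<open>The foot \<open>y\<close> lies in \<open>P\<close>, which the closure of
      \<open>Q\<close> does not meet.\<close>
    have "s1 \<noteq> 0" using w(1) y(1) Q(2) by auto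
    then have "s1 > 0" using w(2) by simp
    have "?w \<notin> W"
    \<comment> \<open>The point of \<open>Q\<close> supplied by \<open>below\<close> is not lower
      than \<open>y\<close>, since otherwise \<open>y\<close> would be a forbidden point of
      \<open>P\<close> in between. So it contradicts the minimality of \<open>s1\<close>.\<close>
    proof
      assume "?w \<in> W"
      then obtain t where t: "t > 0" "?w - t *\<^sub>R e \<in> Q" "\<And>t'. 0 < t' \<Longrightarrow> t' < t \<Longrightarrow> ?w - t' *\<^sub>R e \<notin> P"
        using below by blast
      have "?w - s1 *\<^sub>R e \<in> P" using y(1) by simp
      then have "t \<le> s1" using t(3)[of s1] \<open>s1 > 0\<close> by force
      have eq: "?w - t *\<^sub>R e = y + (s1 - t) *\<^sub>R e" by (simp add: algebra_simps)
      have "y + (s1 - t) *\<^sub>R e \<in> closure Q"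
        using t(2) closure_subset[of Q] unfolding eq by blast
      then have "s1 - t \<in> T"
        using t(1) \<open>t \<le> s1\<close> w(3) by (auto simp: T_def)
      then show False using s1(2) t(1) by fastforce
    qed
    then have "?w \<in> Q - W" using w(1) Q(1) W(2) by blast
    then show ?thesis using \<open>s1 > 0\<close> w(3) by blast
  qed
  obtain x0 L where x0: "x0 \<in> Q" "L > 0" "x0 - L *\<^sub>R e \<in> P" using ex by blast
  \<comment> \<open>By \<open>lowest\<close>, confining upper ends to \<open>Q - W\<close> never
    lengthens a segment. As \<open>W\<close> is open in \<open>closure Q\<close> and contains
    \<open>K\<close>, upper ends then cannot converge to \<open>K\<close>.\<close>
  define Z where "Z = {(x, s). x \<in> Q - W \<and> 0 < s \<and> s \<le> L \<and> x - s *\<^sub>R e \<in> P}"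
  have ZI: "\<exists>x. \<exists>s1\<le>s. (x, s1) \<in> Z" if xs: "x' \<in> Q" "0 < s" "s \<le> L" "x' - s *\<^sub>R e \<in> P" for x' s
  proof -
    obtain s1 where "0 < s1" "s1 \<le> s" "x' - s *\<^sub>R e + s1 *\<^sub>R e \<in> Q - W"
      using lowest[of "x' - s *\<^sub>R e" s] xs by auto
    then show ?thesis
      using xs by (intro exI[of _ "x' - s *\<^sub>R e + s1 *\<^sub>R e"] exI[of _ s1]) (auto simp: Z_def)
  qed
  have "Z \<subseteq> {x \<in> Q. \<exists>s>0. s \<le> L \<and> x - s *\<^sub>R e \<in> P} \<times> {0..L}" by (auto simp: Z_def)
  then have "bounded Z"
    by (rule bounded_subset[rotated]) (intro bounded_Times bdd bounded_closed_interval)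
  then have "compact (closure Z)" by simp
  moreover have "closure Z \<noteq> {}" using ZI[OF x0(1,2) _ x0(3)] by auto
  moreover have "continuous_on (closure Z) snd" by (intro continuous_intros)
  ultimately have "\<exists>q\<in>closure Z. \<forall>q'\<in>closure Z. snd q \<le> snd q'"
    by (rule continuous_attains_inf)
  then obtain q where q: "q \<in> closure Z" "\<And>q'. q' \<in> closure Z \<Longrightarrow> snd q \<le> snd q'"
    by (elim bexE) (rule that, auto)
  obtain x l where xl: "q = (x, l)" by force
  have "closed (closure Q - W)"
    using W(1) by (metis closedin_closed_eq closed_closure closedin_diff closedin_self)
  then have "closed ((closure Q - W) \<times> {0..L})" by (intro closed_Times) auto
  moreover have "Z \<subseteq> (closure Q - W) \<times> {0..L}" using closure_subset[of Q] by (auto simp: Z_def)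
  ultimately have "q \<in> (closure Q - W) \<times> {0..L}" using q(1) closure_minimal by blast
  then have "x \<in> closure Q - W" and l: "0 \<le> l" "l \<le> L" by (auto simp: xl)
  then have xQ: "x \<in> Q - W" using Q(1) W(2) by blast
  have "closed ((\<lambda>q. fst q - snd q *\<^sub>R e) -` closure P)"
    by (intro closed_vimage continuous_intros) auto
  moreover have "Z \<subseteq> (\<lambda>q. fst q - snd q *\<^sub>R e) -` closure P"
    using closure_subset[of P] by (auto simp: Z_def)
  ultimately have "closure Z \<subseteq> (\<lambda>q. fst q - snd q *\<^sub>R e) -` closure P"
    by (rule closure_minimal[rotated])
  then have y: "x - l *\<^sub>R e \<in> closure P" using q(1) by (auto simp: xl)
  have "l \<noteq> 0" using y xQ P(2) by auto
  then have "l > 0" using l by simp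
  have min: "l \<le> s" if "(x', s) \<in> Z" for x' s
    using q(2)[of "(x', s)"] that closure_subset[of Z] by (auto simp: xl)
  \<comment> \<open>For a foot on \<open>K\<close>, \<open>above\<close> would supply a point of
    \<open>P\<close> strictly inside the segment, and \<open>x\<close> with that foot would be a
    shorter element of \<open>Z\<close>.\<close>
  have "x - l *\<^sub>R e \<notin> K"
  proof
    assume "x - l *\<^sub>R e \<in> K"
    then obtain t where t: "0 < t" "t < l" "x - l *\<^sub>R e + t *\<^sub>R e \<in> P"
      using above[of "x - l *\<^sub>R e" l] xQ \<open>l > 0\<close> by auto
    have eq: "x - l *\<^sub>R e + t *\<^sub>R e = x - (l - t) *\<^sub>R e" by (simp add: algebra_simps)
    have "(x, l - t) \<in> Z" using t(1,2) t(3)[unfolded eq] xQ l by (simp add: Z_def)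
    then show False using min t(1) by fastforce
  qed
  then have yP: "x - l *\<^sub>R e \<in> P" using y P(1) by blast
  show ?thesis
  proof (rule that[OF _ \<open>l > 0\<close> yP])
    show "x \<in> Q" using xQ by simp
    show "x' - s *\<^sub>R e \<notin> P" if xs: "x' \<in> Q" "0 < s" "s < l" for x' s
    proof
      assume "x' - s *\<^sub>R e \<in> P"
      then obtain x'' s1 where "s1 \<le> s" "(x'', s1) \<in> Z"
        using ZI[of x' s] xs l \<open>x' - s *\<^sub>R e \<in> P\<close> by auto
      then show False using min xs(3) by fastforce
    qed
  qed
qed

text \<open>Far from the origin both ends of such a segment survive in \<open>scaled_end r\<close>,
  while its rescaled length is at most \<open>L / r\<close>. For one admissible
  \<open>r > L / \<delta>\<close> this is less than the guaranteed gap.\<close>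

lemma bounded_of_separated_ends:
  fixes S :: "'a::euclidean_space set"
  assumes sep: "delta_separated_ends \<delta> S" and "\<delta> > 0" "closed S"
    and P: "openin (top_of_set S) P" "connected P" and Q: "openin (top_of_set S) Q" "connected Q"
    and "P \<inter> Q = {}" and dense: "S \<subseteq> closure P \<union> closure Q" and "bounded (closure P \<inter> closure Q)"
    and "norm e = 1"
  shows "bounded {x \<in> Q. \<exists>s>0. s \<le> L \<and> x - s *\<^sub>R e \<in> P}"
proof -
  let ?X = "top_of_set S"
  have sub: "P \<subseteq> S" "Q \<subseteq> S" using P Q openin_imp_subset by blast+
  have clS: "closure P \<subseteq> S" "closure Q \<subseteq> S" using sub \<open>closed S\<close> by (simp_all add: closure_minimal)
  have cl: "?X closure_of T = closure T" if "closure T \<subseteq> S" "T \<subseteq> S" for T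
    using that by (auto simp: closure_of_subtopology Int_absorb1)
  \<comment> \<open>\<open>S - closure A\<close> lies between \<open>B\<close> and
    \<open>closure B\<close>, so its closure is \<open>closure B\<close>. The resulting expression
    is symmetric in the two sets, which gives the required equality of frontiers.\<close>
  have fr: "?X frontier_of (closure A) = closure A \<inter> closure B"
    if AB: "openin ?X B" "A \<inter> B = {}" "S \<subseteq> closure A \<union> closure B" "closure A \<subseteq> S" "closure B \<subseteq> S" "B \<subseteq> S" for A B
  proof -
    obtain T where T: "open T" "B = S \<inter> T" using AB(1) by (auto simp: openin_open)
    have "closure A \<inter> T = {}"
      using open_Int_closure_eq_empty[OF T(1), of A] AB(2,4) T(2) closure_subset[of A] by auto
    then have "B \<subseteq> S - closure A" using T(2) by auto
    moreover have "S - closure A \<subseteq> closure B" using AB(3) by auto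
    ultimately have "closure (S - closure A) = closure B"
      by (metis closure_closure closure_mono subset_antisym)
    then have "?X closure_of (S - closure A) = closure B"
      using AB(5) by (subst cl) auto
    moreover have "?X closure_of (closure A) = closure A"
      using AB(4) by (subst cl) auto
    ultimately show ?thesis by (simp add: frontier_of_closures)
  qed
  have frP: "?X frontier_of (?X closure_of P) = closure P \<inter> closure Q"
    using fr[of Q P] cl[OF clS(1) sub(1)] assms sub clS by auto
  have frQ: "?X frontier_of (?X closure_of Q) = closure P \<inter> closure Q"
    using fr[of P Q] cl[OF clS(2) sub(2)] assms sub clS by auto
  have "closure P \<union> closure Q = S" using dense clS by blast
  then have "\<forall>\<^sub>F r in at_top. scaled_end r P = {} \<or> scaled_end r Q = {} \<or>
      Inf {norm (x1 - x2) | x1 x2. x1 \<in> scaled_end r P \<and> x2 \<in> scaled_end r Q} \<ge> \<delta>"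
    using sep[unfolded delta_separated_ends_def, rule_format, of P Q] assms frP frQ
      cl[OF clS(1) sub(1)] cl[OF clS(2) sub(2)] clS by auto
  moreover have "\<forall>\<^sub>F r in at_top. r > max 1 (L / \<delta>)" by (rule eventually_gt_at_top)
  ultimately have "\<forall>\<^sub>F r in at_top. r > max 1 (L / \<delta>) \<and> (scaled_end r P = {} \<or> scaled_end r Q = {} \<or>
      Inf {norm (x1 - x2) | x1 x2. x1 \<in> scaled_end r P \<and> x2 \<in> scaled_end r Q} \<ge> \<delta>)"
    by eventually_elim auto
  then obtain r where r: "r > 1" "r > L / \<delta>"
    and far: "scaled_end r P = {} \<or> scaled_end r Q = {} \<or>
      Inf {norm (x1 - x2) | x1 x2. x1 \<in> scaled_end r P \<and> x2 \<in> scaled_end r Q} \<ge> \<delta>"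
    using eventually_happens'[OF trivial_limit_at_top_linorder] by fastforce
  have in_end: "(1 / r) *\<^sub>R x \<in> scaled_end r T" if "x \<in> T" "norm x \<ge> r" for x :: 'a and T
    using that r(1) by (auto simp: scaled_end_def field_simps)
  \<comment> \<open>The extra \<open>L\<close> keeps the other end of the segment outside the ball
    of radius \<open>r\<close> as well.\<close>
  have "norm x < r + L" if x: "x \<in> Q" "s > 0" "s \<le> L" "x - s *\<^sub>R e \<in> P" for x s
  proof (rule ccontr)
    assume "\<not> norm x < r + L"
    moreover have "norm x \<le> norm (x - s *\<^sub>R e) + s"
      using norm_triangle_ineq[of "x - s *\<^sub>R e" "s *\<^sub>R e"] \<open>norm e = 1\<close> \<open>s > 0\<close> by simp
    ultimately have n: "norm x \<ge> r" "norm (x - s *\<^sub>R e) \<ge> r" using x by auto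
    let ?x = "(1 / r) *\<^sub>R x" and ?y = "(1 / r) *\<^sub>R (x - s *\<^sub>R e)"
    have ends: "?y \<in> scaled_end r P" "?x \<in> scaled_end r Q"
      using in_end x n by blast+
    let ?D = "{norm (x1 - x2) | x1 x2. x1 \<in> scaled_end r P \<and> x2 \<in> scaled_end r Q}"
    have "Inf ?D \<le> norm (?y - ?x)"
      using ends by (intro cInf_lower bdd_belowI[of _ 0]) auto
    moreover have "\<delta> \<le> Inf ?D" using far ends by blast
    moreover have "norm (?y - ?x) = s / r"
      using r(1) \<open>s > 0\<close> \<open>norm e = 1\<close> by (simp add: scaleR_diff_right)
    ultimately have "\<delta> \<le> s / r" by linarith
    then have "\<delta> * r \<le> s" using r(1) by (simp add: field_simps)
    moreover have "L < \<delta> * r" using r(2) \<open>\<delta> > 0\<close> by (simp add: field_simps)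
    ultimately show False using x(3) by simp
  qed
  then show ?thesis
    by (intro boundedI[of _ "r + L"]) (auto intro: less_imp_le)
qed

section \<open>The embedded sphere has no interior in the hypersurface\<close>

lemma smooth_immersion_locally_injective:
  fixes X :: "'b::euclidean_space \<Rightarrow> 'a::euclidean_space"
  assumes "open U" "u0 \<in> U" and X: "smooth_on U X" "inj (frechet_derivative X (at u0))"
  obtains r where "r > 0" "ball u0 r \<subseteq> U" "inj_on X (ball u0 r)"
proof -
  let ?D = "\<lambda>u. frechet_derivative X (at u)"
  have der: "(X has_derivative ?D u) (at u)" if "u \<in> U" for u
    using smooth_on_has_derivative[OF X(1) assms(1) that] .
  have lin: "linear (?D u0)" using has_derivative_linear[OF der[OF assms(2)]] .
  obtain g where g: "linear g" "g \<circ> ?D u0 = id"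
    using linear_injective_left_inverse[OF lin X(2)] by blast
  define B where "B u = Blinfun (?D u)" for u
  have B: "blinfun_apply (B u) = ?D u" if "u \<in> U" for u
    unfolding B_def by (rule bounded_linear_Blinfun_apply, rule has_derivative_bounded_linear[OF der[OF that]])
  \<comment> \<open>Smoothness controls the derivative on each fixed vector; in finite dimension
    this gives continuity in operator norm, which local injectivity requires.\<close>
  have "continuous_on U B"
  proof (rule continuous_on_blinfun_componentwise)
    fix i :: 'b
    show "continuous_on U (\<lambda>u. blinfun_apply (B u) i)"
      using smooth_on_imp_continuous_on[OF smooth_on_frechet_derivative[OF X(1)]]
      by (rule continuous_on_eq) (simp add: B)
  qed
  then have cB: "isCont B u0" using assms continuous_on_eq_continuous_at by blast
  have on: "\<exists>d>0. \<forall>u. dist u0 u < d \<longrightarrow> onorm (\<lambda>v. ?D u v - ?D u0 v) < \<epsilon>" if \<epsilon>: "\<epsilon> > 0" for \<epsilon>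
  proof -
    obtain d where d: "d > 0" "\<And>u. dist u u0 < d \<Longrightarrow> dist (B u) (B u0) < \<epsilon>"
      using cB[unfolded continuous_at_eps_delta, rule_format, OF \<epsilon>] by blast
    obtain d' where d': "d' > 0" "ball u0 d' \<subseteq> U" using assms open_contains_ball by metis
    have "onorm (\<lambda>v. ?D u v - ?D u0 v) < \<epsilon>" if "dist u0 u < min d d'" for u
    proof -
      have "u \<in> U" using that d'(2) by auto
      then have "norm (B u - B u0) = onorm (\<lambda>v. ?D u v - ?D u0 v)"
        using B assms(2) by (simp add: norm_blinfun.rep_eq minus_blinfun.rep_eq)
      moreover have "dist u u0 < d" using that by (simp add: dist_commute)
      ultimately show ?thesis using d(2)[of u] by (simp add: dist_norm)
    qed
    then show ?thesis using d(1) d'(1) by (intro exI[of _ "min d d'"]) auto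
  qed
  show ?thesis
  proof (rule has_derivative_locally_injective[OF assms(2,1) _ g(2) der on])
    show "bounded_linear g" using g(1) by (simp add: linear_linear)
  qed (use that in auto)
qed

text \<open>Otherwise a ball of the \<open>n\<close>-dimensional parameter space would map
  injectively through a chart and the inverse of \<open>\<alpha>\<close> into the unit sphere of
  that same space. By invariance of domain the image would be open, but the sphere is null.\<close>

lemma embedded_sphere_nowhere_dense:
  fixes F :: "'m \<Rightarrow> 'a::euclidean_space" and \<alpha> :: "'b::euclidean_space \<Rightarrow> 'a"
    and \<Phi> :: "('b set \<times> ('b \<Rightarrow> 'm)) set"
  assumes man: "smooth_manifold M \<Phi>" and imm: "smooth_immersion \<Phi> F"
    and \<alpha>: "embedding_map (top_of_set (sphere (0::'b) 1)) (top_of_set (F ` topspace M)) \<alpha>"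
    and "open T" "T \<inter> F ` topspace M \<subseteq> \<alpha> ` sphere 0 1"
  shows "T \<inter> F ` topspace M = {}"
proof (rule ccontr)
  let ?S = "F ` topspace M" and ?K = "\<alpha> ` sphere 0 1"
  assume "T \<inter> ?S \<noteq> {}"
  then obtain q where "q \<in> topspace M" "F q \<in> T" by blast
  then obtain V \<phi> where c: "(V, \<phi>) \<in> \<Phi>" "q \<in> \<phi> ` V"
    using man by (auto simp: smooth_manifold_def)
  then obtain u0 where "u0 \<in> V" "q = \<phi> u0" by blast
  let ?X = "F \<circ> \<phi>"
  have V: "open V" "\<phi> ` V \<subseteq> topspace M"
    using man c(1) by (auto simp: smooth_manifold_def)
  have X: "smooth_on V ?X" "inj (frechet_derivative ?X (at u0))"
    using imm c(1) \<open>u0 \<in> V\<close> by (auto simp: smooth_immersion_def)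
  define V' where "V' = V \<inter> ?X -` T"
  have "open V'"
    unfolding V'_def using smooth_on_imp_continuous_on[OF X(1)] V(1) \<open>open T\<close> by (intro continuous_open_preimage)
  moreover have "u0 \<in> V'" using \<open>u0 \<in> V\<close> \<open>F q \<in> T\<close> \<open>q = \<phi> u0\<close> by (simp add: V'_def)
  moreover have "V' \<subseteq> V" by (auto simp: V'_def)
  ultimately obtain r where r: "r > 0" "ball u0 r \<subseteq> V'" "inj_on ?X (ball u0 r)"
    using smooth_immersion_locally_injective[of V' u0 ?X] X smooth_on_subset[OF X(1)] by metis
  have XK: "?X ` ball u0 r \<subseteq> ?K"
  proof
    fix p assume "p \<in> ?X ` ball u0 r"
    then obtain u where "u \<in> V'" "p = ?X u" using r(2) by blast
    then have "p \<in> T \<inter> ?S" using V(2) by (auto simp: V'_def)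
    then show "p \<in> ?K" using assms(5) by blast
  qed
  have "homeomorphic_map (top_of_set (sphere (0::'b) 1)) (top_of_set ?K) \<alpha>"
  proof -
    have "continuous_map (top_of_set (sphere (0::'b) 1)) (top_of_set ?S) \<alpha>"
      using homeomorphic_imp_continuous_map[OF \<alpha>[unfolded embedding_map_def]]
      by (rule continuous_map_into_fulltopology)
    from continuous_map_image_subset_topspace[OF this] have "?K \<subseteq> ?S" by simp
    then show ?thesis
      using \<alpha> by (simp add: embedding_map_def subtopology_subtopology Int_absorb1)
  qed
  then obtain \<beta> where \<beta>: "homeomorphic_maps (top_of_set (sphere (0::'b) 1)) (top_of_set ?K) \<alpha> \<beta>"
    by (auto simp: homeomorphic_map_maps)
  then have \<beta>c: "continuous_on ?K \<beta>" and \<beta>s: "\<And>x. x \<in> ?K \<Longrightarrow> \<beta> x \<in> sphere 0 1" and \<alpha>\<beta>: "\<And>x. x \<in> ?K \<Longrightarrow> \<alpha> (\<beta> x) = x"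
    by (auto simp: homeomorphic_maps_def continuous_map_in_subtopology)
  have "continuous_on (ball u0 r) ?X"
    using smooth_on_imp_continuous_on[OF X(1)] r(2) \<open>V' \<subseteq> V\<close> continuous_on_subset by blast
  then have "continuous_on (ball u0 r) (\<beta> \<circ> ?X)"
    using continuous_on_subset[OF \<beta>c XK] by (rule continuous_on_compose)
  moreover have "inj_on \<beta> ?K" using \<alpha>\<beta> by (metis inj_onI)
  then have "inj_on (\<beta> \<circ> ?X) (ball u0 r)"
    using comp_inj_on[OF r(3) inj_on_subset[OF _ XK]] by blast
  ultimately have "open ((\<beta> \<circ> ?X) ` ball u0 r)"
    by (rule invariance_of_domain[OF _ open_ball])
  moreover have "(\<beta> \<circ> ?X) ` ball u0 r \<subseteq> sphere 0 1"
    using XK \<beta>s by fastforce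
  then have "negligible ((\<beta> \<circ> ?X) ` ball u0 r)"
    using negligible_sphere negligible_subset by blast
  ultimately show False
    using open_not_negligible[of "(\<beta> \<circ> ?X) ` ball u0 r"] r(1) by simp
qed

section \<open>Scaling of directions, adapted coordinates and countable atlases\<close>

text \<open>Stretching the direction by \<open>t\<close> divides the length by \<open>t\<close>.
  This makes the exceptional directions a cone, as needed to compare \<open>cone_over A\<close> with
  them.\<close>

lemma grazing_scaled:
  assumes "(e, u, v, s) \<in> grazing U X V Y \<rho>" "\<rho> > 0" "t > 0" "linear (frechet_derivative X (at u))"
  shows "\<exists>\<rho>'>0. (t *\<^sub>R e, u, v, s / t) \<in> grazing U X V Y \<rho>'"
proof -
  \<comment> \<open>The first bound serves the two balls; the second serves the window of lengths,
    which \<open>t\<close> rescales.\<close>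
  define \<rho>' where "\<rho>' = min \<rho> (\<rho> / t)"
  have \<rho>': "\<rho>' > 0" "\<rho>' \<le> \<rho>" "t * \<rho>' \<le> \<rho>"
    using assms(2,3) by (auto simp: \<rho>'_def min_def field_simps)
  have g: "u \<in> U" "v \<in> V" "s > 0" "X u = Y v + s *\<^sub>R e" "e \<in> range (frechet_derivative X (at u))"
    and sep: "\<And>u' v' s'. u' \<in> U \<inter> ball u \<rho> \<Longrightarrow> v' \<in> V \<inter> ball v \<rho> \<Longrightarrow> s' \<in> {s-\<rho><..<s} \<Longrightarrow> X u' \<noteq> Y v' + s' *\<^sub>R e"
    using assms(1) by (auto simp: grazing_def)
  obtain a where "e = frechet_derivative X (at u) a" using g(5) by blast
  then have "t *\<^sub>R e = frechet_derivative X (at u) (t *\<^sub>R a)"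
    using linear_cmul[OF assms(4)] by simp
  then have "t *\<^sub>R e \<in> range (frechet_derivative X (at u))" by blast
  moreover have "X u' \<noteq> Y v' + s' *\<^sub>R (t *\<^sub>R e)"
    if "u' \<in> U \<inter> ball u \<rho>'" "v' \<in> V \<inter> ball v \<rho>'" "s' \<in> {s / t - \<rho>'<..<s / t}" for u' v' s'
  proof -
    have "s - t * \<rho>' < t * s'" "t * s' < s"
      using that(3) \<open>t > 0\<close> by (auto simp: field_simps)
    then have "s' * t \<in> {s-\<rho><..<s}" using \<rho>'(3) by (auto simp: mult.commute)
    then show ?thesis
      using sep[of u' v' "s' * t"] that(1,2) \<rho>'(2) by auto
  qed
  ultimately have "(t *\<^sub>R e, u, v, s / t) \<in> grazing U X V Y \<rho>'"
    using g \<open>t > 0\<close> by (auto simp: grazing_def)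
  then show ?thesis using \<rho>'(1) by blast
qed

lemma exists_orthonormal_basis_ending_with:
  fixes a :: "'a::euclidean_space"
  assumes "norm a = 1"
  obtains e where "orthonormal_basis e" "e (DIM('a)) = a"
proof -
  obtain B where B: "a \<in> B" "pairwise orthogonal B" "\<And>x. x \<in> B \<Longrightarrow> norm x = 1"
    "independent B" "card B = DIM('a)" "span B = UNIV"
    using vector_in_orthonormal_basis[OF assms] by metis
  have "finite B" using B(4) independent_imp_finite by blast
  then have "card {1..<DIM('a)} = card (B - {a})" using B(1,5) by simp
  then obtain f where f: "bij_betw f {1..<DIM('a)} (B - {a})"
    using finite_same_card_bij[of "{1..<DIM('a)}" "B - {a}"] \<open>finite B\<close> by auto
  define e where "e i = (if i = DIM('a) then a else f i)" for i
  have split: "{1..DIM('a)} = insert (DIM('a)) {1..<DIM('a)}"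
    using DIM_positive[where 'a='a] by auto
  have "bij_betw e {1..<DIM('a)} (B - {a})"
    using f by (rule bij_betw_cong[THEN iffD1, rotated]) (auto simp: e_def)
  then have "bij_betw e ({1..<DIM('a)} \<union> {DIM('a)}) ((B - {a}) \<union> {e (DIM('a))})"
    by (intro notIn_Un_bij_betw) (auto simp: e_def)
  then have e: "bij_betw e {1..DIM('a)} B"
    unfolding split using B(1) by (simp add: e_def insert_absorb del: One_nat_def)
  have "orthonormal_basis e"
    unfolding orthonormal_basis_def
  proof (intro conjI ballI)
    show "span (e ` {1..DIM('a)}) = UNIV" using e B(6) by (simp add: bij_betw_def)
    fix i j assume ij: "i \<in> {1..DIM('a)}" "j \<in> {1..DIM('a)}"
    then have "e i \<in> B" "e j \<in> B" "e i = e j \<longleftrightarrow> i = j"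
      using e by (auto simp: bij_betw_def inj_on_eq_iff)
    then show "e i \<bullet> e j = (if i = j then 1 else 0)"
      using pairwiseD[OF B(2), of "e i" "e j"] B(3)[of "e i"] by (auto simp: orthogonal_def norm_eq_1)
  qed
  then show ?thesis using that by (simp add: e_def)
qed

text \<open>Only the last basis vector matters: the coordinate conditions become statements about
  segments parallel to it.\<close>

lemma same_vertical_height_less_iff:
  fixes e :: "nat \<Rightarrow> 'a::euclidean_space"
  assumes "orthonormal_basis e"
  shows "same_vertical e x y \<and> height e y < height e x \<longleftrightarrow> (\<exists>s>0. y = x - s *\<^sub>R e (DIM('a)))"
proof
  let ?n = "DIM('a)"
  have on: "e i \<bullet> e j = (if i = j then 1 else 0)" if "i \<in> {1..?n}" "j \<in> {1..?n}" for i j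
    using assms that by (auto simp: orthonormal_basis_def)
  have n: "?n \<in> {1..?n}" using DIM_positive[where 'a='a] by auto
  {
    assume a: "same_vertical e x y \<and> height e y < height e x"
    let ?z = "x - y"
    have "?z = (\<Sum>i\<in>{1..?n}. (?z \<bullet> e i) *\<^sub>R e i)"
      using orthonormal_family_expand[of "{1..?n}" e ?z] on assms by (simp add: orthonormal_basis_def)
    also have "\<dots> = (\<Sum>i\<in>{1..?n}. if i = ?n then (?z \<bullet> e ?n) *\<^sub>R e ?n else 0)"
      using a by (intro sum.cong) (auto simp: same_vertical_def inner_diff_left)
    also have "\<dots> = (?z \<bullet> e ?n) *\<^sub>R e ?n" using n by simp
    finally have "y = x - (?z \<bullet> e ?n) *\<^sub>R e ?n" by (simp add: algebra_simps)
    moreover have "?z \<bullet> e ?n > 0" using a by (simp add: height_def inner_diff_left)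
    ultimately show "\<exists>s>0. y = x - s *\<^sub>R e ?n" by blast
  next
    assume "\<exists>s>0. y = x - s *\<^sub>R e ?n"
    then obtain s where "s > 0" "y = x - s *\<^sub>R e ?n" by blast
    then show "same_vertical e x y \<and> height e y < height e x"
      using on n by (auto simp: same_vertical_def height_def inner_diff_left)
  }
qed

text \<open>Countability keeps the union of the null sets belonging to pairs of charts null.\<close>

lemma countable_subatlas:
  assumes "smooth_manifold M \<Phi>"
  obtains \<Phi>' where "\<Phi>' \<subseteq> \<Phi>" "countable \<Phi>'" "topspace M = (\<Union>(V, \<phi>)\<in>\<Phi>'. \<phi> ` V)"
proof -
  let ?im = "\<lambda>(V, \<phi>). \<phi> ` V"
  have "second_countable M" and op: "\<And>c. c \<in> \<Phi> \<Longrightarrow> openin M (?im c)" and un: "\<Union>(?im ` \<Phi>) = topspace M"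
    using assms by (auto simp: smooth_manifold_def)
  have "\<exists>\<V>. countable \<V> \<and> \<V> \<subseteq> ?im ` \<Phi> \<and> \<Union>\<V> = topspace M"
    by (rule Lindelof_spaceD[OF second_countable_imp_Lindelof_space[OF \<open>second_countable M\<close>] _ un])
      (use op in blast)
  then obtain \<V> where \<V>: "countable \<V>" "\<V> \<subseteq> ?im ` \<Phi>" "\<Union>\<V> = topspace M"
    by (elim exE conjE)
  have "\<exists>\<Phi>'. countable \<Phi>' \<and> \<Phi>' \<subseteq> \<Phi> \<and> \<V> = ?im ` \<Phi>'"
    by (rule countable_subset_image[THEN iffD1]) (use \<V> in blast)
  then obtain \<Phi>' where "countable \<Phi>'" "\<Phi>' \<subseteq> \<Phi>" "\<V> = ?im ` \<Phi>'"
    by (elim exE conjE)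
  then show ?thesis using that[of \<Phi>'] \<V>(3) by simp
qed

section \<open>A non-tangential direction in \<open>A\<close> and the contradiction at its shortest
  segment\<close>

theorem corollary8:
  fixes M :: "'m topology"
    and \<Phi> :: "('b::euclidean_space set \<times> ('b \<Rightarrow> 'm)) set"
    and F :: "'m \<Rightarrow> 'a::euclidean_space"
    and S Sp Sm A :: "'a set"
    and \<alpha> :: "'b \<Rightarrow> 'a"
    and \<delta> :: real
  assumes "\<delta> > 0"
    and "properly_immersed_hypersurface M \<Phi> F"
    and "complete_hypersurface M F"
    and "S = F ` topspace M"
    and "delta_separated_ends \<delta> S"
    and "embedding_map (top_of_set (sphere (0::'b) 1)) (top_of_set S) \<alpha>"
    and "components (S - \<alpha> ` sphere 0 1) = {Sp, Sm}"
    and "Sp \<noteq> Sm"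
    and "A \<subseteq> sphere 0 1"
    and "sphere_measurable A"
    and "sphere_measure A \<noteq> 0"
    and cond1: "\<And>e. orthonormal_basis e \<Longrightarrow> e (DIM('a)) \<in> A \<Longrightarrow>
      \<exists>x\<in>Sm. \<exists>y\<in>Sp. same_vertical e x y \<and> height e y < height e x"
    and cond2: "\<And>e. orthonormal_basis e \<Longrightarrow> e (DIM('a)) \<in> A \<Longrightarrow>
      \<exists>V. neighbourhood_in (closure Sm) (\<alpha> ` sphere 0 1) V \<and>
        (\<forall>a\<in>V. \<exists>u\<in>Sm. same_vertical e a u \<and> height e a > height e u \<and>
          \<not> (\<exists>v\<in>Sp. same_vertical e a v \<and> height e a > height e v \<and> height e v > height e u))"
    and cond3: "\<And>e z b. orthonormal_basis e \<Longrightarrow> e (DIM('a)) \<in> A \<Longrightarrow>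
      z \<in> \<alpha> ` sphere 0 1 \<Longrightarrow> b \<in> Sm \<Longrightarrow> same_vertical e z b \<Longrightarrow> height e b > height e z \<Longrightarrow>
      \<exists>w\<in>Sp. same_vertical e z w \<and> height e b > height e w \<and> height e w > height e z"
  shows "\<not> self_shrinker \<Phi> F"
proof
  assume shrinker: "self_shrinker \<Phi> F"
  let ?K = "\<alpha> ` sphere 0 1"
  have dim: "DIM('a) = DIM('b) + 1" and man: "smooth_manifold M \<Phi>" and imm: "smooth_immersion \<Phi> F"
    and proper: "proper_map M euclidean F"
    using assms(2) by (auto simp: properly_immersed_hypersurface_def)
  have chart: "open V" "smooth_on V (F \<circ> \<phi>)" "\<phi> ` V \<subseteq> topspace M" if "(V, \<phi>) \<in> \<Phi>" for V \<phi>
    using man imm that by (auto simp: smooth_manifold_def smooth_immersion_def)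
  have inj: "inj (frechet_derivative (F \<circ> \<phi>) (at u))" if "(V, \<phi>) \<in> \<Phi>" "u \<in> V" for V \<phi> u
    using imm that by (auto simp: smooth_immersion_def)
  have H: "mean_curvature (F \<circ> \<phi>) \<nu> u = (F \<circ> \<phi>) u \<bullet> \<nu> u / 2"
    if "(V, \<phi>) \<in> \<Phi>" "open U" "U \<subseteq> V" "smooth_unit_normal U (F \<circ> \<phi>) \<nu>" "u \<in> U" for V \<phi> U \<nu> u
    using shrinker that unfolding self_shrinker_def by blast
  obtain \<Phi>' where \<Phi>': "\<Phi>' \<subseteq> \<Phi>" "countable \<Phi>'" "topspace M = (\<Union>(V, \<phi>)\<in>\<Phi>'. \<phi> ` V)"
    using countable_subatlas[OF man] by blast
  \<comment> \<open>All radii \<open>\<rho>\<close> are united because the neighbourhood on which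
    minimality will hold is known only after the direction has been chosen.\<close>
  define Bad where "Bad = (\<lambda>c :: ('b set \<times> ('b \<Rightarrow> 'm)) \<times> ('b set \<times> ('b \<Rightarrow> 'm)). \<Union>\<rho>\<in>{0<..}. fst ` grazing (fst (fst c)) (F \<circ> snd (fst c)) (fst (snd c)) (F \<circ> snd (snd c)) \<rho>)"
  have BadI: "e \<in> Bad ((U, \<phi>), (V, \<psi>))" if "(e, u, v, s) \<in> grazing U (F \<circ> \<phi>) V (F \<circ> \<psi>) \<rho>" "\<rho> > 0" for e u v s U V \<phi> \<psi> \<rho>
    using that by (force simp: Bad_def)
  have "negligible (Bad ((U, \<phi>), (V, \<psi>)))" if c: "(U, \<phi>) \<in> \<Phi>" "(V, \<psi>) \<in> \<Phi>" for U V \<phi> \<psi>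
    using negligible_grazing[OF dim chart(1)[OF c(1)] chart(1)[OF c(2)] chart(2)[OF c(1)] inj[OF c(1)]
        smooth_on_imp_continuous_on[OF chart(2)[OF c(2)]]]
    by (simp add: Bad_def)
  then have neg: "negligible (\<Union>(Bad ` (\<Phi>' \<times> \<Phi>')))"
    using \<Phi>'(2) subsetD[OF \<Phi>'(1)] by (intro negligible_countable_Union) auto
  have "\<not> A \<subseteq> \<Union>(Bad ` (\<Phi>' \<times> \<Phi>'))"
  proof
    assume A: "A \<subseteq> \<Union>(Bad ` (\<Phi>' \<times> \<Phi>'))"
    \<comment> \<open>\<open>A\<close> itself is null in the ambient space, so only its cone can
      contradict positive measure on the sphere.\<close>
    have "cone_over A \<subseteq> \<Union>(Bad ` (\<Phi>' \<times> \<Phi>'))"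
    proof
      fix x assume "x \<in> cone_over A"
      then obtain t a where ta: "x = t *\<^sub>R a" "t > 0" "a \<in> A" by (auto simp: cone_over_def)
      then obtain U \<phi> V \<psi> where c: "(U, \<phi>) \<in> \<Phi>'" "(V, \<psi>) \<in> \<Phi>'" "a \<in> Bad ((U, \<phi>), (V, \<psi>))"
        using A by fast
      then obtain \<rho> u v s where g: "\<rho> > 0" "(a, u, v, s) \<in> grazing U (F \<circ> \<phi>) V (F \<circ> \<psi>) \<rho>"
        by (auto simp: Bad_def)
      have U: "(U, \<phi>) \<in> \<Phi>" using c(1) \<Phi>'(1) by blast
      have "u \<in> U" using g(2) by (simp add: grazing_def)
      then have "linear (frechet_derivative (F \<circ> \<phi>) (at u))"
        using smooth_on_has_derivative[OF chart(2)[OF U] chart(1)[OF U]] has_derivative_linear by blast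
      then have "x \<in> Bad ((U, \<phi>), (V, \<psi>))"
        using grazing_scaled[OF g(2,1) ta(2)] BadI ta(1) by blast
      then show "x \<in> \<Union>(Bad ` (\<Phi>' \<times> \<Phi>'))" using c by blast
    qed
    then have "negligible (cone_over A)" using neg negligible_subset by blast
    then have "emeasure lebesgue (cone_over A) = 0"
      using negligible_iff_emeasure0[of "cone_over A"] assms(10) by (simp add: sphere_measurable_def)
    then show False using assms(11) by (simp add: sphere_measure_def)
  qed
  then obtain e where e: "e \<in> A" "e \<notin> \<Union>(Bad ` (\<Phi>' \<times> \<Phi>'))" by blast
  then have "norm e = 1" using assms(9) by auto
  obtain b where b: "orthonormal_basis b" "b (DIM('a)) = e"
    using exists_orthonormal_basis_ending_with[OF \<open>norm e = 1\<close>] by blast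
  have below: "same_vertical b x y \<and> height b y < height b x \<longleftrightarrow> (\<exists>s>0. y = x - s *\<^sub>R e)" for x y
    using same_vertical_height_less_iff[OF b(1), of x y] b(2) by simp
  have sym: "same_vertical b x y \<longleftrightarrow> same_vertical b y x" for x y
    by (auto simp: same_vertical_def)
  have height: "height b (x + t *\<^sub>R e) = height b x + t" for x t
    using b(2) \<open>norm e = 1\<close> by (simp add: height_def inner_add_left norm_eq_1)
  have height': "height b (x - t *\<^sub>R e) = height b x - t" for x t
    using height[of x "- t"] by simp
  have "closed S"
    using proper assms(4) by (auto simp: proper_map_def closed_map_def)
  have "compact ?K"
  proof -
    have "continuous_map (top_of_set (sphere (0::'b) 1)) (top_of_set S) \<alpha>"
      using homeomorphic_imp_continuous_map[OF assms(6)[unfolded embedding_map_def]]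
      by (rule continuous_map_into_fulltopology)
    then have "continuous_on (sphere 0 1) \<alpha>"
      by (auto simp: continuous_map_in_subtopology)
    then show ?thesis by (intro compact_continuous_image) auto
  qed
  note P = two_components_of_complement[OF \<open>closed S\<close> \<open>compact ?K\<close> assms(7,8)]
  have "components (S - ?K) = {Sm, Sp}" using assms(7) by auto
  note Q = two_components_of_complement[OF \<open>closed S\<close> \<open>compact ?K\<close> this assms(8)[symmetric]]
  \<comment> \<open>Separated ends speak of open sets whose closures fill \<open>S\<close>; for this
    no part of the sphere may be isolated from both components.\<close>
  have dense: "S \<subseteq> closure Sp \<union> closure Sm"
  proof -
    let ?T = "- (closure Sp \<union> closure Sm)"
    have T: "?T \<inter> F ` topspace M \<subseteq> ?K"
      using P(7) closure_subset[of Sp] closure_subset[of Sm] assms(4) by blast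
    have "open ?T" by (intro open_Compl closed_Un) auto
    then have "?T \<inter> F ` topspace M = {}"
      using embedded_sphere_nowhere_dense[OF man imm assms(6)[unfolded assms(4)] _ T] by blast
    then show ?thesis using assms(4) by blast
  qed
  have "closure Sp \<inter> closure Sm \<subseteq> ?K" using P(8,9) Q(8,9) by blast
  then have "bounded (closure Sp \<inter> closure Sm)"
    using compact_imp_bounded[OF \<open>compact ?K\<close>] bounded_subset by blast
  note bdd = bounded_of_separated_ends[OF assms(5,1) \<open>closed S\<close> P(1,2) Q(1,2) P(5) dense this \<open>norm e = 1\<close>]
  obtain V where V: "neighbourhood_in (closure Sm) ?K V"
    and V2: "\<And>a. a \<in> V \<Longrightarrow> \<exists>u\<in>Sm. same_vertical b a u \<and> height b a > height b u \<and>
          \<not> (\<exists>v\<in>Sp. same_vertical b a v \<and> height b a > height b v \<and> height b v > height b u)"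
    using cond2[OF b(1)] b(2) e(1) by auto
  obtain W where W: "openin (top_of_set (closure Sm)) W" "?K \<subseteq> W" "W \<subseteq> V"
    using V by (auto simp: neighbourhood_in_def)
  obtain x l where xl: "x \<in> Sm" "l > 0" "x - l *\<^sub>R e \<in> Sp"
    and min: "\<And>x' s. x' \<in> Sm \<Longrightarrow> 0 < s \<Longrightarrow> s < l \<Longrightarrow> x' - s *\<^sub>R e \<notin> Sp"
  proof (rule shortest_vertical_segment[OF P(8,9) Q(8,9) W(1,2) bdd])
    show "\<exists>x\<in>Sm. \<exists>s>0. x - s *\<^sub>R e \<in> Sp"
      using cond1[OF b(1)] b(2) e(1) below by metis
    show "\<exists>s>0. a - s *\<^sub>R e \<in> Sm \<and> (\<forall>t. 0 < t \<and> t < s \<longrightarrow> a - t *\<^sub>R e \<notin> Sp)" if a: "a \<in> W" for a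
    proof -
      obtain u where u: "u \<in> Sm" "same_vertical b a u \<and> height b u < height b a"
        and no: "\<And>v. v \<in> Sp \<Longrightarrow> same_vertical b a v \<and> height b v < height b a \<Longrightarrow> \<not> height b v > height b u"
        using V2[of a] a W(3) by blast
      obtain s where s: "s > 0" "u = a - s *\<^sub>R e" using u(2) below by blast
      have "a - t *\<^sub>R e \<notin> Sp" if "0 < t" "t < s" for t
        using no[of "a - t *\<^sub>R e"] below that s(2) height' by auto
      then show ?thesis using s u(1) by blast
    qed
    show "\<exists>t. 0 < t \<and> t < s \<and> z + t *\<^sub>R e \<in> Sp" if z: "z \<in> ?K" "s > 0" "z + s *\<^sub>R e \<in> Sm" for z s
    proof -
      have zs: "same_vertical b z (z + s *\<^sub>R e) \<and> height b z < height b (z + s *\<^sub>R e)"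
        using below[of "z + s *\<^sub>R e" z] sym z(2) by auto
      then obtain w where w: "w \<in> Sp" "same_vertical b z w" "height b w < height b (z + s *\<^sub>R e)" "height b z < height b w"
        using cond3[OF b(1) _ z(1,3)] b(2) e(1) by auto
      then obtain t where t: "t > 0" "z = w - t *\<^sub>R e" using below[of w z] sym by blast
      then have "w = z + t *\<^sub>R e" by simp
      then show ?thesis using w(1,3) t(1) height by auto
    qed
  qed (rule that)
  have lift: "\<exists>U \<phi> u. (U, \<phi>) \<in> \<Phi>' \<and> u \<in> U \<and> p = (F \<circ> \<phi>) u" if "p \<in> S" for p
    using that assms(4) \<Phi>'(3) by fastforce
  \<comment> \<open>Openness in \<open>S\<close> keeps the sheet through a chosen preimage inside
    the set, even if other sheets pass through the same point.\<close>
  have local: "\<exists>\<rho>>0. \<forall>u'\<in>U \<inter> ball u \<rho>. (F \<circ> \<phi>) u' \<in> T"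
    if c: "(U, \<phi>) \<in> \<Phi>'" "u \<in> U" "(F \<circ> \<phi>) u \<in> T" and T: "openin (top_of_set S) T" for U \<phi> u T
  proof -
    have c': "(U, \<phi>) \<in> \<Phi>" using c(1) \<Phi>'(1) by blast
    obtain T' where T': "open T'" "T = S \<inter> T'" using T by (auto simp: openin_open)
    have "open (U \<inter> (F \<circ> \<phi>) -` T')"
      using chart(1)[OF c'] smooth_on_imp_continuous_on[OF chart(2)[OF c']] T'(1)
      by (intro continuous_open_preimage)
    moreover have "u \<in> U \<inter> (F \<circ> \<phi>) -` T'" using c(2,3) T'(2) by auto
    ultimately obtain \<rho> where "\<rho> > 0" "ball u \<rho> \<subseteq> U \<inter> (F \<circ> \<phi>) -` T'"
      using open_contains_ball by metis
    then show ?thesis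
      using chart(3)[OF c'] assms(4) T'(2) by (intro exI[of _ \<rho>]) auto
  qed
  obtain U \<phi> u where u: "(U, \<phi>) \<in> \<Phi>'" "u \<in> U" "x = (F \<circ> \<phi>) u" using lift[of x] xl(1) Q(4) by blast
  obtain V' \<psi> v where v: "(V', \<psi>) \<in> \<Phi>'" "v \<in> V'" "x - l *\<^sub>R e = (F \<circ> \<psi>) v"
    using lift[of "x - l *\<^sub>R e"] xl(3) P(4) by blast
  obtain \<rho>1 where \<rho>1: "\<rho>1 > 0" "\<And>u'. u' \<in> U \<inter> ball u \<rho>1 \<Longrightarrow> (F \<circ> \<phi>) u' \<in> Sm"
    using local[OF u(1,2) _ Q(1)] xl(1) u(3) by metis
  obtain \<rho>2 where \<rho>2: "\<rho>2 > 0" "\<And>v'. v' \<in> V' \<inter> ball v \<rho>2 \<Longrightarrow> (F \<circ> \<psi>) v' \<in> Sp"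
    using local[OF v(1,2) _ P(1)] xl(3) v(3) by metis
  \<comment> \<open>The entry \<open>l\<close> keeps the competing lengths positive, as
    \<open>min\<close> requires.\<close>
  define \<rho> where "\<rho> = Min {\<rho>1, \<rho>2, l}"
  have \<rho>: "\<rho> > 0" "\<rho> \<le> \<rho>1" "\<rho> \<le> \<rho>2" "\<rho> \<le> l" using \<rho>1(1) \<rho>2(1) xl(2) by (auto simp: \<rho>_def)
  have sep: "(F \<circ> \<phi>) u' \<noteq> (F \<circ> \<psi>) v' + s *\<^sub>R e"
    if "u' \<in> U \<inter> ball u \<rho>" "v' \<in> V' \<inter> ball v \<rho>" "l - \<rho> < s" "s < l" for u' v' s
  proof
    assume eq: "(F \<circ> \<phi>) u' = (F \<circ> \<psi>) v' + s *\<^sub>R e"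
    have "(F \<circ> \<phi>) u' \<in> Sm" using that(1) \<rho>(2) by (intro \<rho>1(2)) auto
    moreover have "(F \<circ> \<psi>) v' \<in> Sp" using that(2) \<rho>(3) by (intro \<rho>2(2)) auto
    ultimately show False using min[of "(F \<circ> \<phi>) u'" s] eq that(3,4) \<rho>(4) by simp
  qed
  have eq: "(F \<circ> \<phi>) u = (F \<circ> \<psi>) v + l *\<^sub>R e" using u(3) v(3) by (metis diff_add_cancel)
  have U: "(U, \<phi>) \<in> \<Phi>" and V': "(V', \<psi>) \<in> \<Phi>" using u(1) v(1) \<Phi>'(1) by auto
  \<comment> \<open>The choice of \<open>e\<close> outside \<open>Bad\<close> enters here: the
    shortest segment meets every other clause of \<open>grazing\<close>.\<close>
  have tangent: "e \<notin> range (frechet_derivative (F \<circ> \<phi>) (at u))"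
  proof
    assume "e \<in> range (frechet_derivative (F \<circ> \<phi>) (at u))"
    then have "(e, u, v, l) \<in> grazing U (F \<circ> \<phi>) V' (F \<circ> \<psi>) \<rho>"
      unfolding grazing_def using u(2) v(2) xl(2) eq sep by simp
    then show False using BadI[OF _ \<rho>(1)] e(2) u(1) v(1) by blast
  qed
  show False
  proof (rule minimal_segment_impossible[OF dim chart(1)[OF U] u(2) chart(1)[OF V'] v(2) chart(2)[OF U]
        inj[OF U u(2)] chart(2)[OF V'] inj[OF V' v(2)] _ _ eq xl(2) tangent \<rho>(1)])
    show "mean_curvature (F \<circ> \<phi>) \<nu> u = (F \<circ> \<phi>) u \<bullet> \<nu> u / 2"
      if "open T" "T \<subseteq> U" "smooth_unit_normal T (F \<circ> \<phi>) \<nu>" "u \<in> T" for T \<nu>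
      using H[OF U that] .
    show "mean_curvature (F \<circ> \<psi>) \<mu> v = (F \<circ> \<psi>) v \<bullet> \<mu> v / 2"
      if "open T" "T \<subseteq> V'" "smooth_unit_normal T (F \<circ> \<psi>) \<mu>" "v \<in> T" for T \<mu>
      using H[OF V' that] .
  qed (rule sep)
qed

end
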